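(* The Grushin plane $\mathbb G_2$, equipped with the Lebesgue measure, satisfies the measure contraction property $\mathrm{MCP}(K,N)$ if and only if $N\ge5$ and $K\le0$.
   Context: The Grushin plane $\mathbb G_2$ is the sub-Riemannian structure on $\mathbb R^2$ with generating vector fields $X_1=\partial_x$, $X_2=x\,\partial_y$: $\mathcal D_q=\mathrm{span}\{X_1(q),X_2(q)\}$ with $g_q(v,v)=\inf\{u_1^2+u_2^2:u_1X_1(q)+u_2X_2(q)=v\}$. A horizontal curve is an absolutely continuous $\gamma:[0,1]\to\mathbb R^2$ with $\dot\gamma=u_1(t)X_1(\gamma)+u_2(t)X_2(\gamma)$ a.e. for a control $u\in L^2([0,1],\mathbb R^2)$; its length is $\int_0^1\sqrt{g(\dot\gamma,\dot\gamma)}dt$, and $d=d_{SR}$ is the infimum of lengths of horizontal curves joining two points. A minimizing geodesic is a constant-speed horizontal curve whose length equals the distance between its endpoints. $Z_t(A,B)$ is the set of all points $\gamma(t)$ with $\gamma:[0,1]\to\mathbb R^2$ a minimizing geodesic, $\gamma(0)\in A$, $\gamma(1)\in B$. Measure contraction property (Ohta), for a space such as this one in which, for each $x$, almost every point is joined to $x$ by a unique minimizing geodesic. Let $K\in\mathbb R$ and $N>1$, or $K\le0$ and $N=1$. Put $s_K(\theta)=\sin(\sqrt K\theta)/\sqrt K$ if $K>0$, $s_K(\theta)=\theta$ if $K=0$, $s_K(\theta)=\sinh(\sqrt{-K}\theta)/\sqrt{-K}$ if $K<0$. Then $\mathrm{MCP}(K,N)$ holds with respect to the measure $\mathsf m=\mathcal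 L^2$ if for every $x$ and every Borel set $B$ with $0<\mathsf m(B)<\infty$ (and, if $K>0$, $B$ contained in the open ball of center $x$ and radius $\pi\sqrt{(N-1)/K}$), $$\mathsf m(Z_t(\{x\},B))\ge\int_B t\left[\frac{s_K\big(t\,d(x,z)/\sqrt{N-1}\big)}{s_K\big(d(x,z)/\sqrt{N-1}\big)}\right]^{N-1}d\mathsf m(z),\qquad\forall\,t\in[0,1],$$ with the conventions $0/0=1$ and that the bracketed term to the power $N-1$ equals $1$ when $K\le0$, $N=1$. For $K=0$ this reads $\mathsf m(Z_t(\{x\},B))\ge t^N\mathsf m(B)$. *)

theory Defs
  imports "HOL-Analysis.Analysis"
begin

definition abs_continuous_on :: "real \<Rightarrow> real \<Rightarrow> (real \<Rightarrow> 'a::real_normed_vector) \<Rightarrow> bool" where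
  "abs_continuous_on lo hi \<gamma> \<longleftrightarrow>
     (\<forall>\<epsilon>>0. \<exists>\<delta>>0. \<forall>(I::nat set) a b.
        finite I \<longrightarrow> (\<forall>i\<in>I. lo \<le> a i \<and> a i \<le> b i \<and> b i \<le> hi) \<longrightarrow>
        disjoint_family_on (\<lambda>i. {a i<..<b i}) I \<longrightarrow>
        (\<Sum>i\<in>I. b i - a i) < \<delta> \<longrightarrow>
        (\<Sum>i\<in>I. norm (\<gamma> (b i) - \<gamma> (a i))) < \<epsilon>)"


type_synonym plane = "real \<times> real"

definition X1 :: "plane \<Rightarrow> plane" where
  "X1 q = (1, 0)"

definition X2 :: "plane \<Rightarrow> plane" where
  "X2 q = (0, fst q)"

text \<open>The squared sub-Riemannian norm of \<open>v\<close> at \<open>q\<close>. It is meaningful only for \<open>v\<close> in the span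
  of \<open>X1 q\<close> and \<open>X2 q\<close> (otherwise the infimum is over the empty set and its value is
  unspecified). The velocity of a horizontal curve lies in this span almost everywhere.\<close>

definition grushin_metric :: "plane \<Rightarrow> plane \<Rightarrow> real" where
  "grushin_metric q v =
     Inf {u1\<^sup>2 + u2\<^sup>2 | u1 u2. u1 *\<^sub>R X1 q + u2 *\<^sub>R X2 q = v}"

text \<open>Curves are functions on all of \<open>real\<close>, but only their restriction to \<open>{0..1}\<close> matters.\<close>

definition horizontal :: "(real \<Rightarrow> plane) \<Rightarrow> bool" where
  "horizontal \<gamma> \<longleftrightarrow> abs_continuous_on 0 1 \<gamma> \<and>
     (\<exists>u :: real \<Rightarrow> real \<times> real.
        set_borel_measurable lebesgue {0..1} u \<and>
        set_integrable lebesgue {0..1} (\<lambda>t. (norm (u t))\<^sup>2) \<and>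
        (AE t in lebesgue. t \<in> {0..1} \<longrightarrow>
           (\<gamma> has_vector_derivative
              fst (u t) *\<^sub>R X1 (\<gamma> t) + snd (u t) *\<^sub>R X2 (\<gamma> t)) (at t within {0..1})))"

definition speed :: "(real \<Rightarrow> plane) \<Rightarrow> real \<Rightarrow> real" where
  "speed \<gamma> t = sqrt (grushin_metric (\<gamma> t) (vector_derivative \<gamma> (at t within {0..1})))"

definition curve_length :: "(real \<Rightarrow> plane) \<Rightarrow> real" where
  "curve_length \<gamma> = (LINT t:{0..1}|lebesgue. speed \<gamma> t)"

text \<open>Any two points are joined by a horizontal curve, so the infimum is over a nonempty set.\<close>

definition grushin_dist :: "plane \<Rightarrow> plane \<Rightarrow> real" where
  "grushin_dist p q = Inf {curve_length \<gamma> | \<gamma>. horizontal \<gamma> \<and> \<gamma> 0 = p \<and> \<gamma> 1 = q}"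

definition minimizing_geodesic :: "(real \<Rightarrow> plane) \<Rightarrow> bool" where
  "minimizing_geodesic \<gamma> \<longleftrightarrow> horizontal \<gamma> \<and>
     (\<exists>c. AE t in lebesgue. t \<in> {0..1} \<longrightarrow> speed \<gamma> t = c) \<and>
     curve_length \<gamma> = grushin_dist (\<gamma> 0) (\<gamma> 1)"

definition intermediate_points :: "real \<Rightarrow> plane set \<Rightarrow> plane set \<Rightarrow> plane set" where
  "intermediate_points t A B = {\<gamma> t | \<gamma>. minimizing_geodesic \<gamma> \<and> \<gamma> 0 \<in> A \<and> \<gamma> 1 \<in> B}"


definition s_fun :: "real \<Rightarrow> real \<Rightarrow> real" where
  "s_fun K \<theta> =
     (if K > 0 then sin (sqrt K * \<theta>) / sqrt K
      else if K = 0 then \<theta>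
      else sinh (sqrt (- K) * \<theta>) / sqrt (- K))"

text \<open>Division with the convention \<open>0 / 0 = 1\<close>.\<close>

definition ratio01 :: "real \<Rightarrow> real \<Rightarrow> real" where
  "ratio01 a b = (if a = 0 \<and> b = 0 then 1 else a / b)"

definition mcp_factor :: "real \<Rightarrow> real \<Rightarrow> real \<Rightarrow> real \<Rightarrow> real" where
  "mcp_factor K N t r =
     (if K \<le> 0 \<and> N = 1 then 1
      else ratio01 (s_fun K (t * r / sqrt (N - 1))) (s_fun K (r / sqrt (N - 1))) powr (N - 1))"

text \<open>Intended for \<open>N > 1\<close>, or \<open>K \<le> 0\<close> and \<open>N = 1\<close>. The set of intermediate points need not be
  Borel, hence the completed measure \<open>lebesgue\<close>.\<close>

definition grushin_MCP :: "real \<Rightarrow> real \<Rightarrow> bool" where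
  "grushin_MCP K N \<longleftrightarrow>
     (\<forall>x. \<forall>B \<in> sets borel.
        0 < emeasure lebesgue B \<longrightarrow> emeasure lebesgue B < \<infinity> \<longrightarrow>
        (K > 0 \<longrightarrow> B \<subseteq> {z. grushin_dist x z < pi * sqrt ((N - 1) / K)}) \<longrightarrow>
        (\<forall>t \<in> {0..1}.
           emeasure lebesgue (intermediate_points t {x} B) \<ge>
             (\<integral>\<^sup>+z\<in>B. ennreal (t * mcp_factor K N t (grushin_dist x z)) \<partial>lebesgue)))"

end

theory Submission
  imports Defs "HOL-Real_Asymp.Real_Asymp"
begin

text \<open>
  Along a horizontal curve write \<open>x' = a\<close> and \<open>y' = x * b\<close>, with \<open>b = 0\<close> where \<open>x = 0\<close>; then the
  squared speed is \<open>a\<^sup>2 + b\<^sup>2\<close>. Fix a number \<open>\<omega>\<close> with \<open>\<bar>\<omega>\<bar> < pi\<close>, the multiplier of the constraint on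
  the height \<open>y\<close>. Up to complete squares, \<open>(a\<^sup>2 + b\<^sup>2) / 2 - \<omega> * x * b\<close> is the derivative of a function
  \<open>S t x\<close> that solves the Hamilton--Jacobi equation of the harmonic oscillator with frequency \<open>\<omega>\<close>.
  This calibration bounds the length from below (\<open>length_bound\<close>), and equality forces
  \<open>b = \<omega> * x\<close> and \<open>x = x0 * cos (\<omega> * t) + q * sin (\<omega> * t)\<close> (\<open>rigidity\<close>). Hence the minimizing
  geodesics are known: two end points with different heights determine one of them with \<open>\<bar>\<omega>\<bar> < pi\<close>,
  except for the end points on the line \<open>x = - x0\<close> that only \<open>\<bar>\<omega>\<bar> = pi\<close> reaches; for these the
  calibrations with \<open>\<omega>\<close> tending to \<open>\<plusminus>pi\<close> still control the minimizers (\<open>cut_geodesic\<close>).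

  Off null sets, the abscissa \<open>x\<close> of the end point and the angle \<open>\<omega>\<close> are coordinates of the plane.
  The height of the end point is strictly increasing in \<open>\<omega>\<close>, so substitution on each vertical line
  and Fubini's theorem express areas in these coordinates. The contraction towards the base point by
  the factor \<open>t\<close> reads \<open>(x, \<omega>) \<mapsto> (mid x0 t x \<omega>, t * \<omega>)\<close> there and is affine in \<open>x\<close>. This gives the
  measure of the set of intermediate points as an integral of an explicit density \<open>weight\<close>
  (\<open>intermediate_points_measure\<close>). Up to the common factor \<open>1 / sin \<omega>\<close>, the densities of the set and
  of the contracted set are \<open>jac x0 q \<omega>\<close> and \<open>t * jac x0 q (t * \<omega>)\<close>, with \<open>jac\<close> a quadratic form
  in \<open>(x0, q)\<close>. The property \<open>MCP(0,5)\<close> amounts to the monotonicity of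
  \<open>jac x0 q \<omega> / \<omega> ^ 4\<close>, and this is the semidefiniteness of a quadratic form whose
  discriminant is estimated in \<open>jac_discriminant\<close>. A bound \<open>K < 0\<close> or a larger \<open>N\<close> only
  decreases the coefficient in the definition.

  Conversely, testing the inequality on small boxes in angular coordinates yields a pointwise
  inequality between the densities (\<open>MCP_pointwise\<close>). On short geodesics close to the segment from
  \<open>(c, 0)\<close> to \<open>(- 2 * c, 0)\<close>, which crosses the singular line, it becomes
  \<open>t powr N \<le> t\<^sup>2 * (1 - 3 * t + 3 * t\<^sup>2)\<close>; comparing derivatives at \<open>t = 1\<close> gives \<open>N \<ge> 5\<close>. If \<open>K > 0\<close>,
  the coefficient blows up at distance \<open>pi * sqrt ((N - 1) / K)\<close>, whereas dilations make the quotient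
  of the densities constant along suitable end points; so no \<open>K > 0\<close> is possible.
\<close>

section \<open>Absolutely continuous functions\<close>

text \<open>The definition speaks of families that are indexed by natural numbers; tagged divisions of an
  interval are indexed by themselves.\<close>

lemma abs_continuous_onD:
  fixes f :: "real \<Rightarrow> 'a::real_normed_vector"
  assumes "abs_continuous_on lo hi f" "\<epsilon> > 0"
  shows "\<exists>\<delta>>0. \<forall>(I::'i set) a b. finite I \<longrightarrow> (\<forall>i\<in>I. lo \<le> a i \<and> a i \<le> b i \<and> b i \<le> hi) \<longrightarrow>
        disjoint_family_on (\<lambda>i. {a i<..<b i}) I \<longrightarrow> (\<Sum>i\<in>I. b i - a i) < \<delta> \<longrightarrow>
        (\<Sum>i\<in>I. norm (f (b i) - f (a i))) < \<epsilon>"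
proof -
  obtain \<delta> where "\<delta> > 0" and \<delta>: "\<And>(J::nat set) a b. finite J \<Longrightarrow>
        (\<forall>i\<in>J. lo \<le> a i \<and> a i \<le> b i \<and> b i \<le> hi) \<Longrightarrow>
        disjoint_family_on (\<lambda>i. {a i<..<b i}) J \<Longrightarrow> (\<Sum>i\<in>J. b i - a i) < \<delta> \<Longrightarrow>
        (\<Sum>i\<in>J. norm (f (b i) - f (a i))) < \<epsilon>"
    using assms unfolding abs_continuous_on_def by meson
  show ?thesis
  proof (intro exI[of _ \<delta>] conjI allI impI \<open>\<delta> > 0\<close>)
    fix I :: "'i set" and a b :: "'i \<Rightarrow> real"
    assume I: "finite I" "\<forall>i\<in>I. lo \<le> a i \<and> a i \<le> b i \<and> b i \<le> hi"
      "disjoint_family_on (\<lambda>i. {a i<..<b i}) I" "(\<Sum>i\<in>I. b i - a i) < \<delta>"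
    obtain e where e: "bij_betw e {0..<card I} I"
      using ex_bij_betw_nat_finite[OF \<open>finite I\<close>] by blast
    have im: "e j \<in> I" if "j < card I" for j
      using e that by (auto simp: bij_betw_def)
    have "disjoint_family_on (\<lambda>j. {a (e j)<..<b (e j)}) {0..<card I}"
      unfolding disjoint_family_on_def
    proof (intro ballI impI)
      fix j k assume jk: "j \<in> {0..<card I}" "k \<in> {0..<card I}" "j \<noteq> k"
      then have "e j \<noteq> e k"
        using e by (auto simp: bij_betw_def inj_on_def)
      then show "{a (e j)<..<b (e j)} \<inter> {a (e k)<..<b (e k)} = {}"
        using I(3) im jk unfolding disjoint_family_on_def by (metis atLeastLessThan_iff)
    qed
    moreover have "(\<Sum>j\<in>{0..<card I}. b (e j) - a (e j)) < \<delta>"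
      using sum.reindex_bij_betw[OF e, of "\<lambda>i. b i - a i"] I(4) by simp
    ultimately have "(\<Sum>j\<in>{0..<card I}. norm (f (b (e j)) - f (a (e j)))) < \<epsilon>"
      using I(2) im by (intro \<delta>) auto
    then show "(\<Sum>i\<in>I. norm (f (b i) - f (a i))) < \<epsilon>"
      using sum.reindex_bij_betw[OF e, of "\<lambda>i. norm (f (b i) - f (a i))"] by simp
  qed
qed

text \<open>The derivative may be missing or arbitrary on a null set \<open>N\<close>. Replace it by \<open>0\<close> there and choose a
  gauge that forces the intervals with tags in \<open>N\<close> into an open set of small measure: absolute
  continuity makes the variation of \<open>f\<close> over these intervals small, and the other intervals are
  handled by differentiability as usual.\<close>

lemma abs_continuous_on_fundamental_theorem:
  fixes f :: "real \<Rightarrow> real"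
  assumes "a \<le> b" and ac: "abs_continuous_on a b f" and N: "negligible N"
    and der: "\<And>t. t \<in> {a..b} - N \<Longrightarrow> (f has_real_derivative f' t) (at t within {a..b})"
  shows "(f' has_integral (f b - f a)) {a..b}"
proof -
  define g where "g t = (if t \<in> N then 0 else f' t)" for t
  have "(g has_integral (f b - f a)) {a..b}"
    unfolding has_integral_real
  proof (intro allI impI)
    fix e :: real assume "e > 0"
    define e1 where "e1 = e / (2 * (b - a + 1))"
    have "e1 > 0" using \<open>e > 0\<close> \<open>a \<le> b\<close> by (simp add: e1_def)
    have "\<forall>t. \<exists>d>0. t \<in> {a..b} - N \<longrightarrow>
            (\<forall>y\<in>{a..b}. \<bar>y - t\<bar> < d \<longrightarrow> \<bar>f y - f t - (y - t) * f' t\<bar> \<le> e1 * \<bar>y - t\<bar>)"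
    proof
      fix t
      show "\<exists>d>0. t \<in> {a..b} - N \<longrightarrow>
            (\<forall>y\<in>{a..b}. \<bar>y - t\<bar> < d \<longrightarrow> \<bar>f y - f t - (y - t) * f' t\<bar> \<le> e1 * \<bar>y - t\<bar>)"
      proof (cases "t \<in> {a..b} - N")
        case True
        then have "(f has_derivative (*) (f' t)) (at t within {a..b})"
          using der[OF True] by (simp only: has_field_derivative_def)
        then have "\<exists>d>0. \<forall>y\<in>{a..b}. norm (y - t) < d \<longrightarrow>
            norm (f y - f t - f' t * (y - t)) \<le> e1 * norm (y - t)"
          using \<open>e1 > 0\<close> unfolding has_derivative_within_alt by blast
        then show ?thesis by (auto simp: mult.commute[of "f' t"])
      qed (auto intro: exI[of _ 1])
    qed
    from choice[OF this] obtain d where dall: "\<forall>t. d t > 0 \<and> (t \<in> {a..b} - N \<longrightarrow>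
        (\<forall>y\<in>{a..b}. \<bar>y - t\<bar> < d t \<longrightarrow> \<bar>f y - f t - (y - t) * f' t\<bar> \<le> e1 * \<bar>y - t\<bar>))" ..
    have dpos: "d t > 0" for t using dall by simp
    have d: "\<bar>f y - f t - (y - t) * f' t\<bar> \<le> e1 * \<bar>y - t\<bar>"
      if "t \<in> {a..b} - N" "y \<in> {a..b}" "\<bar>y - t\<bar> < d t" for t y
      using dall that by simp
    obtain \<delta> where "\<delta> > 0" and \<delta>: "\<forall>(I::(real \<times> real set) set) a' b'. finite I \<longrightarrow>
        (\<forall>i\<in>I. a \<le> a' i \<and> a' i \<le> b' i \<and> b' i \<le> b) \<longrightarrow>
        disjoint_family_on (\<lambda>i. {a' i<..<b' i}) I \<longrightarrow> (\<Sum>i\<in>I. b' i - a' i) < \<delta> \<longrightarrow>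
        (\<Sum>i\<in>I. norm (f (b' i) - f (a' i))) < e / 2"
      using abs_continuous_onD[OF ac half_gt_zero[OF \<open>e > 0\<close>]] by (elim exE conjE) (rule that)
    obtain U where U: "open U" "N \<subseteq> U" "U - N \<in> lmeasurable" "emeasure lebesgue (U - N) < ennreal \<delta>"
      using sets_lebesgue_outer_open[OF negligible_imp_sets[OF N] \<open>\<delta> > 0\<close>] by metis
    have Umeas: "U \<in> lmeasurable"
      using fmeasurable.Un[OF negligible_imp_measurable[OF N] U(3)] \<open>N \<subseteq> U\<close>
      by (simp add: Un_absorb1)
    have "measure lebesgue U = measure lebesgue (N \<union> (U - N))"
      using \<open>N \<subseteq> U\<close> by (simp add: Un_absorb1)
    also have "\<dots> \<le> measure lebesgue N + measure lebesgue (U - N)"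
      using U(3) negligible_imp_measurable[OF N] by (intro measure_Un_le) auto
    also have "\<dots> = measure lebesgue (U - N)"
      using negligible_imp_measure0[OF N] by simp
    also have "\<dots> < \<delta>"
      using U(3,4) by (simp add: emeasure_eq_measure2 ennreal_less_iff)
    finally have Usmall: "measure lebesgue U < \<delta>" .
    define \<gamma> where "\<gamma> t = (if t \<in> N then U else ball t (d t))" for t
    have gauge: "gauge \<gamma>"
      unfolding gauge_def \<gamma>_def using U dpos by auto
    have close: "norm ((\<Sum>(x, k)\<in>D. measure lborel k *\<^sub>R g x) - (f b - f a)) < e"
      if D: "D tagged_division_of {a..b}" and fine: "\<gamma> fine D" for D
    proof -
      have fin: "finite D" using D by auto
      have Dk: "\<exists>l u. k = {l..u} \<and> a \<le> l \<and> l \<le> x \<and> x \<le> u \<and> u \<le> b" if xk: "(x, k) \<in> D" for x k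
      proof -
        obtain l u where k: "k = cbox l u" using tagged_division_ofD(4)[OF D xk] by blast
        moreover have "x \<in> k" "k \<subseteq> {a..b}" using tagged_division_ofD(2,3)[OF D xk] by auto
        ultimately show ?thesis by auto
      qed
      define \<Delta> where "\<Delta> = (\<lambda>(x::real, k). f (Sup k) - f (Inf k))"
      define D1 where "D1 = {p \<in> D. fst p \<in> N}"
      have D1fin: "finite D1" using fin by (simp add: D1_def)
      have tele: "(\<Sum>p\<in>D. \<Delta> p) = f b - f a"
        using additive_tagged_division_1[OF \<open>a \<le> b\<close> D, of f] by (simp add: \<Delta>_def)
      have cont: "(\<Sum>p\<in>D. measure lborel (snd p)) = b - a"
        using additive_content_tagged_division[of D a b] D \<open>a \<le> b\<close> by (simp add: case_prod_beta)
      have disj: "disjoint_family_on (\<lambda>p. {Inf (snd p)<..<Sup (snd p)}) D"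
        unfolding disjoint_family_on_def
      proof (intro ballI impI)
        fix p q assume pq: "p \<in> D" "q \<in> D" "p \<noteq> q"
        obtain x k y l where xk: "p = (x, k)" "q = (y, l)" by fastforce
        have "interior k \<inter> interior l = {}"
          using tagged_division_ofD(5)[OF D] pq xk by metis
        then show "{Inf (snd p)<..<Sup (snd p)} \<inter> {Inf (snd q)<..<Sup (snd q)} = {}"
          using Dk[of x k] Dk[of y l] pq xk by (auto simp: interior_atLeastAtMost_real)
      qed
      have "(\<Sum>p\<in>D1. Sup (snd p) - Inf (snd p)) =
          (\<Sum>p\<in>D1. measure lebesgue {Inf (snd p)<..<Sup (snd p)})"
      proof (rule sum.cong[OF refl])
        fix p assume "p \<in> D1"
        then obtain l u where "snd p = {l..u}" "l \<le> u"
          using Dk[of "fst p" "snd p"] by (auto simp: D1_def)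
        then show "Sup (snd p) - Inf (snd p) = measure lebesgue {Inf (snd p)<..<Sup (snd p)}"
          by simp
      qed
      also have "\<dots> = measure lebesgue (\<Union>p\<in>D1. {Inf (snd p)<..<Sup (snd p)})"
      proof (rule measure_finite_Union[symmetric])
        show "disjoint_family_on (\<lambda>p. {Inf (snd p)<..<Sup (snd p)}) D1"
          using disj by (auto simp: disjoint_family_on_def D1_def)
      next
        fix p assume "p \<in> D1"
        show "emeasure lebesgue {Inf (snd p)<..<Sup (snd p)} \<noteq> \<infinity>"
          by (cases "Inf (snd p) \<le> Sup (snd p)") auto
      qed (use D1fin in auto)
      also have "\<dots> \<le> measure lebesgue U"
      proof (rule measure_mono_fmeasurable)
        show "(\<Union>p\<in>D1. {Inf (snd p)<..<Sup (snd p)}) \<subseteq> U"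
        proof (rule UN_least)
          fix p assume p: "p \<in> D1"
          obtain x k where xk: "p = (x, k)" by fastforce
          then have "(x, k) \<in> D" "x \<in> N" using p by (auto simp: D1_def)
          moreover have "k \<subseteq> \<gamma> x" using fine \<open>(x, k) \<in> D\<close> by (auto simp: fine_def)
          ultimately show "{Inf (snd p)<..<Sup (snd p)} \<subseteq> U"
            using Dk[of x k] xk by (auto simp: \<gamma>_def)
        qed
      qed (use Umeas D1fin in \<open>auto intro!: sets.finite_UN\<close>)
      finally have short: "(\<Sum>p\<in>D1. Sup (snd p) - Inf (snd p)) < \<delta>"
        using Usmall by linarith
      have "(\<Sum>p\<in>D1. norm (f (Sup (snd p)) - f (Inf (snd p)))) < e / 2"
      proof (intro \<delta>[rule_format, OF D1fin _ _ short])
        show "disjoint_family_on (\<lambda>p. {Inf (snd p)<..<Sup (snd p)}) D1"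
          using disj by (auto simp: disjoint_family_on_def D1_def)
      next
        fix p assume "p \<in> D1"
        then show "a \<le> Inf (snd p) \<and> Inf (snd p) \<le> Sup (snd p) \<and> Sup (snd p) \<le> b"
          using Dk[of "fst p" "snd p"] by (auto simp: D1_def)
      qed
      moreover have "(\<Sum>p\<in>D1. norm (measure lborel (snd p) * g (fst p) - \<Delta> p)) =
          (\<Sum>p\<in>D1. norm (f (Sup (snd p)) - f (Inf (snd p))))"
        by (rule sum.cong) (auto simp: D1_def g_def \<Delta>_def)
      moreover have "(\<Sum>p\<in>D-D1. norm (measure lborel (snd p) * g (fst p) - \<Delta> p)) \<le>
          (\<Sum>p\<in>D-D1. e1 * measure lborel (snd p))"
      proof (rule sum_mono)
        fix p assume p: "p \<in> D - D1"
        obtain x k where xk: "p = (x, k)" by fastforce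
        then have xkD: "(x, k) \<in> D" "x \<notin> N" using p by (auto simp: D1_def)
        then obtain l u where lu: "k = {l..u}" "a \<le> l" "l \<le> x" "x \<le> u" "u \<le> b"
          using Dk by blast
        have "k \<subseteq> \<gamma> x" using fine xkD(1) by (auto simp: fine_def)
        then have "k \<subseteq> ball x (d x)" using xkD(2) by (simp add: \<gamma>_def)
        moreover have "l \<in> k" "u \<in> k" using lu by auto
        ultimately have "\<bar>l - x\<bar> < d x" "\<bar>u - x\<bar> < d x"
          by (auto simp: subset_iff dist_real_def abs_minus_commute)
        then have "\<bar>f l - f x - (l - x) * f' x\<bar> \<le> e1 * \<bar>l - x\<bar>"
          "\<bar>f u - f x - (u - x) * f' x\<bar> \<le> e1 * \<bar>u - x\<bar>"
          using d[of x l] d[of x u] lu xkD by auto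
        then have "\<bar>(u - l) * f' x - (f u - f l)\<bar> \<le> e1 * (u - l)"
          using lu by (simp add: algebra_simps abs_if split: if_splits)
        then show "norm (measure lborel (snd p) * g (fst p) - \<Delta> p) \<le> e1 * measure lborel (snd p)"
          using xk xkD lu by (simp add: g_def \<Delta>_def)
      qed
      moreover have "(\<Sum>p\<in>D-D1. e1 * measure lborel (snd p)) \<le> (\<Sum>p\<in>D. e1 * measure lborel (snd p))"
        using fin \<open>e1 > 0\<close> by (intro sum_mono2) auto
      moreover have "(\<Sum>p\<in>D. e1 * measure lborel (snd p)) = e1 * (b - a)"
        by (simp add: sum_distrib_left[symmetric] cont)
      moreover have "e1 * (b - a) \<le> e / 2"
        using \<open>e > 0\<close> \<open>a \<le> b\<close> by (simp add: e1_def field_simps)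
      moreover have "(\<Sum>p\<in>D. norm (measure lborel (snd p) * g (fst p) - \<Delta> p)) =
          (\<Sum>p\<in>D1. norm (measure lborel (snd p) * g (fst p) - \<Delta> p)) +
          (\<Sum>p\<in>D-D1. norm (measure lborel (snd p) * g (fst p) - \<Delta> p))"
        using sum.subset_diff[OF _ fin, of D1] by (simp add: D1_def add.commute)
      ultimately have small: "(\<Sum>p\<in>D. norm (measure lborel (snd p) * g (fst p) - \<Delta> p)) < e"
        by linarith
      have "norm (\<Sum>p\<in>D. measure lborel (snd p) * g (fst p) - \<Delta> p) \<le>
          (\<Sum>p\<in>D. norm (measure lborel (snd p) * g (fst p) - \<Delta> p))"
        by (rule norm_sum)
      also note small
      also have "(\<Sum>p\<in>D. measure lborel (snd p) * g (fst p) - \<Delta> p) =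
          (\<Sum>(x, k)\<in>D. measure lborel k *\<^sub>R g x) - (f b - f a)"
        unfolding tele[symmetric] by (simp add: sum_subtractf case_prod_beta)
      finally show ?thesis .
    qed
    show "\<exists>\<gamma>. gauge \<gamma> \<and> (\<forall>D. D tagged_division_of {a..b} \<and> \<gamma> fine D \<longrightarrow>
        norm ((\<Sum>(x, k)\<in>D. measure lborel k *\<^sub>R g x) - (f b - f a)) < e)"
      by (intro exI[of _ \<gamma>] conjI gauge allI impI, elim conjE) (rule close)
  qed
  then show ?thesis
    by (rule has_integral_spike[OF N, rotated]) (simp add: g_def)
qed

lemma abs_continuous_on_mono:
  fixes f :: "real \<Rightarrow> real"
  assumes "a \<le> b" "abs_continuous_on a b f" "negligible N"
    and "\<And>t. t \<in> {a..b} - N \<Longrightarrow> (f has_real_derivative f' t) (at t within {a..b})"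
    and nonneg: "\<And>t. t \<in> {a..b} - N \<Longrightarrow> f' t \<ge> 0"
  shows "f a \<le> f b"
proof -
  have "((\<lambda>t. if t \<in> N then 0 else f' t) has_integral (f b - f a)) {a..b}"
    by (rule has_integral_spike[OF \<open>negligible N\<close> _
          abs_continuous_on_fundamental_theorem[OF assms(1-4)]]) auto
  from has_integral_nonneg[OF this] nonneg show ?thesis by force
qed

lemma abs_continuous_on_subinterval:
  assumes "abs_continuous_on a b f" "a \<le> c" "d \<le> b"
  shows "abs_continuous_on c d f"
  using assms unfolding abs_continuous_on_def by (meson order_trans)

text \<open>All closure properties that are used follow from this comparison of increments.\<close>

lemma abs_continuous_on_dominated:
  fixes f :: "real \<Rightarrow> 'a::real_normed_vector" and g :: "real \<Rightarrow> 'b::real_normed_vector"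
    and h :: "real \<Rightarrow> 'c::real_normed_vector"
  assumes g: "abs_continuous_on a b g" and h: "abs_continuous_on a b h"
    and le: "\<And>s t. a \<le> s \<Longrightarrow> s \<le> t \<Longrightarrow> t \<le> b \<Longrightarrow>
      norm (f t - f s) \<le> M * (norm (g t - g s) + norm (h t - h s))"
  shows "abs_continuous_on a b f"
  unfolding abs_continuous_on_def
proof (intro allI impI)
  fix e :: real assume "e > 0"
  define K where "K = \<bar>M\<bar> + 1"
  have "K > 0" by (simp add: K_def)
  then have "e / (2 * K) > 0" using \<open>e > 0\<close> by simp
  obtain d1 where "d1 > 0" and d1: "\<forall>(I::nat set) s t. finite I \<longrightarrow>
        (\<forall>i\<in>I. a \<le> s i \<and> s i \<le> t i \<and> t i \<le> b) \<longrightarrow>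
        disjoint_family_on (\<lambda>i. {s i<..<t i}) I \<longrightarrow> (\<Sum>i\<in>I. t i - s i) < d1 \<longrightarrow>
        (\<Sum>i\<in>I. norm (g (t i) - g (s i))) < e / (2 * K)"
    using abs_continuous_onD[OF g \<open>e / (2 * K) > 0\<close>] by (elim exE conjE) (rule that)
  obtain d2 where "d2 > 0" and d2: "\<forall>(I::nat set) s t. finite I \<longrightarrow>
        (\<forall>i\<in>I. a \<le> s i \<and> s i \<le> t i \<and> t i \<le> b) \<longrightarrow>
        disjoint_family_on (\<lambda>i. {s i<..<t i}) I \<longrightarrow> (\<Sum>i\<in>I. t i - s i) < d2 \<longrightarrow>
        (\<Sum>i\<in>I. norm (h (t i) - h (s i))) < e / (2 * K)"
    using abs_continuous_onD[OF h \<open>e / (2 * K) > 0\<close>] by (elim exE conjE) (rule that)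
  show "\<exists>\<delta>>0. \<forall>(I::nat set) s t. finite I \<longrightarrow> (\<forall>i\<in>I. a \<le> s i \<and> s i \<le> t i \<and> t i \<le> b) \<longrightarrow>
        disjoint_family_on (\<lambda>i. {s i<..<t i}) I \<longrightarrow> (\<Sum>i\<in>I. t i - s i) < \<delta> \<longrightarrow>
        (\<Sum>i\<in>I. norm (f (t i) - f (s i))) < e"
  proof (intro exI[of _ "min d1 d2"] conjI allI impI)
    show "min d1 d2 > 0" using \<open>d1 > 0\<close> \<open>d2 > 0\<close> by simp
    fix I :: "nat set" and s t
    assume I: "finite I" "\<forall>i\<in>I. a \<le> s i \<and> s i \<le> t i \<and> t i \<le> b"
      "disjoint_family_on (\<lambda>i. {s i<..<t i}) I" "(\<Sum>i\<in>I. t i - s i) < min d1 d2"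
    have "(\<Sum>i\<in>I. norm (f (t i) - f (s i))) \<le>
        (\<Sum>i\<in>I. K * (norm (g (t i) - g (s i)) + norm (h (t i) - h (s i))))"
    proof (rule sum_mono)
      fix i assume "i \<in> I"
      then have "norm (f (t i) - f (s i)) \<le> M * (norm (g (t i) - g (s i)) + norm (h (t i) - h (s i)))"
        using I(2) le by auto
      also have "\<dots> \<le> K * (norm (g (t i) - g (s i)) + norm (h (t i) - h (s i)))"
        by (rule mult_right_mono) (auto simp: K_def)
      finally show "norm (f (t i) - f (s i)) \<le> \<dots>" .
    qed
    also have "\<dots> = K * ((\<Sum>i\<in>I. norm (g (t i) - g (s i))) + (\<Sum>i\<in>I. norm (h (t i) - h (s i))))"
      by (simp add: sum_distrib_left[symmetric] sum.distrib)
    also have "\<dots> < K * (e / (2 * K) + e / (2 * K))"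
      using d1[rule_format, OF I(1) _ I(3)] d2[rule_format, OF I(1) _ I(3)] I(2,4) \<open>K > 0\<close>
      by (intro mult_strict_left_mono add_strict_mono) auto
    also have "\<dots> = e" using \<open>K > 0\<close> by (simp add: field_simps)
    finally show "(\<Sum>i\<in>I. norm (f (t i) - f (s i))) < e" .
  qed
qed

lemma abs_continuous_on_id: "abs_continuous_on a b (\<lambda>t::real. t)"
  unfolding abs_continuous_on_def
proof (intro allI impI exI conjI)
  fix e :: real and I :: "nat set" and s t :: "nat \<Rightarrow> real" assume "e > 0" then show "e > 0" .
  assume "\<forall>i\<in>I. a \<le> s i \<and> s i \<le> t i \<and> t i \<le> b" "(\<Sum>i\<in>I. t i - s i) < e"
  moreover from this have "(\<Sum>i\<in>I. norm (t i - s i)) = (\<Sum>i\<in>I. t i - s i)"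
    by (intro sum.cong) auto
  ultimately show "(\<Sum>i\<in>I. norm (t i - s i)) < e" by simp
qed

lemma abs_continuous_on_lipschitz:
  assumes "\<And>s t. a \<le> s \<Longrightarrow> s \<le> t \<Longrightarrow> t \<le> b \<Longrightarrow> norm (f t - f s) \<le> M * (t - s)"
  shows "abs_continuous_on a b f"
proof (rule abs_continuous_on_dominated[OF abs_continuous_on_id abs_continuous_on_id])
  show "norm (f t - f s) \<le> (\<bar>M\<bar> / 2) * (norm (t - s) + norm (t - s))"
    if "a \<le> s" "s \<le> t" "t \<le> b" for s t
  proof -
    have "M * (t - s) \<le> \<bar>M\<bar> * (t - s)" using that by (intro mult_right_mono) auto
    then show ?thesis using assms[OF that] that by (simp add: algebra_simps)
  qed
qed

lemma abs_continuous_on_C1: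
  fixes f :: "real \<Rightarrow> real"
  assumes "\<And>t. t \<in> {a..b} \<Longrightarrow> (f has_real_derivative f' t) (at t within {a..b})"
    and "continuous_on {a..b} f'"
  shows "abs_continuous_on a b f"
proof -
  obtain M where M: "\<And>t. t \<in> {a..b} \<Longrightarrow> norm (f' t) \<le> M"
    using compact_imp_bounded[OF compact_continuous_image[OF assms(2) compact_Icc]]
    unfolding bounded_iff by blast
  show ?thesis
  proof (rule abs_continuous_on_lipschitz)
    fix s t assume st: "a \<le> s" "s \<le> t" "t \<le> b"
    have "norm (f t - f s) \<le> M * norm (t - s)"
      using st by (intro field_differentiable_bound[OF convex_real_interval(5) assms(1) M]) auto
    then show "norm (f t - f s) \<le> M * (t - s)" using st by simp
  qed
qed

lemma abs_continuous_on_imp_continuous_on: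
  fixes f :: "real \<Rightarrow> 'a::real_normed_vector"
  assumes "abs_continuous_on a b f"
  shows "continuous_on {a..b} f"
  unfolding continuous_on_iff
proof (intro ballI allI impI)
  fix t e :: real assume "t \<in> {a..b}" "e > 0"
  obtain d where "d > 0" and d: "\<forall>(I::nat set) s t. finite I \<longrightarrow>
        (\<forall>i\<in>I. a \<le> s i \<and> s i \<le> t i \<and> t i \<le> b) \<longrightarrow>
        disjoint_family_on (\<lambda>i. {s i<..<t i}) I \<longrightarrow> (\<Sum>i\<in>I. t i - s i) < d \<longrightarrow>
        (\<Sum>i\<in>I. norm (f (t i) - f (s i))) < e"
    using abs_continuous_onD[OF assms \<open>e > 0\<close>] by (elim exE conjE) (rule that)
  show "\<exists>d>0. \<forall>s\<in>{a..b}. dist s t < d \<longrightarrow> dist (f s) (f t) < e"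
  proof (intro exI[of _ d] conjI ballI impI)
    fix s assume "s \<in> {a..b}" "dist s t < d"
    then show "dist (f s) (f t) < e"
      using d[rule_format, of "{0}" "\<lambda>_. min s t" "\<lambda>_. max s t"] \<open>t \<in> {a..b}\<close>
      by (cases "s \<le> t") (auto simp: disjoint_family_on_def dist_norm norm_minus_commute)
  qed (rule \<open>d > 0\<close>)
qed

lemma abs_continuous_on_bounded:
  fixes f :: "real \<Rightarrow> 'a::real_normed_vector"
  assumes "abs_continuous_on a b f"
  obtains M where "\<And>t. t \<in> {a..b} \<Longrightarrow> norm (f t) \<le> M" "M > 0"
  using compact_imp_bounded[OF compact_continuous_image[OF
      abs_continuous_on_imp_continuous_on[OF assms] compact_Icc]] that
  unfolding bounded_pos by blast

lemma abs_continuous_on_add: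
  assumes "abs_continuous_on a b f" "abs_continuous_on a b g"
  shows "abs_continuous_on a b (\<lambda>t. f t + g t)"
proof (rule abs_continuous_on_dominated[OF assms, where M = 1])
  fix s t :: real
  have "f t + g t - (f s + g s) = (f t - f s) + (g t - g s)" by simp
  then show "norm (f t + g t - (f s + g s)) \<le> 1 * (norm (f t - f s) + norm (g t - g s))"
    by (metis mult_1 norm_triangle_ineq)
qed

lemma abs_continuous_on_mult:
  fixes f g :: "real \<Rightarrow> real"
  assumes "abs_continuous_on a b f" "abs_continuous_on a b g"
  shows "abs_continuous_on a b (\<lambda>t. f t * g t)"
proof -
  obtain M1 where M1: "\<And>t. t \<in> {a..b} \<Longrightarrow> norm (f t) \<le> M1" "M1 > 0"
    using abs_continuous_on_bounded[OF assms(1)] by blast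
  obtain M2 where M2: "\<And>t. t \<in> {a..b} \<Longrightarrow> norm (g t) \<le> M2" "M2 > 0"
    using abs_continuous_on_bounded[OF assms(2)] by blast
  show ?thesis
  proof (rule abs_continuous_on_dominated[OF assms, where M = "M1 + M2"])
    fix s t assume st: "a \<le> s" "s \<le> t" "t \<le> b"
    have "norm (f t * g t - f s * g s) = norm (f t * (g t - g s) + (f t - f s) * g s)"
      by (simp add: algebra_simps)
    also have "\<dots> \<le> norm (f t) * norm (g t - g s) + norm (f t - f s) * norm (g s)"
      by (metis norm_mult norm_triangle_ineq)
    also have "\<dots> \<le> M1 * norm (g t - g s) + norm (f t - f s) * M2"
      using M1(1)[of t] M2(1)[of s] st by (intro add_mono mult_right_mono mult_left_mono) auto
    also have "\<dots> \<le> (M1 + M2) * (norm (f t - f s) + norm (g t - g s))"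
      using M1(2) M2(2) by (simp add: algebra_simps)
    finally show "norm (f t * g t - f s * g s) \<le> (M1 + M2) * (norm (f t - f s) + norm (g t - g s))" .
  qed
qed

lemma abs_continuous_on_const: "abs_continuous_on a b (\<lambda>_. c)"
  by (rule abs_continuous_on_lipschitz[where M = 0]) simp

lemma abs_continuous_on_minus:
  fixes f :: "real \<Rightarrow> real"
  assumes "abs_continuous_on a b f"
  shows "abs_continuous_on a b (\<lambda>t. - f t)"
  using abs_continuous_on_mult[OF abs_continuous_on_const[of a b "-1"] assms] by simp

lemma abs_continuous_on_diff:
  fixes f g :: "real \<Rightarrow> real"
  assumes "abs_continuous_on a b f" "abs_continuous_on a b g"
  shows "abs_continuous_on a b (\<lambda>t. f t - g t)"
  using abs_continuous_on_add[OF assms(1) abs_continuous_on_minus[OF assms(2)]] by simp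

lemmas abs_continuous_intros = abs_continuous_on_const abs_continuous_on_id abs_continuous_on_add
  abs_continuous_on_diff abs_continuous_on_mult abs_continuous_on_minus

text \<open>The Cauchy--Schwarz inequality, in a form that needs only the monotonicity of functions with
  nonnegative derivative: \<open>K * r \<le> K * (\<eta> / 2 + r\<^sup>2 / (2 * \<eta>))\<close>, and \<open>r\<^sup>2 / 2\<close> is dominated by
  the derivative of \<open>E\<close>. When the total increment of \<open>E\<close> tends to \<open>0\<close> and
  then \<open>\<eta>\<close> tends to \<open>0\<close>, the increments of \<open>f\<close> vanish.\<close>

lemma abs_continuous_on_increment_le:
  fixes f E :: "real \<Rightarrow> real"
  assumes t: "0 \<le> t1" "t1 \<le> t2" "t2 \<le> 1"
    and acE: "abs_continuous_on 0 1 E" and acf: "abs_continuous_on t1 t2 f"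
    and N: "negligible N"
    and dE: "\<And>t. t \<in> {0..1} - N \<Longrightarrow> (E has_real_derivative E' t) (at t within {0..1})"
    and df: "\<And>t. t \<in> {t1..t2} - N \<Longrightarrow> (f has_real_derivative f' t) (at t within {t1..t2})"
    and E'nn: "\<And>t. t \<in> {0..1} - N \<Longrightarrow> E' t \<ge> 0"
    and le: "\<And>t. t \<in> {t1..t2} - N \<Longrightarrow> \<bar>f' t\<bar> \<le> K * r t \<and> (r t)\<^sup>2 \<le> 2 * E' t"
    and "K > 0" "\<eta> > 0"
  shows "\<bar>f t2 - f t1\<bar> \<le> K * (\<eta> / 2 + (E 1 - E 0) / \<eta>)"
proof -
  have dE': "(E has_real_derivative E' t) (at t within {u..v})"
    if "0 \<le> u" "v \<le> 1" "t \<in> {u..v} - N" for u v t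
    by (rule DERIV_subset[OF dE]) (use that in auto)
  have Emono: "E u \<le> E v" if "0 \<le> u" "u \<le> v" "v \<le> 1" for u v
  proof (rule abs_continuous_on_mono[OF that(2) abs_continuous_on_subinterval[OF acE that(1,3)] N])
    fix t assume t: "t \<in> {u..v} - N"
    show "(E has_real_derivative E' t) (at t within {u..v})" by (rule dE'[OF that(1,3) t])
    show "0 \<le> E' t" using t that by (intro E'nn) auto
  qed
  define w where "w t = K * (\<eta> / 2 * t + E t / \<eta>)" for t
  have acw: "abs_continuous_on t1 t2 w"
    unfolding w_def divide_inverse
    by (intro abs_continuous_intros abs_continuous_on_subinterval[OF acE] t)
  have dw: "(w has_real_derivative K * (\<eta> / 2 + E' t / \<eta>)) (at t within {t1..t2})"
    if "t \<in> {t1..t2} - N" for t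
    unfolding w_def
    by (intro DERIV_cmult DERIV_add DERIV_cdivide dE' t that DERIV_cmult_Id)
  have bound: "\<bar>f' t\<bar> \<le> K * (\<eta> / 2 + E' t / \<eta>)" if "t \<in> {t1..t2} - N" for t
  proof -
    have "0 \<le> (\<eta> - r t)\<^sup>2" by simp
    then have "r t * \<eta> \<le> \<eta>\<^sup>2 / 2 + E' t"
      using le[OF that] by (simp add: power2_eq_square algebra_simps)
    then have "r t \<le> \<eta> / 2 + E' t / \<eta>"
      using \<open>\<eta> > 0\<close> by (simp add: field_simps power2_eq_square)
    then have "K * r t \<le> K * (\<eta> / 2 + E' t / \<eta>)" using \<open>K > 0\<close> by simp
    then show ?thesis using le[OF that] by linarith
  qed
  have "w t1 + f t1 \<le> w t2 + f t2"
  proof (rule abs_continuous_on_mono[OF t(2) abs_continuous_on_add[OF acw acf] N])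
    fix t assume t: "t \<in> {t1..t2} - N"
    show "((\<lambda>t. w t + f t) has_real_derivative K * (\<eta> / 2 + E' t / \<eta>) + f' t) (at t within {t1..t2})"
      by (rule DERIV_add[OF dw[OF t] df[OF t]])
    show "0 \<le> K * (\<eta> / 2 + E' t / \<eta>) + f' t" using bound[OF t] by linarith
  qed
  moreover have "w t1 - f t1 \<le> w t2 - f t2"
  proof (rule abs_continuous_on_mono[OF t(2) abs_continuous_on_diff[OF acw acf] N])
    fix t assume t: "t \<in> {t1..t2} - N"
    show "((\<lambda>t. w t - f t) has_real_derivative K * (\<eta> / 2 + E' t / \<eta>) - f' t) (at t within {t1..t2})"
      by (rule DERIV_diff[OF dw[OF t] df[OF t]])
    show "0 \<le> K * (\<eta> / 2 + E' t / \<eta>) - f' t" using bound[OF t] by linarith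
  qed
  moreover have "w t2 - w t1 \<le> K * (\<eta> / 2 + (E 1 - E 0) / \<eta>)"
  proof -
    have "w t2 - w t1 = K * (\<eta> / 2 * (t2 - t1) + (E t2 - E t1) / \<eta>)"
      by (simp add: w_def algebra_simps diff_divide_distrib)
    also have "\<dots> \<le> K * (\<eta> / 2 * 1 + (E 1 - E 0) / \<eta>)"
      using t \<open>K > 0\<close> \<open>\<eta> > 0\<close> Emono[of 0 t1] Emono[of t2 1]
      by (intro mult_left_mono add_mono divide_right_mono) auto
    finally show ?thesis by simp
  qed
  ultimately show ?thesis by linarith
qed

text \<open>Truncate \<open>v\<close> at a high level, approximate the bounded function almost everywhere by continuous
  functions, clamp these to the same range, and apply dominated convergence twice. A small constant
  is added to make the approximation positive, so that its primitive is a change of parameter.\<close>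

lemma continuous_L1_approximation:
  fixes v :: "real \<Rightarrow> real"
  assumes v: "set_integrable lebesgue {0..1} v" and vnn: "\<And>t. v t \<ge> 0" and "\<epsilon> > 0"
  shows "\<exists>g. continuous_on {0..1} g \<and> (\<forall>t. g t > 0) \<and>
    set_integrable lebesgue {0..1} (\<lambda>t. \<bar>v t - g t\<bar>) \<and>
    (LINT t:{0..1}|lebesgue. \<bar>v t - g t\<bar>) < \<epsilon>"
proof -
  define M where "M = lebesgue_on {0..1::real}"
  have M1: "measure M (space M) = 1" "finite_measure M"
    unfolding M_def by (auto simp: measure_restrict_space space_restrict_space intro!: finite_measure_lebesgue_on)
  have constint: "integrable M (\<lambda>_. c::real)" for c
    using finite_measure.integrable_const[OF M1(2)] by auto
  have set_int: "set_integrable lebesgue {0..1} f \<longleftrightarrow> integrable M f" for f :: "real \<Rightarrow> real"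
    by (simp add: M_def set_integrable_def integrable_restrict_space)
  have set_LINT: "(LINT t:{0..1}|lebesgue. f t) = integral\<^sup>L M f" for f :: "real \<Rightarrow> real"
    by (simp add: M_def set_lebesgue_integral_def integral_restrict_space)
  have vM: "integrable M v" using v set_int by simp
  have [measurable]: "v \<in> borel_measurable M" using vM by simp
  have "(\<lambda>k. integral\<^sup>L M (\<lambda>t. \<bar>v t - min (v t) (real k)\<bar>)) \<longlonglongrightarrow> integral\<^sup>L M (\<lambda>t. 0)"
  proof (rule integral_dominated_convergence[where w = v])
    show "AE t in M. (\<lambda>k. \<bar>v t - min (v t) (real k)\<bar>) \<longlonglongrightarrow> 0"
    proof (rule AE_I2)
      fix t
      have "\<forall>\<^sub>F k in sequentially. \<bar>v t - min (v t) (real k)\<bar> = 0"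
        using eventually_ge_at_top[of "nat \<lceil>v t\<rceil>"] by eventually_elim (simp add: min_def nat_ceiling_le_eq)
      then show "(\<lambda>k. \<bar>v t - min (v t) (real k)\<bar>) \<longlonglongrightarrow> 0" by (rule tendsto_eventually)
    qed
    show "AE t in M. norm \<bar>v t - min (v t) (real k)\<bar> \<le> v t" for k
      using vnn by (auto intro!: AE_I2 simp: min_def)
  qed (use vM in auto)
  then have "\<forall>\<^sub>F k in sequentially. integral\<^sup>L M (\<lambda>t. \<bar>v t - min (v t) (real k)\<bar>) < \<epsilon> / 3"
    using \<open>\<epsilon> > 0\<close> by (intro order_tendstoD(2)) auto
  from eventually_happens'[OF sequentially_bot this]
  obtain k where k: "integral\<^sup>L M (\<lambda>t. \<bar>v t - min (v t) (real k)\<bar>) < \<epsilon> / 3" ..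
  define w where "w t = min (v t) (real k)" for t
  have [measurable]: "w \<in> borel_measurable M" unfolding w_def by measurable
  have wb: "0 \<le> w t" "w t \<le> real k" for t using vnn[of t] by (auto simp: w_def)
  have "w measurable_on {0..1}"
    using iffD2[OF measurable_on_iff_borel_measurable \<open>w \<in> borel_measurable M\<close>[unfolded M_def]] by simp
  then obtain Z G where Z: "negligible Z" and G: "\<forall>n. continuous_on UNIV (G n)"
    and lim: "\<forall>t. t \<notin> Z \<longrightarrow> (\<lambda>n. G n t) \<longlonglongrightarrow> (if t \<in> {0..1} then w t else 0)"
    unfolding measurable_on_def
    by (elim conjE exE) (rule that)
  note G = spec[OF G] and lim = spec[OF lim, THEN mp]
  define c where "c n t = max 0 (min (real k) (G n t))" for n t
  have contc: "continuous_on UNIV (c n)" for n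
    unfolding c_def by (intro continuous_intros G)
  have [measurable]: "c n \<in> borel_measurable M" for n
    unfolding M_def
    by (rule continuous_imp_measurable_on_sets_lebesgue[OF continuous_on_subset[OF contc]]) auto
  have cb: "0 \<le> c n t" "c n t \<le> real k" for n t by (auto simp: c_def)
  have "(\<lambda>n. integral\<^sup>L M (\<lambda>t. \<bar>w t - c n t\<bar>)) \<longlonglongrightarrow> integral\<^sup>L M (\<lambda>t. 0)"
  proof (rule integral_dominated_convergence[where w = "\<lambda>_. real k"])
    have "AE t in M. t \<notin> Z"
      unfolding M_def
      by (subst AE_restrict_space_iff)
         (use AE_not_in[OF Z[unfolded negligible_iff_null_sets]] in \<open>auto elim: eventually_mono\<close>)
    moreover have "AE t in M. t \<in> {0..1}"
      using AE_space[of M] by (simp add: M_def space_restrict_space)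
    ultimately show "AE t in M. (\<lambda>n. \<bar>w t - c n t\<bar>) \<longlonglongrightarrow> 0"
    proof eventually_elim
      fix t assume t: "t \<notin> Z" "t \<in> {0..1}"
      have "(\<lambda>n. c n t) \<longlonglongrightarrow> max 0 (min (real k) (w t))"
        unfolding c_def using lim[OF t(1)] t(2) by (intro tendsto_intros) auto
      then have "(\<lambda>n. c n t) \<longlonglongrightarrow> w t" using wb[of t] by simp
      from tendsto_rabs[OF tendsto_diff[OF tendsto_const[of "w t"] this]]
      show "(\<lambda>n. \<bar>w t - c n t\<bar>) \<longlonglongrightarrow> 0" by simp
    qed
    show "AE t in M. norm \<bar>w t - c n t\<bar> \<le> real k" for n
    proof (rule AE_I2)
      fix t show "norm \<bar>w t - c n t\<bar> \<le> real k" using wb[of t] cb[of n t] by auto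
    qed
  qed (use constint in auto)
  then have "\<forall>\<^sub>F n in sequentially. integral\<^sup>L M (\<lambda>t. \<bar>w t - c n t\<bar>) < \<epsilon> / 3"
    using \<open>\<epsilon> > 0\<close> by (intro order_tendstoD(2)) auto
  from eventually_happens'[OF sequentially_bot this]
  obtain n where n: "integral\<^sup>L M (\<lambda>t. \<bar>w t - c n t\<bar>) < \<epsilon> / 3" ..
  define g where "g t = c n t + \<epsilon> / 4" for t
  have wM: "integrable M w"
    by (rule Bochner_Integration.integrable_bound[OF constint[of "real k"]]) (use wb in auto)
  have cM: "integrable M (c n)"
    by (rule Bochner_Integration.integrable_bound[OF constint[of "real k"]]) (use cb in auto)
  have gM: "integrable M (\<lambda>t. \<bar>v t - g t\<bar>)"
    unfolding g_def using vM cM constint by auto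
  have "integral\<^sup>L M (\<lambda>t. \<bar>v t - g t\<bar>) \<le>
      integral\<^sup>L M (\<lambda>t. \<bar>v t - min (v t) (real k)\<bar> + \<bar>w t - c n t\<bar> + \<epsilon> / 4)"
    using gM vM wM cM constint \<open>\<epsilon> > 0\<close>
    by (intro integral_mono) (auto simp: w_def[symmetric] g_def)
  also have "\<dots> = integral\<^sup>L M (\<lambda>t. \<bar>v t - min (v t) (real k)\<bar>) + integral\<^sup>L M (\<lambda>t. \<bar>w t - c n t\<bar>) + \<epsilon> / 4"
    using vM wM cM constint M1(1) by (simp add: w_def[symmetric])
  also have "\<dots> < \<epsilon>" using k n \<open>\<epsilon> > 0\<close> by linarith
  finally have "integral\<^sup>L M (\<lambda>t. \<bar>v t - g t\<bar>) < \<epsilon>" .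
  moreover have "continuous_on {0..1} g"
    unfolding g_def using contc[of n] by (intro continuous_intros) (auto intro: continuous_on_subset)
  moreover have "g t > 0" for t using cb[of n t] \<open>\<epsilon> > 0\<close> by (simp add: g_def)
  ultimately show ?thesis using gM set_int set_LINT by (intro exI[of _ g]) auto
qed

section \<open>Horizontal curves\<close>

lemma AE_lebesgue_negligibleE:
  assumes "AE t in lebesgue. t \<in> S \<longrightarrow> P t"
  obtains N where "negligible N" "\<forall>t\<in>S - N. P t"
proof -
  obtain N where N: "{t \<in> space lebesgue. \<not> (t \<in> S \<longrightarrow> P t)} \<subseteq> N" "N \<in> null_sets lebesgue"
    using assms by (auto simp: eventually_ae_filter)
  show thesis
    by (rule that[of N]) (use N negligible_iff_null_sets in auto)
qed

text \<open>On the singular line \<open>x = 0\<close> the control \<open>u2\<close> is free, so that the infimum drops its square.\<close>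

lemma grushin_metric_eq:
  "grushin_metric (x, y) (a, x * b) = a\<^sup>2 + (if x = 0 then 0 else b)\<^sup>2"
proof (cases "x = 0")
  case True
  have "{u1\<^sup>2 + u2\<^sup>2 | u1 u2. u1 *\<^sub>R X1 (x, y) + u2 *\<^sub>R X2 (x, y) = (a, x * b)} = {a\<^sup>2 + u2\<^sup>2 | u2. True}"
    using True by (auto simp: X1_def X2_def)
  moreover have "Inf {a\<^sup>2 + u2\<^sup>2 | u2::real. True} = a\<^sup>2"
    by (rule cInf_eq_minimum) (auto intro: exI[of _ 0])
  ultimately show ?thesis using True by (simp add: grushin_metric_def)
next
  case False
  then have "{u1\<^sup>2 + u2\<^sup>2 | u1 u2. u1 *\<^sub>R X1 (x, y) + u2 *\<^sub>R X2 (x, y) = (a, x * b)} = {a\<^sup>2 + b\<^sup>2}"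
    by (auto simp: X1_def X2_def)
  then show ?thesis using False by (simp add: grushin_metric_def)
qed

lemma speed_eq:
  assumes "t \<in> {0..1}"
    and "((\<lambda>t. fst (\<gamma> t)) has_real_derivative a) (at t within {0..1})"
    and "((\<lambda>t. snd (\<gamma> t)) has_real_derivative fst (\<gamma> t) * b) (at t within {0..1})"
  shows "speed \<gamma> t = sqrt (a\<^sup>2 + (if fst (\<gamma> t) = 0 then 0 else b)\<^sup>2)"
proof -
  have "((\<lambda>t. (fst (\<gamma> t), snd (\<gamma> t))) has_vector_derivative (a, fst (\<gamma> t) * b)) (at t within {0..1})"
    using assms(2,3) by (intro has_vector_derivative_Pair) (auto simp: has_real_derivative_iff_has_vector_derivative)
  then have "vector_derivative \<gamma> (at t within {0..1}) = (a, fst (\<gamma> t) * b)"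
    using assms(1) vector_derivative_within_cbox[of 0 1 t] by simp
  then show ?thesis
    unfolding speed_def using grushin_metric_eq[of "fst (\<gamma> t)" "snd (\<gamma> t)" a b] by simp
qed

text \<open>The controls are normalized to \<open>b = 0\<close> on the singular line. This leaves the derivative
  \<open>x * b\<close> of the height unchanged, and makes \<open>a\<^sup>2 + b\<^sup>2\<close> the squared speed almost everywhere.\<close>

lemma horizontal_components:
  assumes "horizontal \<gamma>"
  obtains N a b where "negligible N"
    "abs_continuous_on 0 1 (\<lambda>t. fst (\<gamma> t))" "abs_continuous_on 0 1 (\<lambda>t. snd (\<gamma> t))"
    "\<forall>t\<in>{0..1} - N. ((\<lambda>t. fst (\<gamma> t)) has_real_derivative a t) (at t within {0..1})"
    "\<forall>t\<in>{0..1} - N. ((\<lambda>t. snd (\<gamma> t)) has_real_derivative fst (\<gamma> t) * b t) (at t within {0..1})"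
    "\<forall>t\<in>{0..1} - N. speed \<gamma> t = sqrt ((a t)\<^sup>2 + (b t)\<^sup>2)"
    "set_integrable lebesgue {0..1} (\<lambda>t. sqrt ((a t)\<^sup>2 + (b t)\<^sup>2))"
    "curve_length \<gamma> = (LINT t:{0..1}|lebesgue. sqrt ((a t)\<^sup>2 + (b t)\<^sup>2))"
proof -
  have ac: "abs_continuous_on 0 1 \<gamma>" using assms by (simp add: horizontal_def)
  obtain u :: "real \<Rightarrow> real \<times> real" where
    meas: "set_borel_measurable lebesgue {0..1} u" and
    int: "set_integrable lebesgue {0..1} (\<lambda>t. (norm (u t))\<^sup>2)" and
    ae: "AE t in lebesgue. t \<in> {0..1} \<longrightarrow> (\<gamma> has_vector_derivative
              fst (u t) *\<^sub>R X1 (\<gamma> t) + snd (u t) *\<^sub>R X2 (\<gamma> t)) (at t within {0..1})"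
    using assms unfolding horizontal_def by (elim conjE exE) (rule that)
  obtain N where N: "negligible N" and der: "\<forall>t\<in>{0..1} - N. (\<gamma> has_vector_derivative
              fst (u t) *\<^sub>R X1 (\<gamma> t) + snd (u t) *\<^sub>R X2 (\<gamma> t)) (at t within {0..1})"
    by (rule AE_lebesgue_negligibleE[OF ae]) (rule that)
  note der = bspec[OF der]
  define a where "a t = fst (u t)" for t
  define b where "b t = (if fst (\<gamma> t) = 0 then 0 else snd (u t))" for t
  have dx: "((\<lambda>t. fst (\<gamma> t)) has_real_derivative a t) (at t within {0..1})" if "t \<in> {0..1} - N" for t
    using has_derivative_fst[OF der[OF that, unfolded has_vector_derivative_def]]
    by (simp add: has_field_derivative_def a_def X1_def X2_def mult_commute_abs)
  have dy: "((\<lambda>t. snd (\<gamma> t)) has_real_derivative fst (\<gamma> t) * b t) (at t within {0..1})"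
    if "t \<in> {0..1} - N" for t
  proof -
    have "((\<lambda>t. snd (\<gamma> t)) has_real_derivative snd (u t) * fst (\<gamma> t)) (at t within {0..1})"
      using has_derivative_snd[OF der[OF that, unfolded has_vector_derivative_def]]
      by (simp add: has_field_derivative_def X1_def X2_def mult_commute_abs)
    also have "snd (u t) * fst (\<gamma> t) = fst (\<gamma> t) * b t" by (simp add: b_def)
    finally show ?thesis .
  qed
  have sp: "speed \<gamma> t = sqrt ((a t)\<^sup>2 + (b t)\<^sup>2)" if "t \<in> {0..1} - N" for t
    using speed_eq[OF _ dx[OF that] dy[OF that]] that by (simp add: b_def)
  define U where "U t = indicator {0..1} t *\<^sub>R u t" for t :: real
  define X where "X t = indicator {0..1} t *\<^sub>R fst (\<gamma> t)" for t :: real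
  have Um [measurable]: "U \<in> borel_measurable lebesgue"
    using meas by (simp add: set_borel_measurable_def U_def[abs_def])
  have "continuous_on {0..1} (\<lambda>t. fst (\<gamma> t))"
    by (intro continuous_on_fst abs_continuous_on_imp_continuous_on[OF ac])
  then have "X \<in> borel_measurable borel"
    unfolding X_def by (intro borel_measurable_continuous_on_indicator) auto
  then have [measurable]: "X \<in> borel_measurable lebesgue"
    by (simp add: measurable_completion)
  have [measurable]: "(\<lambda>t. fst (U t)) \<in> borel_measurable lebesgue" "(\<lambda>t. snd (U t)) \<in> borel_measurable lebesgue"
    using measurable_compose[OF Um borel_measurable_continuous_onI[OF continuous_on_fst[OF continuous_on_id]]]
      measurable_compose[OF Um borel_measurable_continuous_onI[OF continuous_on_snd[OF continuous_on_id]]]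
    by simp_all
  have eq: "indicator {0..1} t *\<^sub>R sqrt ((a t)\<^sup>2 + (b t)\<^sup>2) =
      sqrt ((fst (U t))\<^sup>2 + (if X t = 0 then 0 else snd (U t))\<^sup>2)" for t
    by (auto simp: U_def X_def a_def b_def indicator_def)
  have "(\<lambda>t. sqrt ((fst (U t))\<^sup>2 + (if X t = 0 then 0 else snd (U t))\<^sup>2)) \<in> borel_measurable lebesgue"
    by measurable
  then have vm: "(\<lambda>t. indicator {0..1} t *\<^sub>R sqrt ((a t)\<^sup>2 + (b t)\<^sup>2)) \<in> borel_measurable lebesgue"
    by (simp only: eq)
  have one: "set_integrable lebesgue {0..1::real} (\<lambda>t. 1::real)"
    by (simp add: set_integrable_def)
  have vint: "set_integrable lebesgue {0..1} (\<lambda>t. sqrt ((a t)\<^sup>2 + (b t)\<^sup>2))"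
    unfolding set_integrable_def
  proof (rule Bochner_Integration.integrable_bound[OF set_integral_add(1)[OF one int, unfolded set_integrable_def] vm])
    show "AE t in lebesgue. norm (indicator {0..1} t *\<^sub>R sqrt ((a t)\<^sup>2 + (b t)\<^sup>2)) \<le>
        norm (indicator {0..1} t *\<^sub>R (1 + (norm (u t))\<^sup>2))"
    proof (rule AE_I2)
      fix t
      have "(a t)\<^sup>2 + (b t)\<^sup>2 \<le> (norm (u t))\<^sup>2"
        by (auto simp: a_def b_def norm_prod_def)
      then have "sqrt ((a t)\<^sup>2 + (b t)\<^sup>2) \<le> norm (u t)" by (simp add: real_le_lsqrt)
      moreover have "norm (u t) \<le> 1 + (norm (u t))\<^sup>2"
        using zero_le_power2[of "norm (u t) - 1"] norm_ge_zero[of "u t"]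
        unfolding power2_diff power_one mult_1_right by linarith
      ultimately show "norm (indicator {0..1} t *\<^sub>R sqrt ((a t)\<^sup>2 + (b t)\<^sup>2)) \<le>
        norm (indicator {0..1} t *\<^sub>R (1 + (norm (u t))\<^sup>2))"
        by (auto simp: indicator_def)
    qed
  qed
  have len: "curve_length \<gamma> = (LINT t:{0..1}|lebesgue. sqrt ((a t)\<^sup>2 + (b t)\<^sup>2))"
    unfolding curve_length_def set_lebesgue_integral_def
  proof (rule Bochner_Integration.integral_cong_AE)
    have aeq: "AE t in lebesgue. indicator {0..1} t *\<^sub>R sqrt ((a t)\<^sup>2 + (b t)\<^sup>2) = indicator {0..1} t *\<^sub>R speed \<gamma> t"
      using AE_not_in[OF N[unfolded negligible_iff_null_sets]] by eventually_elim (use sp in \<open>auto simp: indicator_def\<close>)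
    show "(\<lambda>t. indicator {0..1} t *\<^sub>R speed \<gamma> t) \<in> borel_measurable lebesgue"
      by (rule borel_measurable_AE[OF vm aeq])
    show "AE t in lebesgue. indicator {0..1} t *\<^sub>R speed \<gamma> t = indicator {0..1} t *\<^sub>R sqrt ((a t)\<^sup>2 + (b t)\<^sup>2)"
      using aeq by eventually_elim (rule sym)
  qed (rule vm)
  have acx: "abs_continuous_on 0 1 (\<lambda>t. fst (\<gamma> t))"
  proof (rule abs_continuous_on_dominated[OF ac ac, where M = 1])
    fix t1 t2
    have "norm (fst (\<gamma> t2 - \<gamma> t1)) \<le> norm (\<gamma> t2 - \<gamma> t1)" by (metis norm_fst_le prod.collapse)
    then show "norm (fst (\<gamma> t2) - fst (\<gamma> t1)) \<le> 1 * (norm (\<gamma> t2 - \<gamma> t1) + norm (\<gamma> t2 - \<gamma> t1))"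
      by simp
  qed
  have acy: "abs_continuous_on 0 1 (\<lambda>t. snd (\<gamma> t))"
  proof (rule abs_continuous_on_dominated[OF ac ac, where M = 1])
    fix t1 t2
    have "norm (snd (\<gamma> t2 - \<gamma> t1)) \<le> norm (\<gamma> t2 - \<gamma> t1)" by (metis norm_snd_le prod.collapse)
    then show "norm (snd (\<gamma> t2) - snd (\<gamma> t1)) \<le> 1 * (norm (\<gamma> t2 - \<gamma> t1) + norm (\<gamma> t2 - \<gamma> t1))"
      by simp
  qed
  show thesis
    by (rule that[OF N acx acy _ _ _ vint len]) (use dx dy sp in blast)+
qed

lemma horizontal_C1:
  assumes x: "\<And>t. (x has_real_derivative a t) (at t)"
    and y: "\<And>t. (y has_real_derivative x t * b t) (at t)"
    and a: "continuous_on {0..1} a" and b: "continuous_on {0..1} b"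
  shows "horizontal (\<lambda>t. (x t, y t))"
proof -
  have x': "(x has_real_derivative a t) (at t within {0..1})"
    and y': "(y has_real_derivative x t * b t) (at t within {0..1})" for t
    using x y has_field_derivative_at_within by blast+
  have contx: "continuous_on {0..1} x"
    by (rule DERIV_continuous_on) (rule x')
  have "abs_continuous_on 0 1 (\<lambda>t. (x t, y t))"
  proof (rule abs_continuous_on_dominated[where M = 1])
    show "abs_continuous_on 0 1 x" by (rule abs_continuous_on_C1[OF x' a])
    show "abs_continuous_on 0 1 y"
      by (rule abs_continuous_on_C1[OF y']) (intro continuous_intros contx b)
    show "norm ((x t, y t) - (x s, y s)) \<le> 1 * (norm (x t - x s) + norm (y t - y s))" for s t
      using norm_Pair_le[of "x t - x s" "y t - y s"] by simp
  qed
  moreover have "set_borel_measurable lebesgue {0..1} (\<lambda>t. (a t, b t))"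
  proof -
    have "(\<lambda>t. indicator {0..1} t *\<^sub>R (a t, b t)) \<in> borel_measurable borel"
      by (intro borel_measurable_continuous_on_indicator continuous_intros a b) auto
    then show ?thesis by (simp add: set_borel_measurable_def measurable_completion)
  qed
  moreover have "set_integrable lebesgue {0..1} (\<lambda>t. (norm (a t, b t))\<^sup>2)"
    by (intro absolutely_integrable_continuous_real continuous_intros a b)
  moreover have "((\<lambda>t. (x t, y t)) has_vector_derivative
      fst (a t, b t) *\<^sub>R X1 (x t, y t) + snd (a t, b t) *\<^sub>R X2 (x t, y t)) (at t within {0..1})" for t
    using has_vector_derivative_Pair[OF x'[unfolded has_real_derivative_iff_has_vector_derivative]
        y'[unfolded has_real_derivative_iff_has_vector_derivative]]
    by (simp add: X1_def X2_def mult.commute)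
  ultimately show ?thesis unfolding horizontal_def by (intro conjI exI[of _ "\<lambda>t. (a t, b t)"]) auto
qed

section \<open>The calibration\<close>

text \<open>Here \<open>s\<close> is the candidate for the abscissa of a geodesic and \<open>C\<close> a second solution of the same
  oscillator equation, which describes a field of extremals around \<open>s\<close>.\<close>

locale calibration =
  fixes \<omega> :: real and s s' C C' :: "real \<Rightarrow> real"
  assumes ds: "\<And>t. (s has_real_derivative s' t) (at t)"
    and ds': "\<And>t. (s' has_real_derivative - \<omega>\<^sup>2 * s t) (at t)"
    and dC: "\<And>t. (C has_real_derivative C' t) (at t)"
    and dC': "\<And>t. (C' has_real_derivative - \<omega>\<^sup>2 * C t) (at t)"
begin

text \<open>The slope \<open>\<phi> = C' / C\<close> solves the Riccati equation \<open>\<phi>' = - \<omega>\<^sup>2 - \<phi>\<^sup>2\<close>. Therefore \<open>S\<close> solves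
  \<open>S_t + (S_x)\<^sup>2 / 2 + \<omega>\<^sup>2 * x\<^sup>2 / 2 = 0\<close>, with \<open>S_x\<close> equal to \<open>Sx\<close>. The lower bound \<open>F\<close> for half the
  squared length is the increment of \<open>\<omega> * y + S t x\<close> between points on the graph of \<open>s\<close>.\<close>

definition \<phi> where "\<phi> t = C' t / C t"

definition S where "S t x = \<phi> t * (x - s t)\<^sup>2 / 2 + s' t * x - s t * s' t / 2"

definition Sx where "Sx t x = \<phi> t * (x - s t) + s' t"

definition F where "F y0 y1 = \<omega> * (y1 - y0) + (s 1 * s' 1 - s 0 * s' 0) / 2"

lemma d\<phi>:
  assumes "C t \<noteq> 0"
  shows "(\<phi> has_real_derivative - \<omega>\<^sup>2 - (\<phi> t)\<^sup>2) (at t)"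
proof -
  have "((\<lambda>t. C' t / C t) has_real_derivative
      ((- \<omega>\<^sup>2 * C t) * C t - C' t * C' t) / (C t * C t)) (at t)"
    by (rule DERIV_divide[OF dC' dC assms])
  moreover have "((- \<omega>\<^sup>2 * C t) * C t - C' t * C' t) / (C t * C t) = - \<omega>\<^sup>2 - (\<phi> t)\<^sup>2"
    using assms by (simp add: \<phi>_def field_simps power2_eq_square)
  ultimately show ?thesis by (simp add: \<phi>_def[abs_def])
qed

lemma continuous_s: "continuous_on A s" and continuous_s': "continuous_on A s'"
  and continuous_C: "continuous_on A C" and continuous_C': "continuous_on A C'"
  using ds ds' dC dC' by (meson DERIV_isCont continuous_at_imp_continuous_on)+

text \<open>The time in \<open>S\<close> is a free reparametrization \<open>\<tau>\<close>: lengths are compared without passing to the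
  constant speed parametrization of the curve.\<close>

lemma dS:
  assumes \<tau>: "(\<tau> has_real_derivative \<tau>') (at t within T)" and C: "C (\<tau> t) \<noteq> 0"
    and x: "(x has_real_derivative a) (at t within T)"
    and y: "(y has_real_derivative x t * b) (at t within T)"
  shows "((\<lambda>t. \<omega> * y t + S (\<tau> t) (x t)) has_real_derivative
      \<omega> * x t * b + Sx (\<tau> t) (x t) * a - \<tau>' / 2 * ((Sx (\<tau> t) (x t))\<^sup>2 + \<omega>\<^sup>2 * (x t)\<^sup>2)) (at t within T)"
proof -
  note d = DERIV_chain2[OF ds \<tau>] DERIV_chain2[OF ds' \<tau>] DERIV_chain2[OF d\<phi>[OF C] \<tau>] x y
  show ?thesis
    unfolding S_def Sx_def
    by (rule derivative_eq_intros d refl | simp)+ (simp add: field_simps power2_eq_square)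
qed

end

locale positive_calibration = calibration +
  assumes Cpos: "\<And>t. t \<in> {0..1} \<Longrightarrow> C t > 0"
begin

lemma continuous_\<phi>: "continuous_on {0..1} \<phi>"
  unfolding \<phi>_def using Cpos by (intro continuous_intros continuous_C continuous_C') force

lemma abs_continuous_S:
  assumes \<tau>: "\<And>t. t \<in> {0..1} \<Longrightarrow> (\<tau> has_real_derivative \<tau>' t) (at t within {0..1})"
    and \<tau>': "continuous_on {0..1} \<tau>'" and im: "\<And>t. t \<in> {0..1} \<Longrightarrow> \<tau> t \<in> {0..1}"
    and x: "abs_continuous_on 0 1 x" and y: "abs_continuous_on 0 1 y"
  shows "abs_continuous_on 0 1 (\<lambda>t. \<omega> * y t + S (\<tau> t) (x t))"
proof -
  have cont\<tau>: "continuous_on {0..1} \<tau>" by (rule DERIV_continuous_on) (rule \<tau>)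
  have sub: "\<tau> ` {0..1} \<subseteq> {0..1}" using im by auto
  have C\<tau>: "C (\<tau> t) \<noteq> 0" if "t \<in> {0..1}" for t using Cpos[OF im[OF that]] by simp
  have "abs_continuous_on 0 1 (\<lambda>t. s (\<tau> t))"
    by (rule abs_continuous_on_C1[OF DERIV_chain2[OF ds \<tau>]])
       (auto intro!: continuous_intros \<tau>' continuous_on_compose2[OF continuous_s' cont\<tau>])
  moreover have "abs_continuous_on 0 1 (\<lambda>t. s' (\<tau> t))"
    by (rule abs_continuous_on_C1[OF DERIV_chain2[OF ds' \<tau>]])
       (auto intro!: continuous_intros \<tau>' continuous_on_compose2[OF continuous_s cont\<tau>])
  moreover have "abs_continuous_on 0 1 (\<lambda>t. \<phi> (\<tau> t))"
    by (rule abs_continuous_on_C1[OF DERIV_chain2[OF d\<phi> \<tau>]])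
       (auto intro!: continuous_intros \<tau>' C\<tau> continuous_on_compose2[OF continuous_\<phi> cont\<tau> sub])
  ultimately show ?thesis
    unfolding S_def power2_eq_square divide_inverse
    by (intro abs_continuous_intros x y)
qed

lemma S_start: "x = s 0 \<Longrightarrow> \<omega> * y + S 0 x = \<omega> * y + s 0 * s' 0 / 2"
  and S_end: "x = s 1 \<Longrightarrow> \<omega> * y + S 1 x = \<omega> * y + s 1 * s' 1 / 2"
  by (simp_all add: S_def)

text \<open>If \<open>\<tau>\<close> were the normalized arc length of a curve of length \<open>L\<close> and speed \<open>v\<close>, the Cauchy--Schwarz
  inequality would give \<open>(\<omega> * y + S \<tau> x)' \<le> A * v - A\<^sup>2 * v / (2 * L) \<le> L * v / 2\<close>, where
  \<open>A\<^sup>2 = (Sx \<tau> x)\<^sup>2 + (\<omega> * x)\<^sup>2\<close>, and integration would prove the claim. To have a continuously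
  differentiable \<open>\<tau>\<close>, the speed is replaced by a continuous function that is close to it in the mean;
  the error is controlled by a bound \<open>M\<close> for \<open>A\<close> that holds for all \<open>\<tau>\<close>.\<close>

lemma length_bound:
  assumes hor: "horizontal \<gamma>" and start: "fst (\<gamma> 0) = s 0" and fin: "fst (\<gamma> 1) = s 1"
  shows "F (snd (\<gamma> 0)) (snd (\<gamma> 1)) \<le> (curve_length \<gamma>)\<^sup>2 / 2"
proof -
  define x where "x = (\<lambda>t. fst (\<gamma> t))"
  define y where "y = (\<lambda>t. snd (\<gamma> t))"
  define L where "L = curve_length \<gamma>"
  obtain N a b where N: "negligible N"
    and ac: "abs_continuous_on 0 1 (\<lambda>t. fst (\<gamma> t))" "abs_continuous_on 0 1 (\<lambda>t. snd (\<gamma> t))"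
    and d: "\<forall>t\<in>{0..1} - N. ((\<lambda>t. fst (\<gamma> t)) has_real_derivative a t) (at t within {0..1})"
      "\<forall>t\<in>{0..1} - N. ((\<lambda>t. snd (\<gamma> t)) has_real_derivative fst (\<gamma> t) * b t) (at t within {0..1})"
    and vint: "set_integrable lebesgue {0..1} (\<lambda>t. sqrt ((a t)\<^sup>2 + (b t)\<^sup>2))"
    and len: "curve_length \<gamma> = (LINT t:{0..1}|lebesgue. sqrt ((a t)\<^sup>2 + (b t)\<^sup>2))"
    by (rule horizontal_components[OF hor]) (rule that)
  note acx = ac(1)[folded x_def] and acy = ac(2)[folded y_def]
  have dx: "(x has_real_derivative a t) (at t within {0..1})"
    and dy: "(y has_real_derivative x t * b t) (at t within {0..1})" if "t \<in> {0..1} - N" for t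
    using d that by (simp_all add: x_def y_def)
  define v where "v t = sqrt ((a t)\<^sup>2 + (b t)\<^sup>2)" for t
  have vint: "set_integrable lebesgue {0..1} v" and len: "L = (LINT t:{0..1}|lebesgue. v t)"
    using vint len by (simp_all add: v_def[abs_def] L_def)
  have vL: "(v has_integral L) {0..1}" using has_integral_set_lebesgue[OF vint] len by simp
  have "L \<ge> 0" using has_integral_nonneg[OF vL] by (simp add: v_def)
  obtain Mx where Mx: "\<And>t. t \<in> {0..1} \<Longrightarrow> \<bar>x t\<bar> \<le> Mx" "Mx > 0"
    using abs_continuous_on_bounded[OF acx] unfolding real_norm_def by blast
  have bnd: "\<exists>M. \<forall>t\<in>{0..1}. \<bar>f t\<bar> \<le> M" if "continuous_on {0..1} f" for f :: "real \<Rightarrow> real"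
    using compact_imp_bounded[OF compact_continuous_image[OF that compact_Icc]]
    by (simp add: bounded_iff)
  obtain M1 where M1: "\<And>t. t \<in> {0..1} \<Longrightarrow> \<bar>\<phi> t\<bar> \<le> M1" using bnd[OF continuous_\<phi>] by blast
  obtain M2 where M2: "\<And>t. t \<in> {0..1} \<Longrightarrow> \<bar>s t\<bar> \<le> M2" using bnd[OF continuous_s] by blast
  obtain M3 where M3: "\<And>t. t \<in> {0..1} \<Longrightarrow> \<bar>s' t\<bar> \<le> M3" using bnd[OF continuous_s'] by blast
  have M1p: "M1 \<ge> 0" and M2p: "M2 \<ge> 0" using M1[of 0] M2[of 0] by auto
  define M where "M = M1 * (Mx + M2) + M3 + \<bar>\<omega>\<bar> * Mx"
  define A where "A r \<xi> = sqrt ((Sx r \<xi>)\<^sup>2 + (\<omega> * \<xi>)\<^sup>2)" for r \<xi>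
  have A0: "A r \<xi> \<ge> 0" for r \<xi> by (simp add: A_def)
  have AM: "A r (x t) \<le> M" if "r \<in> {0..1}" "t \<in> {0..1}" for r t
  proof -
    have "\<bar>\<phi> r * (x t - s r)\<bar> \<le> M1 * (Mx + M2)"
      unfolding abs_mult using M1[OF that(1)] M2[OF that(1)] Mx(1)[OF that(2)] M1p
      by (intro mult_mono) auto
    then have "\<bar>Sx r (x t)\<bar> \<le> M1 * (Mx + M2) + M3"
      unfolding Sx_def using M3[OF that(1)] by linarith
    moreover have "\<bar>\<omega> * x t\<bar> \<le> \<bar>\<omega>\<bar> * Mx"
      unfolding abs_mult using Mx(1)[OF that(2)] by (intro mult_left_mono) auto
    ultimately show ?thesis
      using sqrt_sum_squares_le_sum_abs[of "Sx r (x t)" "\<omega> * x t"] by (simp add: A_def M_def)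
  qed
  have M0: "M \<ge> 0" using AM[of 0 0] A0[of 0 "x 0"] by simp
  have key: "F (y 0) (y 1) \<le> M * \<epsilon> + (L + \<epsilon>)\<^sup>2 / 2" if epos: "\<epsilon> > 0" for \<epsilon>
  proof -
    obtain g where gc: "continuous_on {0..1} g" and gp: "\<And>t. g t > 0"
      and gi: "set_integrable lebesgue {0..1} (\<lambda>t. \<bar>v t - g t\<bar>)"
      and gl: "(LINT t:{0..1}|lebesgue. \<bar>v t - g t\<bar>) < \<epsilon>"
        using continuous_L1_approximation[OF vint _ epos] unfolding v_def by auto
    define I where "I = (LINT t:{0..1}|lebesgue. \<bar>v t - g t\<bar>)"
    have I: "((\<lambda>t. \<bar>v t - g t\<bar>) has_integral I) {0..1}"
      using has_integral_set_lebesgue[OF gi] by (simp add: I_def)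
    define \<Gamma> where "\<Gamma> t = integral {0..t} g" for t
    define G where "G = \<Gamma> 1"
    have gint: "g integrable_on {0..t}" if "t \<le> 1" for t
      by (rule integrable_continuous_real) (use gc that continuous_on_subset in force)
    have gG: "(g has_integral G) {0..1}"
      unfolding G_def \<Gamma>_def by (rule integrable_integral[OF gint]) simp
    have d\<Gamma>: "(\<Gamma> has_real_derivative g t) (at t within {0..1})" if "t \<in> {0..1}" for t
      unfolding \<Gamma>_def by (rule integral_has_real_derivative[OF gc that])
    have \<Gamma>mono: "\<Gamma> t1 \<le> \<Gamma> t2" if "0 \<le> t1" "t1 \<le> t2" "t2 \<le> 1" for t1 t2
      unfolding \<Gamma>_def using that gp by (intro integral_subset_le gint) (auto intro: less_imp_le)
    have "G > 0"
    proof -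
      have "integral {0..1} g \<noteq> 0"
        using integral_eq_0_iff[OF gc] gp by (metis atLeastAtMost_iff less_imp_le less_irrefl zero_le_one zero_less_one order_refl)
      moreover have "G \<ge> 0" using has_integral_nonneg[OF gG] gp by (simp add: less_imp_le)
      ultimately show ?thesis by (simp add: G_def \<Gamma>_def)
    qed
    have "G \<le> L + I"
      by (rule has_integral_le[OF gG has_integral_add[OF vL I]]) auto
    then have "G \<le> L + \<epsilon>" using gl by (simp add: I_def)
    define \<tau> where "\<tau> t = \<Gamma> t / G" for t
    have d\<tau>: "(\<tau> has_real_derivative g t / G) (at t within {0..1})" if "t \<in> {0..1}" for t
      unfolding \<tau>_def by (rule DERIV_cdivide[OF d\<Gamma>[OF that]])
    have \<tau>01: "\<tau> 0 = 0" "\<tau> 1 = 1" using \<open>G > 0\<close> by (auto simp: \<tau>_def \<Gamma>_def G_def)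
    have \<tau>im: "\<tau> t \<in> {0..1}" if "t \<in> {0..1}" for t
      using \<Gamma>mono[of 0 t] \<Gamma>mono[of t 1] that \<open>G > 0\<close>
      by (auto simp: \<tau>_def G_def[symmetric] \<Gamma>_def[of 0])
    have contd: "continuous_on {0..1} (\<lambda>t. g t / G)"
      using \<open>G > 0\<close> by (intro continuous_intros gc) auto
    define h where "h t = \<omega> * y t + S (\<tau> t) (x t)" for t
    define h' where "h' t = \<omega> * x t * b t + Sx (\<tau> t) (x t) * a t
        - (g t / G) / 2 * ((Sx (\<tau> t) (x t))\<^sup>2 + \<omega>\<^sup>2 * (x t)\<^sup>2)" for t
    have ach: "abs_continuous_on 0 1 h"
      unfolding h_def by (rule abs_continuous_S[OF d\<tau> contd \<tau>im acx acy])
    have dh: "(h has_real_derivative h' t) (at t within {0..1})" if "t \<in> {0..1} - N" for t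
      unfolding h_def h'_def using that Cpos[OF \<tau>im[of t]]
      by (intro dS d\<tau> dx dy) auto
    have hint: "(h' has_integral (h 1 - h 0)) {0..1}"
      by (rule abs_continuous_on_fundamental_theorem[OF _ ach N dh]) auto
    have bnd: "h' t \<le> M * \<bar>v t - g t\<bar> + g t * (G / 2)" if t: "t \<in> {0..1}" for t
    proof -
      let ?A = "A (\<tau> t) (x t)"
      have "(\<omega> * x t) * b t + Sx (\<tau> t) (x t) * a t \<le> ?A * v t"
        using Cauchy_Schwarz_ineq2[of "(\<omega> * x t, Sx (\<tau> t) (x t))" "(b t, a t)"]
        by (simp add: A_def v_def norm_prod_def add.commute abs_le_iff)
      moreover have "(Sx (\<tau> t) (x t))\<^sup>2 + \<omega>\<^sup>2 * (x t)\<^sup>2 = ?A\<^sup>2"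
        by (simp add: A_def power_mult_distrib)
      moreover have "?A * v t \<le> M * \<bar>v t - g t\<bar> + ?A * g t"
      proof -
        have "?A * (v t - g t) \<le> ?A * \<bar>v t - g t\<bar>" by (intro mult_left_mono A0) auto
        also have "\<dots> \<le> M * \<bar>v t - g t\<bar>" using AM[OF \<tau>im[OF t] t] by (intro mult_right_mono) auto
        finally show ?thesis by (simp add: algebra_simps)
      qed
      moreover have "?A * g t - (g t / G) / 2 * ?A\<^sup>2 \<le> g t * (G / 2)"
      proof -
        have "0 \<le> g t * (?A - G)\<^sup>2 / (2 * G)" using gp[of t] \<open>G > 0\<close> by simp
        also have "\<dots> = g t * (G / 2) - (?A * g t - (g t / G) / 2 * ?A\<^sup>2)"
          using \<open>G > 0\<close> by (simp add: field_simps power2_eq_square)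
        finally show ?thesis by simp
      qed
      ultimately show ?thesis unfolding h'_def by simp
    qed
    have "h 1 - h 0 \<le> M * I + G * (G / 2)"
      by (rule has_integral_le[OF hint has_integral_add[OF has_integral_mult_right[OF I] has_integral_mult_left[OF gG]]])
         (rule bnd)
    also have "\<dots> \<le> M * \<epsilon> + (L + \<epsilon>)\<^sup>2 / 2"
      using gl M0 \<open>G > 0\<close> mult_mono[OF \<open>G \<le> L + \<epsilon>\<close> \<open>G \<le> L + \<epsilon>\<close>] \<open>G \<le> L + \<epsilon>\<close>
      by (intro add_mono mult_left_mono) (auto simp: I_def power2_eq_square)
    also have "h 1 - h 0 = F (y 0) (y 1)"
      using S_start[of "x 0" "y 0"] S_end[of "x 1" "y 1"] start fin
      by (simp add: h_def \<tau>01 F_def x_def algebra_simps diff_divide_distrib)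
    finally show ?thesis .
  qed
  have "F (y 0) (y 1) \<le> L\<^sup>2 / 2"
  proof (rule tendsto_lowerbound)
    have "((\<lambda>\<epsilon>. M * \<epsilon> + (L + \<epsilon>)\<^sup>2 / 2) \<longlongrightarrow> M * 0 + (L + 0)\<^sup>2 / 2) (at_right 0)"
      by (intro tendsto_intros) auto
    then show "((\<lambda>\<epsilon>. M * \<epsilon> + (L + \<epsilon>)\<^sup>2 / 2) \<longlongrightarrow> L\<^sup>2 / 2) (at_right 0)" by simp
    show "\<forall>\<^sub>F \<epsilon> in at_right 0. F (y 0) (y 1) \<le> M * \<epsilon> + (L + \<epsilon>)\<^sup>2 / 2"
      using key by (auto simp: eventually_at_right_less intro: eventually_mono[OF eventually_at_right_less])
  qed simp
  then show ?thesis by (simp add: y_def L_def)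
qed

text \<open>For a curve of constant speed \<open>c\<close> the derivative of \<open>E t = c\<^sup>2 / 2 * t - (\<omega> * y + S t x)\<close> is half the
  sum of the squares of \<open>a - Sx t x\<close> and \<open>b - \<omega> * x\<close>, and its total increment is the defect \<open>D\<close>. The
  first defect controls the derivative of \<open>(x - s) / C\<close>, the second one that of \<open>y - \<omega> * p\<close>, where
  \<open>p\<close> is a primitive of \<open>x\<^sup>2\<close>. The estimate is quantitative because the end points of the cut locus
  are reached only in the limit of such calibrations.\<close>

lemma rigidity:
  assumes hor: "horizontal \<gamma>" and start: "fst (\<gamma> 0) = s 0" and fin: "fst (\<gamma> 1) = s 1"
    and sp: "AE t in lebesgue. t \<in> {0..1} \<longrightarrow> speed \<gamma> t = c"
    and t: "0 \<le> t1" "t1 \<le> t2" "t2 \<le> 1" and "\<eta> > 0"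
    and m: "\<And>t. t \<in> {t1..t2} \<Longrightarrow> m \<le> C t" "m > 0"
  defines "D \<equiv> c\<^sup>2 / 2 - F (snd (\<gamma> 0)) (snd (\<gamma> 1))"
  shows "\<bar>(fst (\<gamma> t2) - s t2) / C t2 - (fst (\<gamma> t1) - s t1) / C t1\<bar> \<le> (1 / m) * (\<eta> / 2 + D / \<eta>)"
    and "\<lbrakk>\<And>t. t \<in> {0..1} \<Longrightarrow> (p has_real_derivative (fst (\<gamma> t))\<^sup>2) (at t within {0..1});
          \<And>t. t \<in> {0..1} \<Longrightarrow> \<bar>fst (\<gamma> t)\<bar> \<le> M; M > 0\<rbrakk> \<Longrightarrow>
        \<bar>(snd (\<gamma> t2) - \<omega> * p t2) - (snd (\<gamma> t1) - \<omega> * p t1)\<bar> \<le> M * (\<eta> / 2 + D / \<eta>)"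
proof -
  define x where "x = (\<lambda>t. fst (\<gamma> t))"
  define y where "y = (\<lambda>t. snd (\<gamma> t))"
  obtain N0 a b where N0: "negligible N0"
    and ac: "abs_continuous_on 0 1 (\<lambda>t. fst (\<gamma> t))" "abs_continuous_on 0 1 (\<lambda>t. snd (\<gamma> t))"
    and d: "\<forall>t\<in>{0..1} - N0. ((\<lambda>t. fst (\<gamma> t)) has_real_derivative a t) (at t within {0..1})"
      "\<forall>t\<in>{0..1} - N0. ((\<lambda>t. snd (\<gamma> t)) has_real_derivative fst (\<gamma> t) * b t) (at t within {0..1})"
    and sp0: "\<forall>t\<in>{0..1} - N0. speed \<gamma> t = sqrt ((a t)\<^sup>2 + (b t)\<^sup>2)"
    by (rule horizontal_components[OF hor]) (rule that)
  note acx = ac(1)[folded x_def] and acy = ac(2)[folded y_def]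
  obtain N1 where N1: "negligible N1" and sp1: "\<forall>t\<in>{0..1} - N1. speed \<gamma> t = c"
    by (rule AE_lebesgue_negligibleE[OF sp]) (rule that)
  define N where "N = N0 \<union> N1"
  have N: "negligible N" using N0 N1 by (auto simp: N_def)
  have c2: "(a t)\<^sup>2 + (b t)\<^sup>2 = c\<^sup>2" if "t \<in> {0..1} - N" for t
  proof -
    have "sqrt ((a t)\<^sup>2 + (b t)\<^sup>2) = c" using sp0 sp1 that by (metis DiffD1 DiffD2 DiffI N_def UnI1 UnI2)
    then show ?thesis by auto
  qed
  have dx: "(x has_real_derivative a t) (at t within {0..1})"
    and dy: "(y has_real_derivative x t * b t) (at t within {0..1})" if "t \<in> {0..1} - N" for t
    using d that by (simp_all add: N_def x_def y_def)
  define E where "E t = c\<^sup>2 / 2 * t - (\<omega> * y t + S t (x t))" for t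
  define E' where "E' t = ((a t - Sx t (x t))\<^sup>2 + (b t - \<omega> * x t)\<^sup>2) / 2" for t
  have acE: "abs_continuous_on 0 1 E"
    unfolding E_def
    by (intro abs_continuous_intros abs_continuous_S[where \<tau>' = "\<lambda>_. 1"] acx acy)
       (auto intro!: derivative_eq_intros)
  have dE: "(E has_real_derivative E' t) (at t within {0..1})" if "t \<in> {0..1} - N" for t
  proof -
    have "(E has_real_derivative c\<^sup>2 / 2 - (\<omega> * x t * b t + Sx t (x t) * a t -
        1 / 2 * ((Sx t (x t))\<^sup>2 + \<omega>\<^sup>2 * (x t)\<^sup>2))) (at t within {0..1})"
      unfolding E_def using that Cpos[of t]
      by (intro DERIV_diff dS dx dy) (auto intro!: derivative_eq_intros)
    also have "c\<^sup>2 / 2 - (\<omega> * x t * b t + Sx t (x t) * a t -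
        1 / 2 * ((Sx t (x t))\<^sup>2 + \<omega>\<^sup>2 * (x t)\<^sup>2)) = E' t"
      using c2[OF that] by (simp add: E'_def power2_eq_square algebra_simps)
    finally show ?thesis .
  qed
  have DE: "E 1 - E 0 = D"
    using S_start[of "x 0" "y 0"] S_end[of "x 1" "y 1"] start fin
    by (simp add: E_def D_def F_def x_def y_def algebra_simps diff_divide_distrib)
  have E'nn: "E' t \<ge> 0" for t by (simp add: E'_def)
  define k where "k t = \<bar>a t - Sx t (x t)\<bar>" for t
  have tsub: "t \<in> {0..1} - N" if "t \<in> {t1..t2} - N" for t using that t by auto
  have Cpos': "C t > 0" if "t \<in> {t1..t2}" for t using m(1)[OF that] m(2) by linarith
  have "\<bar>(x t2 - s t2) / C t2 - (x t1 - s t1) / C t1\<bar> \<le> (1 / m) * (\<eta> / 2 + (E 1 - E 0) / \<eta>)"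
  proof (rule abs_continuous_on_increment_le[OF t acE _ N dE _ E'nn, where f' = "\<lambda>t. (a t - Sx t (x t)) / C t" and r = k])
    have "abs_continuous_on t1 t2 (\<lambda>t. 1 / C t)"
    proof (rule abs_continuous_on_C1)
      fix u assume "u \<in> {t1..t2}"
      then show "((\<lambda>t. 1 / C t) has_real_derivative - C' u / (C u)\<^sup>2) (at u within {t1..t2})"
        using Cpos'[of u] by (auto intro!: derivative_eq_intros has_field_derivative_at_within[OF dC]
            simp: power2_eq_square field_simps)
    next
      show "continuous_on {t1..t2} (\<lambda>u. - C' u / (C u)\<^sup>2)"
        using Cpos' by (intro continuous_intros continuous_C continuous_C') force
    qed
    moreover have "abs_continuous_on t1 t2 s"
      by (rule abs_continuous_on_C1[OF has_field_derivative_at_within[OF ds] continuous_s'])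
    ultimately have "abs_continuous_on t1 t2 (\<lambda>t. (x t - s t) * (1 / C t))"
      by (intro abs_continuous_intros abs_continuous_on_subinterval[OF acx] t)
    then show "abs_continuous_on t1 t2 (\<lambda>t. (x t - s t) / C t)" by simp
    show "((\<lambda>t. (x t - s t) / C t) has_real_derivative (a u - Sx u (x u)) / C u) (at u within {t1..t2})"
      if "u \<in> {t1..t2} - N" for u
    proof -
      have xd: "(x has_real_derivative a u) (at u within {t1..t2})"
        using DERIV_subset[OF dx[OF tsub[OF that]]] t by auto
      have "C u \<noteq> 0" using Cpos'[of u] that by auto
      have "((\<lambda>t. (x t - s t) / C t) has_real_derivative
          ((a u - s' u) * C u - (x u - s u) * C' u) / (C u * C u)) (at u within {t1..t2})"
        by (rule DERIV_divide[OF DERIV_diff[OF xd has_field_derivative_at_within[OF ds]]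
              has_field_derivative_at_within[OF dC] \<open>C u \<noteq> 0\<close>])
      also have "((a u - s' u) * C u - (x u - s u) * C' u) / (C u * C u) = (a u - Sx u (x u)) / C u"
        using \<open>C u \<noteq> 0\<close> by (simp add: Sx_def \<phi>_def field_simps)
      finally show ?thesis .
    qed
    show "\<bar>(a u - Sx u (x u)) / C u\<bar> \<le> 1 / m * k u \<and> (k u)\<^sup>2 \<le> 2 * E' u" if "u \<in> {t1..t2} - N" for u
    proof
      have "\<bar>(a u - Sx u (x u)) / C u\<bar> = k u / C u"
        using Cpos'[of u] that by (simp add: k_def abs_divide)
      also have "\<dots> \<le> k u / m"
        using m(1)[of u] m(2) that by (intro divide_left_mono) (auto simp: k_def)
      finally show "\<bar>(a u - Sx u (x u)) / C u\<bar> \<le> 1 / m * k u" by simp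
      show "(k u)\<^sup>2 \<le> 2 * E' u" by (simp add: k_def E'_def)
    qed
  qed (use m \<open>\<eta> > 0\<close> in auto)
  then show "\<bar>(fst (\<gamma> t2) - s t2) / C t2 - (fst (\<gamma> t1) - s t1) / C t1\<bar> \<le> (1 / m) * (\<eta> / 2 + D / \<eta>)"
    by (simp add: DE x_def)
  assume p: "\<And>t. t \<in> {0..1} \<Longrightarrow> (p has_real_derivative (fst (\<gamma> t))\<^sup>2) (at t within {0..1})"
    and M: "\<And>t. t \<in> {0..1} \<Longrightarrow> \<bar>fst (\<gamma> t)\<bar> \<le> M" "M > 0"
  have "\<bar>(y t2 - \<omega> * p t2) - (y t1 - \<omega> * p t1)\<bar> \<le> M * (\<eta> / 2 + (E 1 - E 0) / \<eta>)"
  proof (rule abs_continuous_on_increment_le[OF t acE _ N dE _ E'nn,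
        where f' = "\<lambda>t. x t * (b t - \<omega> * x t)" and r = "\<lambda>t. \<bar>b t - \<omega> * x t\<bar>"])
    have "abs_continuous_on 0 1 p"
      by (rule abs_continuous_on_C1[OF p]) (auto intro!: continuous_intros
          abs_continuous_on_imp_continuous_on[OF acx, unfolded x_def])
    then have "abs_continuous_on 0 1 (\<lambda>t. y t - \<omega> * p t)"
      by (intro abs_continuous_intros acy)
    then show "abs_continuous_on t1 t2 (\<lambda>t. y t - \<omega> * p t)"
      by (rule abs_continuous_on_subinterval) (use t in auto)
    show "((\<lambda>t. y t - \<omega> * p t) has_real_derivative x u * (b u - \<omega> * x u)) (at u within {t1..t2})"
      if "u \<in> {t1..t2} - N" for u
    proof (rule DERIV_subset[where s = "{0..1}"])
      show "((\<lambda>t. y t - \<omega> * p t) has_real_derivative x u * (b u - \<omega> * x u)) (at u within {0..1})"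
        using tsub[OF that] by (auto intro!: derivative_eq_intros dy p simp: x_def power2_eq_square algebra_simps)
    qed (use t in auto)
    show "\<bar>x u * (b u - \<omega> * x u)\<bar> \<le> M * \<bar>b u - \<omega> * x u\<bar> \<and> \<bar>b u - \<omega> * x u\<bar>\<^sup>2 \<le> 2 * E' u"
      if "u \<in> {t1..t2} - N" for u
    proof
      show "\<bar>x u * (b u - \<omega> * x u)\<bar> \<le> M * \<bar>b u - \<omega> * x u\<bar>"
        unfolding abs_mult using M(1)[of u] tsub[OF that] by (intro mult_right_mono) (auto simp: x_def)
    qed (simp add: E'_def)
  qed (use M \<open>\<eta> > 0\<close> in auto)
  then show "\<bar>(snd (\<gamma> t2) - \<omega> * p t2) - (snd (\<gamma> t1) - \<omega> * p t1)\<bar> \<le> M * (\<eta> / 2 + D / \<eta>)"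
    by (simp add: DE y_def)
qed

end

section \<open>Explicit geodesics\<close>

context calibration
begin

lemma energy_const: "(s' t)\<^sup>2 + \<omega>\<^sup>2 * (s t)\<^sup>2 = (s' 0)\<^sup>2 + \<omega>\<^sup>2 * (s 0)\<^sup>2"
proof -
  have "((\<lambda>t. (s' t)\<^sup>2 + \<omega>\<^sup>2 * (s t)\<^sup>2) has_real_derivative 0) (at t)" for t
    by (auto intro!: derivative_eq_intros ds ds' simp: power2_eq_square)
  then show ?thesis
    by (intro DERIV_isconst_all[where f = "\<lambda>t. (s' t)\<^sup>2 + \<omega>\<^sup>2 * (s t)\<^sup>2"]) auto
qed

definition speed_of where "speed_of = sqrt ((s' 0)\<^sup>2 + \<omega>\<^sup>2 * (s 0)\<^sup>2)"

lemma speed_of_sq: "speed_of\<^sup>2 = (s' t)\<^sup>2 + \<omega>\<^sup>2 * (s t)\<^sup>2"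
  unfolding energy_const[of t] by (simp add: speed_of_def)

text \<open>The height of the curve grows at the rate \<open>\<omega> * s\<^sup>2\<close>, which is the control \<open>b = \<omega> * s\<close>: it vanishes
  on the singular line, so the speed is the conserved energy there as well.\<close>

lemma extremal_curve:
  assumes dy: "\<And>t. (y has_real_derivative \<omega> * (s t)\<^sup>2) (at t)"
  shows "horizontal (\<lambda>t. (s t, y t))"
    and "t \<in> {0..1} \<Longrightarrow> speed (\<lambda>t. (s t, y t)) t = speed_of"
    and "curve_length (\<lambda>t. (s t, y t)) = speed_of"
    and "F (y 0) (y 1) = speed_of\<^sup>2 / 2"
proof -
  have dy': "(y has_real_derivative s t * (\<omega> * s t)) (at t)" for t
    using dy[of t] by (simp add: power2_eq_square mult.left_commute)
  show "horizontal (\<lambda>t. (s t, y t))"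
    by (rule horizontal_C1[OF ds dy']) (intro continuous_intros continuous_s continuous_s')+
  show sp: "speed (\<lambda>t. (s t, y t)) t = speed_of" if "t \<in> {0..1}" for t
  proof -
    have "speed (\<lambda>t. (s t, y t)) t = sqrt ((s' t)\<^sup>2 + (if fst (s t, y t) = 0 then 0 else \<omega> * s t)\<^sup>2)"
      by (rule speed_eq[OF that]) (auto intro: has_field_derivative_at_within ds dy')
    also have "(if fst (s t, y t) = 0 then 0 else \<omega> * s t) = \<omega> * s t" by simp
    finally show ?thesis
      using energy_const[of t] by (simp add: speed_of_def power_mult_distrib)
  qed
  show "curve_length (\<lambda>t. (s t, y t)) = speed_of"
  proof -
    have "curve_length (\<lambda>t. (s t, y t)) = (LINT t:{0..1::real}|lebesgue. speed_of)"
      unfolding curve_length_def by (rule set_lebesgue_integral_cong) (auto simp: sp)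
    then show ?thesis by (simp add: set_lebesgue_integral_def)
  qed
  have "((\<lambda>t. \<omega> * y t + s t * s' t / 2 - speed_of\<^sup>2 / 2 * t) has_real_derivative 0) (at t)" for t
    unfolding speed_of_sq[of t]
    by (auto intro!: derivative_eq_intros ds ds' dy simp: power2_eq_square field_simps)
  from DERIV_isconst_all[OF allI, OF this, of 1 0] show "F (y 0) (y 1) = speed_of\<^sup>2 / 2"
    by (simp add: F_def field_simps)
qed

end

lemma curve_length_nonneg:
  assumes "horizontal \<gamma>"
  shows "curve_length \<gamma> \<ge> 0"
proof (rule horizontal_components[OF assms])
  fix a b
  assume "set_integrable lebesgue {0..1} (\<lambda>t. sqrt ((a t)\<^sup>2 + (b t)\<^sup>2))"
    "curve_length \<gamma> = (LINT t:{0..1}|lebesgue. sqrt ((a t)\<^sup>2 + (b t)\<^sup>2))"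
  then show "curve_length \<gamma> \<ge> 0"
    using has_integral_nonneg[OF has_integral_set_lebesgue] by fastforce
qed

lemma const_speed_length:
  assumes "AE t in lebesgue. t \<in> {0..1} \<longrightarrow> speed \<gamma> t = c" "horizontal \<gamma>"
  shows "curve_length \<gamma> = c"
proof -
  obtain N where N: "negligible N" "\<forall>t\<in>{0..1} - N. speed \<gamma> t = c"
    by (rule AE_lebesgue_negligibleE[OF assms(1)]) (rule that)
  obtain N' a b where N': "negligible N'"
    "\<forall>t\<in>{0..1} - N'. speed \<gamma> t = sqrt ((a t)\<^sup>2 + (b t)\<^sup>2)"
    "set_integrable lebesgue {0..1} (\<lambda>t. sqrt ((a t)\<^sup>2 + (b t)\<^sup>2))"
    "curve_length \<gamma> = (LINT t:{0..1}|lebesgue. sqrt ((a t)\<^sup>2 + (b t)\<^sup>2))"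
    by (rule horizontal_components[OF assms(2)]) (rule that)
  have I: "((\<lambda>t. sqrt ((a t)\<^sup>2 + (b t)\<^sup>2)) has_integral curve_length \<gamma>) {0..1}"
    using has_integral_set_lebesgue[OF N'(3)] N'(4) by simp
  have "((\<lambda>_. c) has_integral curve_length \<gamma>) {0..1::real}"
    by (rule has_integral_spike[OF negligible_Un[OF N(1) N'(1)] _ I]) (use N(2) N'(2) in force)
  moreover have "((\<lambda>_. c) has_integral c) {0..1::real}"
    using has_integral_const_real[of c 0 1] by simp
  ultimately show ?thesis by (rule has_integral_unique)
qed

context positive_calibration
begin

text \<open>The lower bound of \<open>length_bound\<close> is attained, since all defects vanish on the curve itself.\<close>

lemma extremal_minimizing:
  assumes dy: "\<And>t. (y has_real_derivative \<omega> * (s t)\<^sup>2) (at t)"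
  shows "grushin_dist (s 0, y 0) (s 1, y 1) = speed_of"
    and "minimizing_geodesic (\<lambda>t. (s t, y t))"
proof -
  note ec = extremal_curve[OF dy]
  have nn: "speed_of \<ge> 0" by (simp add: speed_of_def)
  show d: "grushin_dist (s 0, y 0) (s 1, y 1) = speed_of"
    unfolding grushin_dist_def
  proof (rule cInf_eq_minimum)
    show "speed_of \<in> {curve_length \<gamma> |\<gamma>. horizontal \<gamma> \<and> \<gamma> 0 = (s 0, y 0) \<and> \<gamma> 1 = (s 1, y 1)}"
      using ec(1,3) by (intro CollectI exI[of _ "\<lambda>t. (s t, y t)"]) simp
    fix l assume "l \<in> {curve_length \<gamma> |\<gamma>. horizontal \<gamma> \<and> \<gamma> 0 = (s 0, y 0) \<and> \<gamma> 1 = (s 1, y 1)}"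
    then obtain \<gamma> where \<gamma>: "l = curve_length \<gamma>" "horizontal \<gamma>" "\<gamma> 0 = (s 0, y 0)" "\<gamma> 1 = (s 1, y 1)"
      by blast
    have "speed_of\<^sup>2 \<le> l\<^sup>2"
      using length_bound[OF \<gamma>(2)] \<gamma> ec(4) by simp
    moreover have "l \<ge> 0" using curve_length_nonneg[OF \<gamma>(2)] \<gamma>(1) by simp
    ultimately show "speed_of \<le> l" by (rule power2_le_imp_le)
  qed
  show "minimizing_geodesic (\<lambda>t. (s t, y t))"
    unfolding minimizing_geodesic_def
    using ec(1-3) d by (intro conjI exI[of _ speed_of]) auto
qed

lemma C_lower_bound:
  obtains m where "m > 0" "\<forall>t\<in>{0..1}. m \<le> C t"
proof -
  obtain t0 where "t0 \<in> {0..1}" "\<forall>t\<in>{0..1}. C t0 \<le> C t"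
    using continuous_attains_inf[OF compact_Icc _ continuous_C[of "{0..1}"]] by auto
  then show thesis using Cpos by (intro that[of "C t0"]) auto
qed

text \<open>A minimizer has the speed of the extremal, so its defect is \<open>0\<close> and both estimates of \<open>rigidity\<close>
  hold with an arbitrarily small right-hand side.\<close>

lemma extremal_unique:
  assumes dy: "\<And>t. (y has_real_derivative \<omega> * (s t)\<^sup>2) (at t)"
    and min: "minimizing_geodesic \<gamma>" and ends: "\<gamma> 0 = (s 0, y 0)" "\<gamma> 1 = (s 1, y 1)"
    and t: "t \<in> {0..1}"
  shows "\<gamma> t = (s t, y t)"
proof -
  have hor: "horizontal \<gamma>" using min by (simp add: minimizing_geodesic_def)
  obtain c where c: "AE t in lebesgue. t \<in> {0..1} \<longrightarrow> speed \<gamma> t = c"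
    using min by (auto simp: minimizing_geodesic_def)
  have "c = speed_of"
    using const_speed_length[OF c hor] min ends extremal_minimizing(1)[OF dy]
    by (simp add: minimizing_geodesic_def)
  then have D0: "c\<^sup>2 / 2 - F (snd (\<gamma> 0)) (snd (\<gamma> 1)) = 0"
    using extremal_curve(4)[OF dy] ends by simp
  obtain m where m: "m > 0" "\<forall>t\<in>{0..1}. m \<le> C t" by (rule C_lower_bound)
  have start: "fst (\<gamma> 0) = s 0" and fin: "fst (\<gamma> 1) = s 1" using ends by auto
  have small: "x = 0" if "\<And>\<eta>. \<eta> > 0 \<Longrightarrow> \<bar>x\<bar> \<le> K * (\<eta> / 2)" "K > 0" for x K :: real
  proof (rule ccontr)
    assume "x \<noteq> 0"
    then show False using that(1)[of "\<bar>x\<bar> / K"] that(2) by (simp add: field_simps)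
  qed
  have xs: "fst (\<gamma> t) = s t" if t: "t \<in> {0..1}" for t
  proof -
    have "\<bar>(fst (\<gamma> t) - s t) / C t - (fst (\<gamma> 0) - s 0) / C 0\<bar> \<le> (1 / m) * (\<eta> / 2)" if "\<eta> > 0" for \<eta>
      using rigidity(1)[OF hor start fin c, of 0 t \<eta> m] that m t D0 by simp
    then have "(fst (\<gamma> t) - s t) / C t - (fst (\<gamma> 0) - s 0) / C 0 = 0"
      by (rule small) (use m in auto)
    then show ?thesis using start Cpos[OF t] by simp
  qed
  have cx: "continuous_on {0..1} (\<lambda>t. fst (\<gamma> t))"
    by (rule continuous_on_eq[OF continuous_s]) (simp add: xs)
  obtain M where M: "\<forall>t\<in>{0..1}. \<bar>fst (\<gamma> t)\<bar> \<le> M" "M > 0"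
    using compact_imp_bounded[OF compact_continuous_image[OF cx compact_Icc]]
    by (auto simp: bounded_pos)
  define p where "p t = integral {0..t} (\<lambda>t. (fst (\<gamma> t))\<^sup>2)" for t
  have dp: "(p has_real_derivative (fst (\<gamma> t))\<^sup>2) (at t within {0..1})" if "t \<in> {0..1}" for t
    unfolding p_def by (rule integral_has_real_derivative) (use that in \<open>auto intro!: continuous_intros cx\<close>)
  have "\<bar>(snd (\<gamma> t) - \<omega> * p t) - (snd (\<gamma> 0) - \<omega> * p 0)\<bar> \<le> M * (\<eta> / 2)" if "\<eta> > 0" for \<eta>
    using rigidity(2)[OF hor start fin c, of 0 t \<eta> m p M] that m M t D0 dp by simp
  then have 1: "(snd (\<gamma> t) - \<omega> * p t) - (snd (\<gamma> 0) - \<omega> * p 0) = 0"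
    by (rule small) (use M in auto)
  have "y t - \<omega> * p t = y 0 - \<omega> * p 0"
  proof (rule has_field_derivative_zero_constant[of "{0..1}" "\<lambda>t. y t - \<omega> * p t", THEN exE])
    show "((\<lambda>t. y t - \<omega> * p t) has_real_derivative 0) (at u within {0..1})" if "u \<in> {0..1}" for u
      using xs[OF that] by (auto intro!: derivative_eq_intros dp[OF that] has_field_derivative_at_within[OF dy])
    fix k assume "\<forall>u\<in>{0..1}. y u - \<omega> * p u = k"
    then show ?thesis using t by simp
  qed simp
  then show ?thesis using 1 xs[OF t] ends by (simp add: prod_eq_iff)
qed

end

text \<open>The integral of \<open>(x0 * cos u + q * sin u)\<^sup>2\<close> over \<open>u\<close> between \<open>0\<close> and \<open>\<theta>\<close>.\<close>

definition rise :: "real \<Rightarrow> real \<Rightarrow> real \<Rightarrow> real" where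
  "rise x0 q \<theta> = (x0\<^sup>2 + q\<^sup>2) / 2 * \<theta> + (x0\<^sup>2 - q\<^sup>2) / 2 * (sin \<theta> * cos \<theta>) + x0 * q * (sin \<theta>)\<^sup>2"

definition wave :: "real \<Rightarrow> real \<Rightarrow> real \<Rightarrow> real" where
  "wave x0 q \<theta> = x0 * cos \<theta> + q * sin \<theta>"

definition geo :: "plane \<Rightarrow> real \<Rightarrow> real \<Rightarrow> real \<Rightarrow> plane" where
  "geo p q \<omega> t = (wave (fst p) q (\<omega> * t), snd p + rise (fst p) q (\<omega> * t))"

lemma d_rise: "(rise x0 q has_real_derivative (wave x0 q \<theta>)\<^sup>2) (at \<theta>)"
  unfolding rise_def wave_def
  apply (rule derivative_eq_intros refl | simp)+
  using sin_cos_squared_add[of \<theta>] by algebra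

text \<open>The comparison solution \<open>cos (\<omega> * (t - 1/2))\<close> is centred at the midpoint, so that it is positive on
  the unit interval for the full range \<open>\<bar>\<omega>\<bar> < pi\<close>.\<close>

lemma calibration_wave:
  "calibration \<omega> (\<lambda>t. wave x0 q (\<omega> * t)) (\<lambda>t. \<omega> * (q * cos (\<omega> * t) - x0 * sin (\<omega> * t)))
     (\<lambda>t. cos (\<omega> * (t - 1/2))) (\<lambda>t. - \<omega> * sin (\<omega> * (t - 1/2)))"
  by standard (auto intro!: derivative_eq_intros simp: wave_def power2_eq_square algebra_simps)

lemma cos_half_pos:
  assumes "\<bar>\<omega>\<bar> < pi" "t \<in> {0..1}"
  shows "cos (\<omega> * (t - 1/2)) > 0"
proof (rule cos_gt_zero_pi)
  have "\<bar>\<omega> * (t - 1/2)\<bar> \<le> \<bar>\<omega>\<bar> * (1/2)"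
    unfolding abs_mult using assms(2) by (intro mult_left_mono) (auto simp del: abs_le_iff simp: abs_if)
  then show "- (pi / 2) < \<omega> * (t - 1/2)" "\<omega> * (t - 1/2) < pi / 2" using assms by auto
qed

lemma positive_calibration_wave:
  assumes "\<bar>\<omega>\<bar> < pi"
  shows "positive_calibration \<omega> (\<lambda>t. wave x0 q (\<omega> * t)) (\<lambda>t. \<omega> * (q * cos (\<omega> * t) - x0 * sin (\<omega> * t)))
     (\<lambda>t. cos (\<omega> * (t - 1/2))) (\<lambda>t. - \<omega> * sin (\<omega> * (t - 1/2)))"
  unfolding positive_calibration_def positive_calibration_axioms_def
  using calibration_wave cos_half_pos[OF assms] by auto

lemma d_rise_scaled: "((\<lambda>t. y0 + rise x0 q (\<omega> * t)) has_real_derivative \<omega> * (wave x0 q (\<omega> * t))\<^sup>2) (at t)"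
proof -
  have "((\<lambda>t. \<omega> * t) has_real_derivative \<omega>) (at t)" by (auto intro!: derivative_eq_intros)
  from DERIV_chain2[OF d_rise this] show ?thesis
    by (auto intro!: derivative_eq_intros simp: mult.commute)
qed

lemma geo_start: "geo p q \<omega> 0 = p"
  by (simp add: geo_def wave_def rise_def)

lemma wave_speed: "calibration.speed_of \<omega> (\<lambda>t. wave x0 q (\<omega> * t)) (\<lambda>t. \<omega> * (q * cos (\<omega> * t) - x0 * sin (\<omega> * t)))
    = \<bar>\<omega>\<bar> * sqrt (x0\<^sup>2 + q\<^sup>2)"
proof -
  have "(\<omega> * q)\<^sup>2 + \<omega>\<^sup>2 * x0\<^sup>2 = \<omega>\<^sup>2 * (x0\<^sup>2 + q\<^sup>2)" by (simp add: algebra_simps power_mult_distrib)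
  then show ?thesis
    unfolding calibration.speed_of_def[OF calibration_wave]
    by (simp add: wave_def real_sqrt_mult)
qed

lemma geo_horizontal: "horizontal (geo p q \<omega>)"
  and geo_length: "curve_length (geo p q \<omega>) = \<bar>\<omega>\<bar> * sqrt ((fst p)\<^sup>2 + q\<^sup>2)"
  using calibration.extremal_curve(1,3)[OF calibration_wave d_rise_scaled[of "snd p" "fst p" q \<omega>]]
  by (simp_all add: geo_def[abs_def] wave_speed)

lemma geo_minimizing:
  assumes "\<bar>\<omega>\<bar> < pi"
  shows "minimizing_geodesic (geo p q \<omega>)"
    and "grushin_dist p (geo p q \<omega> 1) = \<bar>\<omega>\<bar> * sqrt ((fst p)\<^sup>2 + q\<^sup>2)"
  using positive_calibration.extremal_minimizing[OF positive_calibration_wave[OF assms] d_rise_scaled[of "snd p" "fst p" q \<omega>]]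
  by (simp_all add: geo_def[abs_def] wave_speed wave_def[of _ _ 0] rise_def[of _ _ 0])

lemma geo_unique:
  assumes "\<bar>\<omega>\<bar> < pi" "minimizing_geodesic \<gamma>" "\<gamma> 0 = p" "\<gamma> 1 = geo p q \<omega> 1" "t \<in> {0..1}"
  shows "\<gamma> t = geo p q \<omega> t"
  unfolding geo_def
  by (rule positive_calibration.extremal_unique[OF positive_calibration_wave[OF assms(1)] d_rise_scaled assms(2) _ _ assms(5)])
     (use assms in \<open>simp_all add: geo_def wave_def[of _ _ 0] rise_def[of _ _ 0]\<close>)

text \<open>The calibration with \<open>\<omega> = 0\<close> and constant \<open>C\<close> shows that only straight segments minimize.\<close>

lemma flat_geodesic:
  assumes "minimizing_geodesic \<gamma>" "snd (\<gamma> 1) = snd (\<gamma> 0)" "t \<in> {0..1}"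
  shows "snd (\<gamma> t) = snd (\<gamma> 0)"
proof -
  define a where "a = fst (\<gamma> 0)"
  define b where "b = fst (\<gamma> 1)"
  have "positive_calibration 0 (\<lambda>t. a + (b - a) * t) (\<lambda>t. b - a) (\<lambda>t. 1) (\<lambda>t. 0)"
    by standard (auto intro!: derivative_eq_intros)
  then have "\<gamma> t = (a + (b - a) * t, snd (\<gamma> 0))"
    by (rule positive_calibration.extremal_unique[OF _ _ assms(1) _ _ assms(3), where y = "\<lambda>_. snd (\<gamma> 0)"])
       (use assms in \<open>auto simp: a_def b_def prod_eq_iff\<close>)
  then show ?thesis by simp
qed

section \<open>Geodesics to the cut locus\<close>

lemma geo_end: "geo (x0, y0) q \<omega> 1 = (wave x0 q \<omega>, y0 + rise x0 q \<omega>)"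
  by (simp add: geo_def)

lemma sign_trig:
  assumes "\<epsilon> = 1 \<or> \<epsilon> = (-1::real)"
  shows "cos (\<epsilon> * x) = cos x" "sin (\<epsilon> * x) = \<epsilon> * sin x" "\<epsilon> * \<epsilon> = 1" "\<bar>\<epsilon> * x\<bar> = \<bar>x\<bar>"
  using assms by auto

lemma cot_half_tendsto: "((\<lambda>l::real. (1 + cos l) / sin l) \<longlongrightarrow> 0) (at_left pi)"
  by real_asymp

text \<open>The end points of the line \<open>x = - x0\<close> that no \<open>\<bar>\<omega>\<bar> < pi\<close> reaches. The curve with \<open>\<omega> = \<epsilon> * pi\<close> has half the
  squared length \<open>pi * h\<close>. Let \<open>l < pi\<close> tend to \<open>pi\<close>: the extremals with \<open>\<omega> = \<epsilon> * l\<close> that join the abscissas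
  \<open>x0\<close> and \<open>- x0\<close> calibrate a minimizer up to a defect \<open>\<delta> l\<close> that tends to \<open>0\<close>. The comparison
  solution tends to \<open>sin (pi * t)\<close>, which vanishes at both ends. So in the limit
  \<open>(x - x0 * cos (pi * t)) / sin (pi * t)\<close> is constant on the open interval, but the constant is not
  determined; up to the sign it is the parameter \<open>q\<close> of the family of minimizers.\<close>

lemma cut_geodesic:
  assumes min: "minimizing_geodesic \<gamma>" and start: "\<gamma> 0 = (x0, y0)" and fin: "\<gamma> 1 = (- x0, y0 + \<epsilon> * h)"
    and \<epsilon>: "\<epsilon> = 1 \<or> \<epsilon> = -1" and h: "h > 0" "h \<ge> pi / 2 * x0\<^sup>2"
  shows "\<exists>q. \<forall>t\<in>{0..1}. \<gamma> t = geo (x0, y0) q (\<epsilon> * pi) t"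
proof -
  note st = sign_trig[OF \<epsilon>]
  have hor: "horizontal \<gamma>" using min by (simp add: minimizing_geodesic_def)
  obtain c where c: "AE t in lebesgue. t \<in> {0..1} \<longrightarrow> speed \<gamma> t = c"
    using min by (auto simp: minimizing_geodesic_def)
  have cL: "curve_length \<gamma> = c" by (rule const_speed_length[OF c hor])
  (* The curve with angle \<epsilon> * pi has the squared length 2 * pi * h and competes with the minimizer. *)
  have c2: "c\<^sup>2 \<le> 2 * pi * h"
  proof -
    define b where "b = sqrt (2 * h / pi - x0\<^sup>2)"
    have b2: "x0\<^sup>2 + b\<^sup>2 = 2 * h / pi" using h by (simp add: b_def field_simps)
    have "geo (x0, y0) b (\<epsilon> * pi) 1 = (- x0, y0 + \<epsilon> * h)"
      using b2 by (simp add: geo_end wave_def rise_def st)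
    then have "grushin_dist (\<gamma> 0) (\<gamma> 1) \<le> curve_length (geo (x0, y0) b (\<epsilon> * pi))"
      unfolding grushin_dist_def
      by (intro cInf_lower bdd_belowI[of _ 0])
         (use start fin geo_horizontal geo_start curve_length_nonneg in \<open>auto intro!: exI[of _ "geo (x0, y0) b (\<epsilon> * pi)"]\<close>)
    then have "c \<le> pi * sqrt (2 * h / pi)"
      using min cL b2 by (simp add: minimizing_geodesic_def geo_length st)
    moreover have "c \<ge> 0" using curve_length_nonneg[OF hor] cL by simp
    ultimately have "c\<^sup>2 \<le> (pi * sqrt (2 * h / pi))\<^sup>2" by (intro power_mono)
    also have "\<dots> = 2 * pi * h"
      unfolding power_mult_distrib using h by (simp add: power2_eq_square[of pi])
    finally show ?thesis .
  qed
  (* This parameter makes the extremal with angle \<epsilon> * l end at - x0. *)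
  define q where "q l = - x0 * \<epsilon> * ((1 + cos l) / sin l)" for l
  define \<delta> where "\<delta> l = pi * h - (l * h + l * x0\<^sup>2 * ((1 + cos l) / sin l))" for l
  define s where "s l t = wave x0 (q l) (\<epsilon> * l * t)" for l t
  define s' where "s' l t = \<epsilon> * l * (q l * cos (\<epsilon> * l * t) - x0 * sin (\<epsilon> * l * t))" for l t
  define C where "C l t = cos (\<epsilon> * l * (t - 1/2))" for l t :: real
  define F where "F l = calibration.F (\<epsilon> * l) (s l) (s' l) (snd (\<gamma> 0)) (snd (\<gamma> 1))" for l
  have q_lim: "(q \<longlongrightarrow> 0) (at_left pi)"
    unfolding q_def using tendsto_mult[OF tendsto_const cot_half_tendsto, of "- x0 * \<epsilon>"] by simp
  have \<delta>_lim: "(\<delta> \<longlongrightarrow> 0) (at_left pi)"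
  proof -
    have "(\<delta> \<longlongrightarrow> pi * h - (pi * h + pi * x0\<^sup>2 * 0)) (at_left pi)"
      unfolding \<delta>_def by (intro tendsto_intros cot_half_tendsto)
    then show ?thesis by simp
  qed
  have s_lim: "((\<lambda>l. s l t) \<longlongrightarrow> x0 * cos (pi * t)) (at_left pi)" for t
  proof -
    have "((\<lambda>l. s l t) \<longlongrightarrow> x0 * cos (\<epsilon> * pi * t) + 0 * sin (\<epsilon> * pi * t)) (at_left pi)"
      unfolding s_def wave_def by (intro tendsto_intros q_lim)
    then show ?thesis by (simp add: st mult.assoc)
  qed
  have C_lim: "((\<lambda>l. C l t) \<longlongrightarrow> sin (pi * t)) (at_left pi)" for t
  proof -
    have "((\<lambda>l. C l t) \<longlongrightarrow> cos (\<epsilon> * pi * (t - 1/2))) (at_left pi)"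
      unfolding C_def by (intro tendsto_intros)
    also have "cos (\<epsilon> * pi * (t - 1/2)) = cos (pi * (t - 1/2))"
      by (simp only: mult.assoc st)
    also have "\<dots> = sin (pi * t)"
      by (simp add: right_diff_distrib cos_diff)
    finally show ?thesis .
  qed
  have ev: "\<forall>\<^sub>F l in at_left pi. 0 < l \<and> l < pi"
    by (rule eventually_at_leftI[of 0]) auto
  have cal: "positive_calibration (\<epsilon> * l) (s l) (s' l)
      (C l) (\<lambda>t. - (\<epsilon> * l) * sin (\<epsilon> * l * (t - 1/2)))" if "0 < l" "l < pi" for l
    unfolding s_def[abs_def] s'_def[abs_def] C_def[abs_def]
    by (rule positive_calibration_wave) (use that in \<open>simp add: st\<close>)
  have ends: "s l 0 = x0" "s l 1 = - x0" if "0 < l" "l < pi" for l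
  proof -
    have "(1 + cos l) / sin l * sin l = 1 + cos l" using sin_gt_zero[OF that] by simp
    moreover have "q l * sin (\<epsilon> * l) = - x0 * (\<epsilon> * \<epsilon>) * ((1 + cos l) / sin l * sin l)"
      by (simp add: q_def st(2))
    ultimately have "q l * sin (\<epsilon> * l) = - x0 * (1 + cos l)" by (simp only: st mult_1_right)
    then show "s l 0 = x0" "s l 1 = - x0" by (simp_all add: s_def wave_def st(1) algebra_simps)
  qed
  have D: "c\<^sup>2 / 2 - F l \<le> \<delta> l" if l: "0 < l" "l < pi" for l
  proof -
    have sl: "sin l \<noteq> 0" using sin_gt_zero[OF l] by simp
    have calib: "calibration (\<epsilon> * l) (s l) (s' l)
      (C l) (\<lambda>t. - (\<epsilon> * l) * sin (\<epsilon> * l * (t - 1/2)))"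
      using cal[OF l] by (simp add: positive_calibration_def)
    have "(1 + cos l) * cos l + (sin l)\<^sup>2 = 1 + cos l"
      using sin_cos_squared_add[of l] by (simp add: algebra_simps power2_eq_square)
    then have key: "(1 + cos l) / sin l * cos l + sin l = (1 + cos l) / sin l"
      using sl by (simp add: field_simps power2_eq_square)
    have "q l * cos (\<epsilon> * l) - x0 * sin (\<epsilon> * l) = - x0 * \<epsilon> * ((1 + cos l) / sin l * cos l + sin l)"
      by (simp add: q_def st algebra_simps)
    then have "q l * cos (\<epsilon> * l) - x0 * sin (\<epsilon> * l) = q l" unfolding key by (simp add: q_def)
    then have "F l = \<epsilon> * \<epsilon> * (l * h) + (- x0 * (\<epsilon> * l * q l) - x0 * (\<epsilon> * l * q l)) / 2"
      unfolding F_def calibration.F_def[OF calib] using ends[OF l] start fin by (simp add: s'_def)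
    also have "\<dots> = l * h + l * x0\<^sup>2 * ((1 + cos l) / sin l)"
    proof -
      have "(- x0 * (\<epsilon> * l * q l) - x0 * (\<epsilon> * l * q l)) / 2 = (\<epsilon> * \<epsilon>) * (l * x0\<^sup>2 * ((1 + cos l) / sin l))"
        unfolding q_def by (simp add: power2_eq_square)
      then show ?thesis by (simp add: st)
    qed
    finally show ?thesis using c2 by (simp add: \<delta>_def)
  qed
  have rig0: "fst (\<gamma> 0) = s l 0" "fst (\<gamma> 1) = s l 1" if "0 < l" "l < pi" for l
    using ends[OF that] start fin by auto
  have small: "x = 0" if "\<And>\<eta>. \<eta> > 0 \<Longrightarrow> \<bar>x\<bar> \<le> K * (\<eta> / 2 + 0 / \<eta>)" "K > 0" for x K :: real
  proof (rule ccontr)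
    assume "x \<noteq> 0"
    then show False using that(1)[of "\<bar>x\<bar> / K"] that(2) by (simp add: field_simps)
  qed
  define k where "k t = (fst (\<gamma> t) - x0 * cos (pi * t)) / sin (pi * t)" for t
  define kl where "kl l t = (fst (\<gamma> t) - s l t) / C l t" for l t
  have const: "k t2 = k t1"
    if t: "0 < t1" "t1 \<le> t2" "t2 < 1" for t1 t2
  proof -
    have sinpos: "sin (pi * t) > 0" if "0 < t" "t < 1" for t
      using that by (intro sin_gt_zero) auto
    define r where "r = max \<bar>t1 - 1/2\<bar> \<bar>t2 - 1/2\<bar>"
    have r: "0 \<le> r" "r < 1/2" using t by (auto simp: r_def max_def abs_if)
    define m where "m = cos (pi * r)"
    have "m > 0" unfolding m_def using r by (intro cos_gt_zero_pi) (auto simp: field_simps intro: less_le_trans[of _ 0])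
    have mC: "m \<le> C l u" if "0 < l" "l < pi" "u \<in> {t1..t2}" for l u
    proof -
      have "\<bar>u - 1/2\<bar> \<le> r" using that(3) unfolding r_def atLeastAtMost_iff by arith
      then have "\<bar>\<epsilon> * l * (u - 1/2)\<bar> \<le> pi * r"
        unfolding mult.assoc st(4) unfolding abs_mult using that by (intro mult_mono) auto
      moreover have "pi * r \<le> pi" using r by simp
      ultimately have "cos (pi * r) \<le> cos \<bar>\<epsilon> * l * (u - 1/2)\<bar>"
        by (intro cos_monotone_0_pi_le) auto
      then show ?thesis by (simp add: m_def C_def)
    qed
    have "\<bar>k t2 - k t1\<bar>
        \<le> (1 / m) * (\<eta> / 2 + 0 / \<eta>)" if "\<eta> > 0" for \<eta>
    proof (rule tendsto_le)
      show "((\<lambda>l. (1 / m) * (\<eta> / 2 + \<delta> l / \<eta>)) \<longlongrightarrow> (1 / m) * (\<eta> / 2 + 0 / \<eta>)) (at_left pi)"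
        using that by (intro tendsto_intros \<delta>_lim) auto
      show "((\<lambda>l. \<bar>kl l t2 - kl l t1\<bar>) \<longlongrightarrow>
          \<bar>k t2 - k t1\<bar>) (at_left pi)"
        unfolding k_def kl_def using sinpos[of t1] sinpos[of t2] t by (intro tendsto_intros s_lim C_lim) auto
      show "\<forall>\<^sub>F l in at_left pi. \<bar>kl l t2 - kl l t1\<bar>
          \<le> (1 / m) * (\<eta> / 2 + \<delta> l / \<eta>)"
        using ev
      proof eventually_elim
        fix l assume l: "0 < l \<and> l < pi"
        note l' = conjunct1[OF l] conjunct2[OF l]
        note R = positive_calibration.rigidity(1)[OF cal[OF l'] hor rig0[OF l'] c _ t(2) _ \<open>\<eta> > 0\<close> mC[OF l'] \<open>m > 0\<close>, folded F_def kl_def]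
        have "\<bar>kl l t2 - kl l t1\<bar>
          \<le> (1 / m) * (\<eta> / 2 + (c\<^sup>2 / 2 - F l) / \<eta>)"
          by (rule R) (use t in auto)
        also have "\<dots> \<le> (1 / m) * (\<eta> / 2 + \<delta> l / \<eta>)"
          using D[OF l'] \<open>m > 0\<close> \<open>\<eta> > 0\<close> by (intro mult_left_mono add_left_mono divide_right_mono) auto
        finally show "\<bar>kl l t2 - kl l t1\<bar>
          \<le> (1 / m) * (\<eta> / 2 + \<delta> l / \<eta>)" .
      qed
    qed simp
    then have "k t2 - k t1 = 0"
      by (rule small) (use \<open>m > 0\<close> in auto)
    then show ?thesis by simp
  qed
  define b where "b = fst (\<gamma> (1/2))"
  define Q where "Q = \<epsilon> * b"
  have x: "fst (\<gamma> t) = wave x0 Q (\<epsilon> * pi * t)" if t01: "t \<in> {0..1}" for t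
  proof -
    have w: "wave x0 Q (\<epsilon> * pi * t) = x0 * cos (pi * t) + b * sin (pi * t)"
      using \<epsilon> by (auto simp: wave_def Q_def)
    consider "t = 0" | "t = 1" | "0 < t" "t \<le> 1/2" | "1/2 \<le> t" "t < 1" using t01 unfolding atLeastAtMost_iff by linarith
    then show ?thesis
    proof cases
      case 3
      then have "sin (pi * t) > 0" by (intro sin_gt_zero) auto
      then show ?thesis using const[of t "1/2"] 3 w by (simp add: b_def k_def field_simps)
    next
      case 4
      then have "sin (pi * t) > 0" by (intro sin_gt_zero) auto
      then show ?thesis using const[of "1/2" t] 4 w by (simp add: b_def k_def field_simps)
    qed (use w start fin in auto)
  qed
  define M where "M = \<bar>x0\<bar> + \<bar>Q\<bar> + 1"
  have M: "\<bar>fst (\<gamma> t)\<bar> \<le> M" if "t \<in> {0..1}" for t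
  proof -
    have "\<bar>x0 * cos \<theta>\<bar> \<le> \<bar>x0\<bar> * 1" "\<bar>Q * sin \<theta>\<bar> \<le> \<bar>Q\<bar> * 1" for \<theta>
      unfolding abs_mult by (intro mult_left_mono abs_cos_le_one abs_sin_le_one; simp)+
    from this[of "\<epsilon> * pi * t"] show ?thesis unfolding x[OF that] wave_def M_def by linarith
  qed
  have "M > 0" by (simp add: M_def)
  define p where "p t = rise x0 Q (\<epsilon> * pi * t) / (\<epsilon> * pi)" for t
  have dp: "(p has_real_derivative (fst (\<gamma> t))\<^sup>2) (at t within {0..1})" if "t \<in> {0..1}" for t
  proof -
    have "((\<lambda>t. \<epsilon> * pi * t) has_real_derivative \<epsilon> * pi) (at t within {0..1})"
      by (auto intro!: derivative_eq_intros)
    from DERIV_cdivide[OF DERIV_chain2[OF d_rise this], of x0 Q "\<epsilon> * pi"] show ?thesis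
      using \<epsilon> by (auto simp: p_def[abs_def] x[OF that])
  qed
  have y: "snd (\<gamma> t) = y0 + rise x0 Q (\<epsilon> * pi * t)" if t: "t \<in> {0..1}" for t
  proof -
    define d where "d l = (snd (\<gamma> t) - \<epsilon> * l * p t) - (snd (\<gamma> 0) - \<epsilon> * l * p 0)" for l
    have "\<bar>d pi\<bar> \<le> M * (\<eta> / 2 + 0 / \<eta>)" if "\<eta> > 0" for \<eta>
    proof (rule tendsto_le)
      show "((\<lambda>l. M * (\<eta> / 2 + \<delta> l / \<eta>)) \<longlongrightarrow> M * (\<eta> / 2 + 0 / \<eta>)) (at_left pi)"
        using that by (intro tendsto_intros \<delta>_lim) auto
      show "((\<lambda>l. \<bar>d l\<bar>) \<longlongrightarrow>
          \<bar>d pi\<bar>) (at_left pi)"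
        unfolding d_def by (intro tendsto_intros)
      show "\<forall>\<^sub>F l in at_left pi. \<bar>d l\<bar>
          \<le> M * (\<eta> / 2 + \<delta> l / \<eta>)"
        using ev
      proof eventually_elim
        fix l assume l: "0 < l \<and> l < pi"
        note l' = conjunct1[OF l] conjunct2[OF l]
        obtain m where m: "m > 0" "\<forall>u\<in>{0..1}. m \<le> C l u"
          by (rule positive_calibration.C_lower_bound[OF cal[OF l']]) (rule that)
        have mC: "m \<le> C l u" if "u \<in> {0..t}" for u using m(2) that t by auto
        note R = positive_calibration.rigidity(2)[OF cal[OF l'] hor rig0[OF l'] c _ _ _ \<open>\<eta> > 0\<close> mC m(1) dp M \<open>M > 0\<close>, folded F_def]
        have "\<bar>d l\<bar>
          \<le> M * (\<eta> / 2 + (c\<^sup>2 / 2 - F l) / \<eta>)"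
          unfolding d_def by (rule R) (use t in auto)
        also have "\<dots> \<le> M * (\<eta> / 2 + \<delta> l / \<eta>)"
          using D[OF l'] \<open>M > 0\<close> \<open>\<eta> > 0\<close> by (intro mult_left_mono add_left_mono divide_right_mono) auto
        finally show "\<bar>d l\<bar>
          \<le> M * (\<eta> / 2 + \<delta> l / \<eta>)" .
      qed
    qed simp
    then have "d pi = 0"
      by (rule small) (use \<open>M > 0\<close> in auto)
    moreover have "\<epsilon> * pi * p u = rise x0 Q (\<epsilon> * pi * u)" for u using \<epsilon> by (auto simp: p_def)
    ultimately show ?thesis using start by (simp add: d_def rise_def)
  qed
  show ?thesis
    using x y by (intro exI[of _ Q]) (simp add: geo_def prod_eq_iff)
qed

section \<open>Heights of end points\<close>

text \<open>Split a solution of the oscillator equation into its parts that are even and odd about the midpoint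
  of time; their amplitudes are proportional to \<open>x0 + x\<close> and \<open>x - x0\<close>. The integral of the square has no
  mixed term, and the two functions are the coefficients of the squares. At \<open>\<theta> = 0\<close> the value of
  \<open>skew_height\<close> is \<open>0\<close>, which is also its limit.\<close>

definition sym_height :: "real \<Rightarrow> real" where "sym_height \<theta> = (\<theta> + sin \<theta>) / (1 + cos \<theta>)"
definition skew_height :: "real \<Rightarrow> real" where "skew_height \<theta> = (\<theta> - sin \<theta>) / (1 - cos \<theta>)"
definition height :: "real \<Rightarrow> real \<Rightarrow> real \<Rightarrow> real" where
  "height x0 x \<theta> = ((x0 + x)\<^sup>2 * sym_height \<theta> + (x - x0)\<^sup>2 * skew_height \<theta>) / 4"

text \<open>The derivatives with respect to the angle; \<open>1 / 3\<close> is the limit at the removable singularity.\<close>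

definition sym_height' :: "real \<Rightarrow> real" where
  "sym_height' \<theta> = 1 + sin \<theta> * (\<theta> + sin \<theta>) / (1 + cos \<theta>)\<^sup>2"
definition skew_height' :: "real \<Rightarrow> real" where
  "skew_height' \<theta> = (if \<theta> = 0 then 1 / 3 else 1 - sin \<theta> * (\<theta> - sin \<theta>) / (1 - cos \<theta>)\<^sup>2)"
definition height' :: "real \<Rightarrow> real \<Rightarrow> real \<Rightarrow> real" where
  "height' x0 x \<theta> = ((x0 + x)\<^sup>2 * sym_height' \<theta> + (x - x0)\<^sup>2 * skew_height' \<theta>) / 4"

lemma cos_bounds:
  assumes "\<bar>\<theta>\<bar> < pi"
  shows "1 + cos \<theta> > 0" and "\<theta> \<noteq> 0 \<Longrightarrow> 1 - cos \<theta> > 0" and "\<theta> \<noteq> 0 \<Longrightarrow> sin \<theta> \<noteq> 0"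
proof -
  have "cos pi < cos \<bar>\<theta>\<bar>" using assms by (intro cos_monotone_0_pi) auto
  then show "1 + cos \<theta> > 0" by simp
  show "1 - cos \<theta> > 0" if "\<theta> \<noteq> 0"
  proof -
    have "cos \<bar>\<theta>\<bar> < cos 0" using assms that by (intro cos_monotone_0_pi) auto
    then show ?thesis by simp
  qed
  show "sin \<theta> \<noteq> 0" if "\<theta> \<noteq> 0"
    using sin_gt_zero[of \<theta>] sin_gt_zero[of "-\<theta>"] assms that by (cases "\<theta> > 0") auto
qed

lemma height_wave:
  assumes "\<bar>\<theta>\<bar> < pi" "\<theta> \<noteq> 0"
  shows "height x0 (wave x0 q \<theta>) \<theta> = rise x0 q \<theta>"
proof -
  define c s where "c = cos \<theta>" and "s = sin \<theta>"
  have c: "1 + c \<noteq> 0" "1 - c \<noteq> 0" using cos_bounds[OF assms(1)] assms(2) by (auto simp: c_def)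
  have sc: "s * s = (1 + c) * (1 - c)" using sin_cos_squared_add[of \<theta>] by (simp add: c_def s_def power2_eq_square algebra_simps)
  define x where "x = x0 * c + q * s"
  have "(x0 + x)\<^sup>2 * (\<theta> + s) * (1 - c) + (x - x0)\<^sup>2 * (\<theta> - s) * (1 + c) =
      4 * ((1 + c) * (1 - c)) * ((x0\<^sup>2 + q\<^sup>2) / 2 * \<theta> + (x0\<^sup>2 - q\<^sup>2) / 2 * (s * c) + x0 * q * s\<^sup>2)"
    unfolding x_def power2_eq_square using sc by algebra
  then have "(x0 + x)\<^sup>2 * (\<theta> + s) / (1 + c) + (x - x0)\<^sup>2 * (\<theta> - s) / (1 - c) =
      4 * ((x0\<^sup>2 + q\<^sup>2) / 2 * \<theta> + (x0\<^sup>2 - q\<^sup>2) / 2 * (s * c) + x0 * q * s\<^sup>2)"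
    unfolding add_frac_eq[OF c] using c by simp
  then show ?thesis
    by (simp add: height_def sym_height_def skew_height_def rise_def wave_def x_def c_def s_def)
qed

lemma d_sym_height:
  assumes "\<bar>\<theta>\<bar> < pi"
  shows "(sym_height has_real_derivative sym_height' \<theta>) (at \<theta>)"
proof -
  have c: "1 + cos \<theta> \<noteq> 0" using cos_bounds[OF assms] by simp
  have "(sym_height has_real_derivative
      ((1 + cos \<theta>) * (1 + cos \<theta>) - (\<theta> + sin \<theta>) * (- sin \<theta>)) / ((1 + cos \<theta>) * (1 + cos \<theta>))) (at \<theta>)"
    unfolding sym_height_def[abs_def]
    by (rule DERIV_divide) (use c in \<open>auto intro!: derivative_eq_intros\<close>)
  also have "((1 + cos \<theta>) * (1 + cos \<theta>) - (\<theta> + sin \<theta>) * (- sin \<theta>)) / ((1 + cos \<theta>) * (1 + cos \<theta>)) = sym_height' \<theta>"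
    using c by (simp add: sym_height'_def add_divide_distrib power2_eq_square mult.commute)
  finally show ?thesis .
qed

lemma d_skew_height:
  assumes "\<bar>\<theta>\<bar> < pi"
  shows "(skew_height has_real_derivative skew_height' \<theta>) (at \<theta>)"
proof (cases "\<theta> = 0")
  case True
  have "((\<lambda>h. ((h - sin h) / (1 - cos h)) / h) \<longlongrightarrow> 1 / 3) (at (0::real))" by real_asymp
  then show ?thesis using True by (simp add: DERIV_def skew_height_def skew_height'_def)
next
  case False
  have c: "1 - cos \<theta> \<noteq> 0" using cos_bounds[OF assms] False by simp
  have "(skew_height has_real_derivative
      ((1 - cos \<theta>) * (1 - cos \<theta>) - (\<theta> - sin \<theta>) * sin \<theta>) / ((1 - cos \<theta>) * (1 - cos \<theta>))) (at \<theta>)"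
    unfolding skew_height_def[abs_def]
    by (rule DERIV_divide) (use c in \<open>auto intro!: derivative_eq_intros\<close>)
  also have "((1 - cos \<theta>) * (1 - cos \<theta>) - (\<theta> - sin \<theta>) * sin \<theta>) / ((1 - cos \<theta>) * (1 - cos \<theta>)) = skew_height' \<theta>"
    using c False by (simp add: skew_height'_def diff_divide_distrib power2_eq_square mult.commute)
  finally show ?thesis .
qed

lemma d_height:
  assumes "\<bar>\<theta>\<bar> < pi"
  shows "(height x0 x has_real_derivative height' x0 x \<theta>) (at \<theta>)"
  unfolding height_def[abs_def] height'_def
  by (intro DERIV_cdivide DERIV_add DERIV_cmult d_sym_height d_skew_height assms)

lemma isCont_skew_height':
  assumes "\<bar>\<theta>\<bar> < pi"
  shows "isCont skew_height' \<theta>"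
proof (cases "\<theta> = 0")
  case True
  have "((\<lambda>\<theta>. 1 - sin \<theta> * (\<theta> - sin \<theta>) / (1 - cos \<theta>)\<^sup>2) \<longlongrightarrow> 1 / 3) (at (0::real))"
    by (real_asymp; simp add: power2_eq_square)
  moreover have "\<forall>\<^sub>F \<theta> in at 0. 1 - sin \<theta> * (\<theta> - sin \<theta>) / (1 - cos \<theta>)\<^sup>2 = skew_height' \<theta>"
    by (auto simp: eventually_at_filter skew_height'_def)
  ultimately have "(skew_height' \<longlongrightarrow> 1 / 3) (at 0)" by (rule Lim_transform_eventually)
  then show ?thesis using True by (simp add: isCont_def skew_height'_def)
next
  case False
  have c: "1 - cos \<theta> \<noteq> 0" using cos_bounds[OF assms] False by simp
  have "isCont (\<lambda>\<theta>. 1 - sin \<theta> * (\<theta> - sin \<theta>) / (1 - cos \<theta>)\<^sup>2) \<theta>"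
    using c by (intro continuous_intros) auto
  moreover have "\<forall>\<^sub>F u in nhds \<theta>. 1 - sin u * (u - sin u) / (1 - cos u)\<^sup>2 = skew_height' u"
    using False t1_space_nhds[of \<theta> 0] by (auto elim!: eventually_mono simp: skew_height'_def)
  ultimately show ?thesis by (simp cong: isCont_cong)
qed

lemma isCont_sym_height':
  assumes "\<bar>\<theta>\<bar> < pi"
  shows "isCont sym_height' \<theta>"
  unfolding sym_height'_def[abs_def] using cos_bounds[OF assms] by (intro continuous_intros) auto

lemma sin_mult_nonneg: "\<bar>\<theta>\<bar> < pi \<Longrightarrow> 0 \<le> \<theta> * sin \<theta>" for \<theta> :: real
  using sin_ge_zero[of \<theta>] sin_ge_zero[of "-\<theta>"]
  by (cases "\<theta> \<ge> 0") (auto simp: mult_nonneg_nonneg mult_nonpos_nonpos)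

lemma sym_height'_pos: "\<bar>\<theta>\<bar> < pi \<Longrightarrow> sym_height' \<theta> \<ge> 1"
  using sin_mult_nonneg[of \<theta>] by (simp add: sym_height'_def algebra_simps)

lemma sin_minus_mult_cos_pos:
  assumes "0 < \<theta>" "\<theta> \<le> pi"
  shows "\<theta> * cos \<theta> < sin \<theta>"
proof -
  have "sin 0 - 0 * cos 0 < sin \<theta> - \<theta> * cos (\<theta>::real)"
  proof (rule DERIV_pos_imp_increasing_open[OF assms(1), where f = "\<lambda>u. sin u - u * cos u"])
    fix u assume u: "0 < u" "u < \<theta>"
    have "((\<lambda>u. sin u - u * cos u) has_real_derivative u * sin u) (at u)"
      by (auto intro!: derivative_eq_intros)
    moreover have "u * sin u > 0" using u assms sin_gt_zero[of u] by simp
    ultimately show "\<exists>y. ((\<lambda>u. sin u - u * cos u) has_real_derivative y) (at u) \<and> 0 < y" by blast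
  qed (intro continuous_intros)
  then show ?thesis by simp
qed

lemma skew_height'_pos:
  assumes "\<bar>\<theta>\<bar> < pi"
  shows "skew_height' \<theta> > 0"
proof -
  have pos: "1 - sin u * (u - sin u) / (1 - cos u)\<^sup>2 > 0" if u: "0 < u" "u < pi" for u
  proof -
    have "2 * (1 - cos 0) - sin 0 * 0 < 2 * (1 - cos u) - sin u * u"
    proof (rule DERIV_pos_imp_increasing_open[OF u(1), where f = "\<lambda>u. 2 * (1 - cos u) - sin u * u"])
      fix v assume v: "0 < v" "v < u"
      have "((\<lambda>u. 2 * (1 - cos u) - sin u * u) has_real_derivative sin v - v * cos v) (at v)"
        by (auto intro!: derivative_eq_intros)
      then show "\<exists>y. ((\<lambda>u. 2 * (1 - cos u) - sin u * u) has_real_derivative y) (at v) \<and> 0 < y"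
        using sin_minus_mult_cos_pos[of v] v u by (intro exI[of _ "sin v - v * cos v"]) auto
    qed (intro continuous_intros)
    then have "sin u * (u - sin u) < (1 - cos u)\<^sup>2"
      using sin_cos_squared_add[of u] by (simp add: power2_eq_square algebra_simps)
    then show ?thesis using cos_bounds(2)[of u] u by (simp add: field_simps)
  qed
  consider "\<theta> = 0" | "\<theta> > 0" | "\<theta> < 0" by linarith
  then show ?thesis
  proof cases
    case 2 then show ?thesis using pos[of \<theta>] assms by (simp add: skew_height'_def)
  next
    case 3 then show ?thesis using pos[of "-\<theta>"] assms by (simp add: skew_height'_def algebra_simps)
  qed (simp add: skew_height'_def)
qed

lemma height'_nonneg: "\<bar>\<theta>\<bar> < pi \<Longrightarrow> height' x0 x \<theta> \<ge> 0"
  using sym_height'_pos[of \<theta>] skew_height'_pos[of \<theta>] by (auto simp: height'_def intro!: add_nonneg_nonneg)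

lemma height'_pos:
  assumes "\<bar>\<theta>\<bar> < pi" "x \<noteq> - x0"
  shows "height' x0 x \<theta> > 0"
proof -
  have "(x0 + x)\<^sup>2 > 0" using assms by auto
  then have "(x0 + x)\<^sup>2 * sym_height' \<theta> > 0" using sym_height'_pos[OF assms(1)] by simp
  moreover have "(x - x0)\<^sup>2 * skew_height' \<theta> \<ge> 0" using skew_height'_pos[OF assms(1)] by simp
  ultimately show ?thesis by (simp add: height'_def)
qed

lemma height_0 [simp]: "height x0 x 0 = 0"
  by (simp add: height_def sym_height_def skew_height_def)

lemma height_minus: "height x0 x (- \<theta>) = - height x0 x \<theta>"
proof -
  have "- \<theta> - sin \<theta> = - (\<theta> + sin \<theta>)" "- \<theta> + sin \<theta> = - (\<theta> - sin \<theta>)" by simp_all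
  then have "sym_height (- \<theta>) = - sym_height \<theta>" "skew_height (- \<theta>) = - skew_height \<theta>"
    unfolding sym_height_def skew_height_def by (simp_all only: sin_minus cos_minus minus_divide_left diff_conv_add_uminus minus_minus)
  then show ?thesis by (simp add: height_def add_divide_distrib diff_divide_distrib)
qed

lemma height_strict_mono:
  assumes "- pi < a" "a < b" "b < pi" "x \<noteq> - x0"
  shows "height x0 x a < height x0 x b"
proof (rule DERIV_pos_imp_increasing[OF assms(2)])
  fix u assume "a \<le> u" "u \<le> b"
  then show "\<exists>y. (height x0 x has_real_derivative y) (at u) \<and> 0 < y"
    using d_height[of u x0 x] height'_pos[of u x x0] assms by (intro exI[of _ "height' x0 x u"]) auto
qed

lemma isCont_height: "\<bar>\<theta>\<bar> < pi \<Longrightarrow> isCont (height x0 x) \<theta>"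
  using d_height DERIV_isCont by blast

lemma skew_height_nonneg: "0 \<le> \<theta> \<Longrightarrow> skew_height \<theta> \<ge> 0"
  unfolding skew_height_def using sin_x_le_x[of \<theta>] by (intro divide_nonneg_nonneg) auto

text \<open>Off the line \<open>x = - x0\<close> the symmetric part is unbounded as the angle tends to \<open>pi\<close>. On this line
  only the skew part remains; it increases to \<open>pi / 2 * x0\<^sup>2\<close>, where the cut locus starts.\<close>

lemma height_eq_ex_nonneg:
  assumes "v \<ge> 0" "x \<noteq> - x0 \<or> v < pi / 2 * x0\<^sup>2"
  shows "\<exists>\<theta>. 0 \<le> \<theta> \<and> \<theta> < pi \<and> height x0 x \<theta> = v"
proof -
  obtain b where b: "0 < b" "b < pi" "v \<le> height x0 x b"
  proof (cases "x = - x0")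
    case False
    define K where "K = 4 * v / (x0 + x)\<^sup>2"
    have "filterlim sym_height at_top (at_left pi)"
      unfolding sym_height_def[abs_def] by real_asymp
    then have "\<forall>\<^sub>F b in at_left pi. sym_height b \<ge> K" by (simp add: filterlim_at_top)
    moreover have "\<forall>\<^sub>F b in at_left pi. 0 < b \<and> b < pi"
      by (rule eventually_at_leftI[of 0]) auto
    ultimately have "\<forall>\<^sub>F b in at_left pi. sym_height b \<ge> K \<and> 0 < b \<and> b < pi"
      by eventually_elim simp
    then obtain b where b: "sym_height b \<ge> K" "0 < b" "b < pi"
      using eventually_happens'[OF trivial_limit_at_left_real] by blast
    have "(x0 + x)\<^sup>2 > 0" using False by auto
    then have "(x0 + x)\<^sup>2 * sym_height b \<ge> 4 * v" using b(1) by (simp add: K_def field_simps)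
    moreover have "(x - x0)\<^sup>2 * skew_height b \<ge> 0" using skew_height_nonneg[of b] b by simp
    ultimately show thesis using b by (intro that[of b]) (auto simp: height_def)
  next
    case True
    have "(skew_height \<longlongrightarrow> pi / 2) (at_left pi)"
      unfolding skew_height_def[abs_def] by (rule tendsto_eq_intros refl | simp)+
    then have "((\<lambda>b. x0\<^sup>2 * skew_height b) \<longlongrightarrow> x0\<^sup>2 * (pi / 2)) (at_left pi)" by (intro tendsto_intros)
    then have "\<forall>\<^sub>F b in at_left pi. v < x0\<^sup>2 * skew_height b"
      using assms True by (intro order_tendstoD(1)) (auto simp: mult.commute)
    moreover have "\<forall>\<^sub>F b in at_left pi. 0 < b \<and> b < pi"
      by (rule eventually_at_leftI[of 0]) auto
    ultimately have "\<forall>\<^sub>F b in at_left pi. v < x0\<^sup>2 * skew_height b \<and> 0 < b \<and> b < pi"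
      by eventually_elim simp
    then obtain b where b: "v < x0\<^sup>2 * skew_height b" "0 < b" "b < pi"
      using eventually_happens'[OF trivial_limit_at_left_real] by blast
    have "height x0 x b = x0\<^sup>2 * skew_height b" using True by (simp add: height_def power2_eq_square)
    then show thesis using b by (intro that[of b]) auto
  qed
  have "\<exists>\<theta>\<ge>0. \<theta> \<le> b \<and> height x0 x \<theta> = v"
    using b assms by (intro IVT) (auto intro!: isCont_height)
  then show ?thesis using b by force
qed

lemma height_eq_ex:
  assumes "x \<noteq> - x0 \<or> \<bar>v\<bar> < pi / 2 * x0\<^sup>2"
  shows "\<exists>\<theta>. \<bar>\<theta>\<bar> < pi \<and> height x0 x \<theta> = v"
proof (cases "v \<ge> 0")
  case True
  then show ?thesis using height_eq_ex_nonneg[OF True] assms by (metis abs_of_nonneg)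
next
  case False
  then obtain \<theta> where "0 \<le> \<theta>" "\<theta> < pi" "height x0 x \<theta> = - v"
    using height_eq_ex_nonneg[of "- v" x x0] assms by auto
  then show ?thesis by (intro exI[of _ "- \<theta>"]) (simp add: height_minus)
qed

lemma wave_eq:
  assumes "\<bar>\<theta>\<bar> < pi" "\<theta> \<noteq> 0"
  shows "wave x0 ((x - x0 * cos \<theta>) / sin \<theta>) \<theta> = x"
  using cos_bounds(3)[OF assms] by (simp add: wave_def)

lemma geodesic_classification:
  assumes min: "minimizing_geodesic \<gamma>" and start: "\<gamma> 0 = (x0, y0)" and fin: "snd (\<gamma> 1) \<noteq> y0"
  shows "\<exists>q \<omega>. \<omega> \<noteq> 0 \<and> \<bar>\<omega>\<bar> \<le> pi \<and> (\<forall>t\<in>{0..1}. \<gamma> t = geo (x0, y0) q \<omega> t)"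
proof -
  define x v where "x = fst (\<gamma> 1)" and "v = snd (\<gamma> 1) - y0"
  have "v \<noteq> 0" using fin by (simp add: v_def)
  have end1: "\<gamma> 1 = (x, y0 + v)" by (simp add: x_def v_def)
  show ?thesis
  proof (cases "x \<noteq> - x0 \<or> \<bar>v\<bar> < pi / 2 * x0\<^sup>2")
    case True
    then obtain \<theta> where \<theta>: "\<bar>\<theta>\<bar> < pi" "height x0 x \<theta> = v" using height_eq_ex by blast
    then have "\<theta> \<noteq> 0" using \<open>v \<noteq> 0\<close> by auto
    define q where "q = (x - x0 * cos \<theta>) / sin \<theta>"
    have w: "wave x0 q \<theta> = x" unfolding q_def by (rule wave_eq[OF \<theta>(1) \<open>\<theta> \<noteq> 0\<close>])
    have "geo (x0, y0) q \<theta> 1 = \<gamma> 1"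
      using height_wave[OF \<theta>(1) \<open>\<theta> \<noteq> 0\<close>, of x0 q] w \<theta>(2) by (simp add: geo_end end1)
    then have "\<gamma> t = geo (x0, y0) q \<theta> t" if "t \<in> {0..1}" for t
      by (intro geo_unique[OF \<theta>(1) min start _ that]) (rule sym)
    then show ?thesis using \<theta>(1) \<open>\<theta> \<noteq> 0\<close>
      by (intro exI[of _ q] exI[of _ \<theta>] conjI ballI less_imp_le[of "\<bar>\<theta>\<bar>"])
  next
    case False
    define \<epsilon> where "\<epsilon> = sgn v"
    have \<epsilon>: "\<epsilon> = 1 \<or> \<epsilon> = -1" using \<open>v \<noteq> 0\<close> by (auto simp: \<epsilon>_def sgn_if)
    have "\<gamma> 1 = (- x0, y0 + \<epsilon> * \<bar>v\<bar>)" using end1 False by (simp add: \<epsilon>_def sgn_mult_abs)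
    from cut_geodesic[OF min start this \<epsilon>] False \<open>v \<noteq> 0\<close>
    obtain q where "\<forall>t\<in>{0..1}. \<gamma> t = geo (x0, y0) q (\<epsilon> * pi) t" by force
    moreover have "\<epsilon> * pi \<noteq> 0" "\<bar>\<epsilon> * pi\<bar> \<le> pi" using \<epsilon> by auto
    ultimately show ?thesis by blast
  qed
qed

section \<open>Angular coordinates\<close>

lemma measurable_height [measurable (raw)]:
  fixes f g :: "'a \<Rightarrow> real"
  assumes [measurable]: "f \<in> borel_measurable M" "g \<in> borel_measurable M"
  shows "(\<lambda>z. height x0 (f z) (g z)) \<in> borel_measurable M"
  unfolding height_def sym_height_def skew_height_def by measurable

lemma measurable_height' [measurable (raw)]:
  fixes f g :: "'a \<Rightarrow> real"
  assumes [measurable]: "f \<in> borel_measurable M" "g \<in> borel_measurable M"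
  shows "(\<lambda>z. height' x0 (f z) (g z)) \<in> borel_measurable M"
  unfolding height'_def sym_height'_def skew_height'_def by measurable

lemma nn_integral_incseq_indicator:
  assumes f: "f \<in> borel_measurable M" and A: "\<And>n::nat. A n \<in> sets M" "incseq A"
  shows "(\<integral>\<^sup>+x. f x * indicator (\<Union>n. A n) x \<partial>M) = (SUP n. \<integral>\<^sup>+x. f x * indicator (A n) x \<partial>M)"
proof -
  have "(SUP n. emeasure (density M f) (A n)) = emeasure (density M f) (\<Union>n. A n)"
    by (rule SUP_emeasure_incseq) (use A in auto)
  then show ?thesis using A f by (simp add: emeasure_density)
qed

text \<open>The substitution rule for compact intervals is applied to an exhaustion of \<open>(- pi, pi)\<close>; the images
  exhaust the line because the height is unbounded in both directions.\<close>

lemma nn_integral_height_fibre: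
  fixes f :: "real \<Rightarrow> ennreal"
  assumes f [measurable]: "f \<in> borel_measurable borel" and x: "x \<noteq> - x0"
  shows "(\<integral>\<^sup>+y. f y \<partial>lborel) =
    (\<integral>\<^sup>+\<theta>. f (y0 + height x0 x \<theta>) * height' x0 x \<theta> * indicator {- pi<..<pi} \<theta> \<partial>lborel)"
proof -
  define a where "a n = pi * (1 - 1 / (real n + 2))" for n :: nat
  have a: "0 < a n" "a n < pi" for n
  proof -
    have "0 < 1 - 1 / (real n + 2)" "1 - 1 / (real n + 2) < 1" by (simp_all add: field_simps)
    then show "0 < a n" "a n < pi" unfolding a_def by (simp_all add: mult_less_cancel_left1)
  qed
  have a_mono: "a m \<le> a n" if "m \<le> n" for m n
    using that by (simp add: a_def frac_le)
  have a_lim: "a \<longlonglongrightarrow> pi" unfolding a_def by real_asymp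
  have a_ex: "\<exists>n. \<bar>\<theta>\<bar> \<le> a n" if "\<bar>\<theta>\<bar> < pi" for \<theta>
    using eventually_happens'[OF sequentially_bot order_tendstoD(1)[OF a_lim that]] by (auto intro: less_imp_le)
  define g where "g \<theta> = y0 + height x0 x \<theta>" for \<theta>
  have dg: "(g has_real_derivative height' x0 x \<theta>) (at \<theta>)" if "\<bar>\<theta>\<bar> < pi" for \<theta>
    unfolding g_def using d_height[OF that] by (auto intro!: derivative_eq_intros)
  have gmono: "g u \<le> g v" if "- pi < u" "u \<le> v" "v < pi" for u v
    using height_strict_mono[OF that(1) _ that(3) x] that(2) by (cases "u = v") (auto simp: g_def less_imp_le)
  have cont: "continuous_on {- a n..a n} (height' x0 x)" for n
  proof (rule continuous_at_imp_continuous_on, rule ballI)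
    fix u assume "u \<in> {- a n..a n}"
    then have "\<bar>u\<bar> < pi" using a[of n] by auto
    then show "isCont (height' x0 x) u"
      unfolding height'_def[abs_def] by (intro continuous_intros isCont_sym_height' isCont_skew_height') auto
  qed
  have sub: "(\<integral>\<^sup>+y. f y * indicator {g (- a n)..g (a n)} y \<partial>lborel) =
      (\<integral>\<^sup>+\<theta>. f (g \<theta>) * height' x0 x \<theta> * indicator {- a n..a n} \<theta> \<partial>lborel)" for n
  proof (rule nn_integral_substitution_aux[OF f _ _ cont])
    fix u assume "u \<in> {- a n..a n}"
    then have u: "\<bar>u\<bar> < pi" using a[of n] by auto
    show "(g has_real_derivative height' x0 x u) (at u)" by (rule dg[OF u])
    show "0 \<le> height' x0 x u" by (rule height'_nonneg[OF u])
  qed (use a[of n] in auto)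
  have U1: "(\<Union>n. {g (- a n)..g (a n)}) = UNIV"
  proof (intro equalityI subset_UNIV subsetI)
    fix y :: real
    obtain \<theta> where \<theta>: "\<bar>\<theta>\<bar> < pi" "height x0 x \<theta> = y - y0" using height_eq_ex x by blast
    obtain n where "\<bar>\<theta>\<bar> \<le> a n" using a_ex[OF \<theta>(1)] by blast
    then have "g (- a n) \<le> g \<theta>" "g \<theta> \<le> g (a n)" using a[of n] by (auto intro!: gmono)
    then show "y \<in> (\<Union>n. {g (- a n)..g (a n)})" using \<theta>(2) by (auto simp: g_def)
  qed
  have U2: "(\<Union>n. {- a n..a n}) = {- pi<..<pi}"
  proof (intro equalityI subsetI)
    fix u assume "u \<in> (\<Union>n. {- a n..a n})"
    then obtain n where "- a n \<le> u" "u \<le> a n" by auto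
    then show "u \<in> {- pi<..<pi}" using a[of n] by auto
  next
    fix u assume "u \<in> {- pi<..<pi}"
    then have "\<bar>u\<bar> < pi" by auto
    then obtain n where "\<bar>u\<bar> \<le> a n" using a_ex by blast
    then have "- a n \<le> u" "u \<le> a n" by linarith+
    then show "u \<in> (\<Union>n. {- a n..a n})" by auto
  qed
  have inc1: "incseq (\<lambda>n. {g (- a n)..g (a n)})"
  proof (rule incseq_SucI)
    fix n
    have "g (- a (Suc n)) \<le> g (- a n)" "g (a n) \<le> g (a (Suc n))"
      using a[of n] a[of "Suc n"] a_mono[of n "Suc n"] by (auto intro!: gmono)
    then show "{g (- a n)..g (a n)} \<subseteq> {g (- a (Suc n))..g (a (Suc n))}" by auto
  qed
  have inc2: "incseq (\<lambda>n. {- a n..a n})"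
  proof (rule incseq_SucI)
    fix n show "{- a n..a n} \<subseteq> {- a (Suc n)..a (Suc n)}" using a_mono[of n "Suc n"] by auto
  qed
  have [measurable]: "g \<in> borel_measurable borel" unfolding g_def by measurable
  have "(\<integral>\<^sup>+y. f y \<partial>lborel) = (\<integral>\<^sup>+y. f y * indicator (\<Union>n. {g (- a n)..g (a n)}) y \<partial>lborel)"
    by (simp add: U1)
  also have "\<dots> = (SUP n. \<integral>\<^sup>+y. f y * indicator {g (- a n)..g (a n)} y \<partial>lborel)"
    by (rule nn_integral_incseq_indicator[OF _ _ inc1]) auto
  also have "\<dots> = (SUP n. \<integral>\<^sup>+\<theta>. f (g \<theta>) * height' x0 x \<theta> * indicator {- a n..a n} \<theta> \<partial>lborel)"
    by (simp add: sub)
  also have "\<dots> = (\<integral>\<^sup>+\<theta>. f (g \<theta>) * height' x0 x \<theta> * indicator (\<Union>n. {- a n..a n}) \<theta> \<partial>lborel)"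
    by (rule nn_integral_incseq_indicator[OF _ _ inc2, symmetric]) auto
  finally show ?thesis by (simp add: U2 g_def)
qed

lemma AE_lborel_neq: "AE x in lborel. x \<noteq> (c::real)"
  using AE_lborel_singleton[of c] by simp

text \<open>The integral over \<open>x\<close> is put inside, since the contraction is affine in \<open>x\<close> for a fixed angle.\<close>

lemma nn_integral_plane_angular:
  fixes f :: "plane \<Rightarrow> ennreal"
  assumes f [measurable]: "f \<in> borel_measurable (borel \<Otimes>\<^sub>M borel)"
  shows "(\<integral>\<^sup>+z. f z \<partial>lborel) = (\<integral>\<^sup>+\<theta>. (\<integral>\<^sup>+x. f (x, y0 + height x0 x \<theta>) * height' x0 x \<theta> *
      indicator {- pi<..<pi} \<theta> \<partial>lborel) \<partial>lborel)"
proof -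
  have "(\<integral>\<^sup>+z. f z \<partial>lborel) = (\<integral>\<^sup>+z. f z \<partial>(lborel \<Otimes>\<^sub>M lborel))"
    by (simp add: lborel_prod)
  also have "\<dots> = (\<integral>\<^sup>+x. (\<integral>\<^sup>+y. f (x, y) \<partial>lborel) \<partial>lborel)"
    by (rule lborel.nn_integral_fst[symmetric]) simp
  also have "\<dots> = (\<integral>\<^sup>+x. (\<integral>\<^sup>+\<theta>. f (x, y0 + height x0 x \<theta>) * height' x0 x \<theta> *
      indicator {- pi<..<pi} \<theta> \<partial>lborel) \<partial>lborel)"
  proof (rule nn_integral_cong_AE)
    show "AE x in lborel. (\<integral>\<^sup>+y. f (x, y) \<partial>lborel) = (\<integral>\<^sup>+\<theta>. f (x, y0 + height x0 x \<theta>) *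
        height' x0 x \<theta> * indicator {- pi<..<pi} \<theta> \<partial>lborel)"
      using AE_lborel_neq[of "- x0"]
    proof eventually_elim
      fix x assume "x \<noteq> - x0"
      then show "(\<integral>\<^sup>+y. f (x, y) \<partial>lborel) = (\<integral>\<^sup>+\<theta>. f (x, y0 + height x0 x \<theta>) *
        height' x0 x \<theta> * indicator {- pi<..<pi} \<theta> \<partial>lborel)"
        by (rule nn_integral_height_fibre[rotated]) measurable
    qed
  qed
  also have "\<dots> = (\<integral>\<^sup>+\<theta>. (\<integral>\<^sup>+x. f (x, y0 + height x0 x \<theta>) * height' x0 x \<theta> *
      indicator {- pi<..<pi} \<theta> \<partial>lborel) \<partial>lborel)"
    by (rule lborel_pair.Fubini') measurable
  finally show ?thesis .
qed

text \<open>The inverse of the angular coordinates. On the null line \<open>x = - x0\<close>, which contains the cut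
  locus, the value \<open>0\<close> is arbitrary.\<close>

definition angle :: "real \<Rightarrow> real \<Rightarrow> plane \<Rightarrow> real" where
  "angle x0 y0 z = (if fst z = - x0 then 0 else THE \<theta>. \<bar>\<theta>\<bar> < pi \<and> height x0 (fst z) \<theta> = snd z - y0)"

lemma height_inj:
  assumes "x \<noteq> - x0" "\<bar>\<theta>\<bar> < pi" "\<bar>\<theta>'\<bar> < pi" "height x0 x \<theta> = height x0 x \<theta>'"
  shows "\<theta> = \<theta>'"
  using height_strict_mono[of \<theta> \<theta>' x x0] height_strict_mono[of \<theta>' \<theta> x x0] assms
  by (cases \<theta> \<theta>' rule: linorder_cases) (auto simp: abs_less_iff)

lemma angle_eq:
  assumes "x \<noteq> - x0" "\<bar>\<theta>\<bar> < pi"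
  shows "angle x0 y0 (x, y0 + height x0 x \<theta>) = \<theta>"
proof -
  have "(THE \<theta>'. \<bar>\<theta>'\<bar> < pi \<and> height x0 x \<theta>' = height x0 x \<theta>) = \<theta>"
    using assms height_inj[OF assms(1)] by (intro the_equality) auto
  then show ?thesis using assms by (simp add: angle_def)
qed

lemma angle:
  assumes "fst z \<noteq> - x0"
  shows "\<bar>angle x0 y0 z\<bar> < pi" and "height x0 (fst z) (angle x0 y0 z) = snd z - y0"
proof -
  obtain \<theta> where \<theta>: "\<bar>\<theta>\<bar> < pi" "height x0 (fst z) \<theta> = snd z - y0" using height_eq_ex assms by blast
  have "angle x0 y0 z = \<theta>" using angle_eq[OF assms \<theta>(1), of y0] \<theta>(2) by simp
  then show "\<bar>angle x0 y0 z\<bar> < pi" "height x0 (fst z) (angle x0 y0 z) = snd z - y0" using \<theta> by auto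
qed

lemma angle_le_iff:
  assumes "fst z \<noteq> - x0" "\<bar>c\<bar> < pi"
  shows "angle x0 y0 z \<le> c \<longleftrightarrow> snd z \<le> y0 + height x0 (fst z) c"
proof -
  note a = angle[OF assms(1), of y0]
  consider "angle x0 y0 z < c" | "angle x0 y0 z = c" | "c < angle x0 y0 z" by linarith
  then show ?thesis
  proof cases
    case 1
    then show ?thesis using height_strict_mono[OF _ 1 _ assms(1)] a assms(2) by (auto simp: abs_less_iff)
  next
    case 3
    then show ?thesis using height_strict_mono[OF _ 3 _ assms(1)] a assms(2) by (auto simp: abs_less_iff)
  qed (use a in auto)
qed

text \<open>Monotonicity of the height turns the sublevel sets of the angle into regions below graphs.\<close>

lemma measurable_angle [measurable]: "angle x0 y0 \<in> borel_measurable (borel \<Otimes>\<^sub>M borel)"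
  unfolding borel_measurable_iff_le
proof
  fix c
  have "{z \<in> space (borel \<Otimes>\<^sub>M borel). angle x0 y0 z \<le> c} = (if c \<ge> pi then UNIV else if c \<le> - pi then {}
      else {z. if fst z = - x0 then 0 \<le> c else snd z \<le> y0 + height x0 (fst z) c})"
  proof -
    have "angle x0 y0 z \<le> c \<longleftrightarrow> (if c \<ge> pi then True else if c \<le> - pi then False
      else (if fst z = - x0 then 0 \<le> c else snd z \<le> y0 + height x0 (fst z) c))" for z
    proof (cases "fst z = - x0")
      case True
      then have "angle x0 y0 z = 0" by (simp add: angle_def)
      then show ?thesis using True pi_gt_zero by (smt (verit))
    next
      case False
      then show ?thesis using angle(1)[OF False, of y0] angle_le_iff[OF False, of c y0] by auto
    qed
    then show ?thesis by (auto simp: space_pair_measure)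
  qed
  also have "\<dots> \<in> sets (borel \<Otimes>\<^sub>M borel)"
  proof -
    have "{z \<in> space (borel \<Otimes>\<^sub>M borel). if fst z = - x0 then 0 \<le> c else snd z \<le> y0 + height x0 (fst z) c} \<in>
        sets (borel \<Otimes>\<^sub>M borel)" by measurable
    then show ?thesis using sets.top[of "borel \<Otimes>\<^sub>M borel :: plane measure"] by (simp add: space_pair_measure)
  qed
  finally show "{z \<in> space (borel \<Otimes>\<^sub>M borel). angle x0 y0 z \<le> c} \<in> sets (borel \<Otimes>\<^sub>M borel)" .
qed

section \<open>The measure of the set of intermediate points\<close>

text \<open>The abscissa at time \<open>t\<close> of the geodesic with angle \<open>\<omega>\<close> that starts at \<open>x0\<close> and ends at \<open>x\<close>, and the
  inverse of this map in the variable \<open>x\<close>.\<close>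

definition mid :: "real \<Rightarrow> real \<Rightarrow> real \<Rightarrow> real \<Rightarrow> real" where
  "mid x0 t x \<omega> = (x0 * sin ((1 - t) * \<omega>) + x * sin (t * \<omega>)) / sin \<omega>"

definition unmid :: "real \<Rightarrow> real \<Rightarrow> real \<Rightarrow> real \<Rightarrow> real" where
  "unmid x0 t x \<omega> = (x * sin \<omega> - x0 * sin ((1 - t) * \<omega>)) / sin (t * \<omega>)"

lemma sin_sub_mult: "sin ((1 - t) * \<omega>) = sin \<omega> * cos (t * \<omega>) - cos \<omega> * sin (t * \<omega>)" for t \<omega> :: real
  by (simp add: left_diff_distrib sin_diff)

lemma mid_wave:
  assumes "sin \<omega> \<noteq> 0"
  shows "mid x0 t (wave x0 q \<omega>) \<omega> = wave x0 q (t * \<omega>)"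
  using assms unfolding mid_def sin_sub_mult wave_def by (simp add: field_simps)

lemma unmid_mid:
  assumes "sin \<omega> \<noteq> 0" "sin (t * \<omega>) \<noteq> 0"
  shows "unmid x0 t (mid x0 t x \<omega>) \<omega> = x"
  using assms by (simp add: unmid_def mid_def)

lemma mid_unmid:
  assumes "sin \<omega> \<noteq> 0" "sin (t * \<omega>) \<noteq> 0"
  shows "mid x0 t (unmid x0 t x \<omega>) \<omega> = x"
  using assms by (simp add: unmid_def mid_def)

lemma angle_scale_bounds:
  assumes "0 < t" "t \<le> 1" "\<bar>\<omega>\<bar> < pi" "\<omega> \<noteq> (0::real)"
  shows "\<bar>t * \<omega>\<bar> < pi" "t * \<omega> \<noteq> 0" "sin (t * \<omega>) \<noteq> 0" "sin \<omega> \<noteq> 0"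
proof -
  have "\<bar>t * \<omega>\<bar> \<le> 1 * \<bar>\<omega>\<bar>" unfolding abs_mult using assms by (intro mult_right_mono) auto
  then show 1: "\<bar>t * \<omega>\<bar> < pi" using assms by simp
  show 2: "t * \<omega> \<noteq> 0" using assms by simp
  show "sin (t * \<omega>) \<noteq> 0" by (rule cos_bounds(3)[OF 1 2])
  show "sin \<omega> \<noteq> 0" by (rule cos_bounds(3)[OF assms(3,4)])
qed

text \<open>The interpolated points off two null lines that lie on geodesics with \<open>0 < \<bar>\<omega>\<bar> < pi\<close>. They are
  described through the inverse of the contraction, because measurability is evident in this form,
  whereas it is not for the image of \<open>B\<close>.\<close>

definition regular_points :: "real \<Rightarrow> real \<Rightarrow> real \<Rightarrow> plane set \<Rightarrow> plane set" where
  "regular_points x0 y0 t B = {z. fst z \<noteq> - x0 \<and> snd z \<noteq> y0 \<and> \<bar>angle x0 y0 z\<bar> < t * pi \<and>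
     (unmid x0 t (fst z) (angle x0 y0 z / t),
      y0 + height x0 (unmid x0 t (fst z) (angle x0 y0 z / t)) (angle x0 y0 z / t)) \<in> B}"

lemma sets_regular_points:
  assumes B: "B \<in> sets (borel \<Otimes>\<^sub>M borel)"
  shows "regular_points x0 y0 t B \<in> sets (borel \<Otimes>\<^sub>M borel)"
proof -
  have [measurable]: "Measurable.pred (borel \<Otimes>\<^sub>M borel) (\<lambda>z. z \<in> B)" using B by simp
  have "{z \<in> space (borel \<Otimes>\<^sub>M borel). fst z \<noteq> - x0 \<and> snd z \<noteq> y0 \<and> \<bar>angle x0 y0 z\<bar> < t * pi \<and>
     (unmid x0 t (fst z) (angle x0 y0 z / t),
      y0 + height x0 (unmid x0 t (fst z) (angle x0 y0 z / t)) (angle x0 y0 z / t)) \<in> B} \<in> sets (borel \<Otimes>\<^sub>M borel)"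
    unfolding unmid_def by measurable
  then show ?thesis by (simp add: regular_points_def space_pair_measure)
qed

text \<open>The area density of the contraction in angular coordinates: \<open>t\<close> and the quotient of the sines come from
  the map \<open>(x, \<omega>) \<mapsto> (mid x0 t x \<omega>, t * \<omega>)\<close>, and \<open>height'\<close> from the coordinates at the image.\<close>

definition weight :: "real \<Rightarrow> real \<Rightarrow> real \<Rightarrow> real \<Rightarrow> real" where
  "weight x0 t x \<omega> = t * \<bar>sin (t * \<omega>) / sin \<omega>\<bar> * height' x0 (mid x0 t x \<omega>) (t * \<omega>)"

definition angular_integral :: "real \<Rightarrow> real \<Rightarrow> plane set \<Rightarrow> (real \<Rightarrow> real \<Rightarrow> real) \<Rightarrow> ennreal" where
  "angular_integral x0 y0 B w = (\<integral>\<^sup>+\<omega>. (\<integral>\<^sup>+x. indicator B (x, y0 + height x0 x \<omega>) *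
     ennreal (w x \<omega>) * indicator {- pi<..<pi} \<omega> \<partial>lborel) \<partial>lborel)"

lemma emeasure_angular:
  assumes B: "B \<in> sets (borel \<Otimes>\<^sub>M borel)"
  shows "emeasure lborel B = angular_integral x0 y0 B (height' x0)"
proof -
  have "emeasure lborel B = (\<integral>\<^sup>+z. indicator B z \<partial>lborel)"
    using B unfolding borel_prod by simp
  also have "\<dots> = angular_integral x0 y0 B (height' x0)"
    unfolding angular_integral_def by (rule nn_integral_plane_angular) (use B in measurable)
  finally show ?thesis .
qed

lemma angular_integral_scaled_le:
  assumes B [measurable]: "B \<in> sets (borel \<Otimes>\<^sub>M borel)" and k: "k \<ge> 0"
    and v [measurable]: "(\<lambda>(x, \<omega>). v x \<omega>) \<in> borel_measurable (borel \<Otimes>\<^sub>M borel)"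
    and le: "\<And>x \<omega>. \<bar>\<omega>\<bar> < pi \<Longrightarrow> \<omega> \<noteq> 0 \<Longrightarrow> v x \<omega> \<ge> 0 \<and> k * v x \<omega> \<le> w x \<omega>"
  shows "ennreal k * angular_integral x0 y0 B v \<le> angular_integral x0 y0 B w"
proof -
  have "ennreal k * angular_integral x0 y0 B v = (\<integral>\<^sup>+\<omega>. (\<integral>\<^sup>+x. ennreal k * (indicator B (x, y0 + height x0 x \<omega>) *
      ennreal (v x \<omega>) * indicator {- pi<..<pi} \<omega>) \<partial>lborel) \<partial>lborel)"
    unfolding angular_integral_def by (simp add: nn_integral_cmult)
  also have "\<dots> \<le> angular_integral x0 y0 B w"
    unfolding angular_integral_def
  proof (rule nn_integral_mono_AE, rule eventually_mono[OF AE_lborel_neq[of 0]], rule nn_integral_mono)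
    fix \<omega> x :: real assume "\<omega> \<noteq> 0"
    have "ennreal k * ennreal (v x \<omega>) \<le> ennreal (w x \<omega>)" if "\<omega> \<in> {- pi<..<pi}"
    proof -
      have "\<bar>\<omega>\<bar> < pi" using that by auto
      then show ?thesis using le[OF _ \<open>\<omega> \<noteq> 0\<close>, of x] k by (simp add: ennreal_mult[symmetric] ennreal_leI)
    qed
    then show "ennreal k * (indicator B (x, y0 + height x0 x \<omega>) * ennreal (v x \<omega>) * indicator {- pi<..<pi} \<omega>)
        \<le> indicator B (x, y0 + height x0 x \<omega>) * ennreal (w x \<omega>) * indicator {- pi<..<pi} \<omega>"
      by (auto simp: indicator_def)
  qed
  finally show ?thesis .
qed

text \<open>Write the area of the contracted set in angular coordinates, substitute first the angle by \<open>t * \<omega>\<close> and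
  then, for each \<open>\<omega>\<close>, the abscissa by the affine map \<open>mid\<close>.\<close>

lemma emeasure_regular_points:
  assumes B [measurable]: "B \<in> sets (borel \<Otimes>\<^sub>M borel)" and t: "0 < t" "t \<le> 1"
  shows "emeasure lborel (regular_points x0 y0 t B) =
    angular_integral x0 y0 B (weight x0 t)"
proof -
  define G where "G x \<omega> = indicator B (unmid x0 t x \<omega>, y0 + height x0 (unmid x0 t x \<omega>) \<omega>) *
      ennreal (height' x0 x (t * \<omega>)) * indicator {- pi<..<pi} \<omega>" for x \<omega>
  have Gm [measurable]: "(\<lambda>(x, \<omega>). G x \<omega>) \<in> borel_measurable (borel \<Otimes>\<^sub>M borel)"
    unfolding G_def unmid_def by measurable
  have "emeasure lborel (regular_points x0 y0 t B) = angular_integral x0 y0 (regular_points x0 y0 t B) (height' x0)"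
    by (rule emeasure_angular[OF sets_regular_points[OF B]])
  also have "\<dots> = (\<integral>\<^sup>+\<theta>. (\<integral>\<^sup>+x. G x (\<theta> / t) \<partial>lborel) \<partial>lborel)"
    unfolding angular_integral_def
  proof (rule nn_integral_cong_AE, rule eventually_mono[OF AE_lborel_neq[of 0]],
      rule nn_integral_cong_AE, rule eventually_mono[OF AE_lborel_neq[of "- x0"]])
    fix \<theta> x :: real assume "\<theta> \<noteq> 0" and x: "x \<noteq> - x0"
    have lt: "\<bar>\<theta>\<bar> < t * pi \<longleftrightarrow> \<theta> / t \<in> {- pi<..<pi}" using t by (auto simp: field_simps abs_less_iff)
    show "indicator (regular_points x0 y0 t B) (x, y0 + height x0 x \<theta>) * ennreal (height' x0 x \<theta>) *
      indicator {- pi<..<pi} \<theta> = G x (\<theta> / t)"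
    proof (cases "\<bar>\<theta>\<bar> < t * pi")
      case True
      moreover have "t * pi \<le> pi" using t by simp
      ultimately have \<theta>: "\<bar>\<theta>\<bar> < pi" by linarith
      have "height x0 x \<theta> \<noteq> 0" using height_inj[OF x \<theta>, of 0] \<open>\<theta> \<noteq> 0\<close> by auto
      then have "(x, y0 + height x0 x \<theta>) \<in> regular_points x0 y0 t B \<longleftrightarrow>
        (unmid x0 t x (\<theta> / t), y0 + height x0 (unmid x0 t x (\<theta> / t)) (\<theta> / t)) \<in> B"
        using x True angle_eq[OF x \<theta>, of y0] by (simp add: regular_points_def)
      moreover have "\<theta> \<in> {- pi<..<pi}" using \<theta> by auto
      ultimately show ?thesis using True lt t by (auto simp: G_def indicator_def)
    next
      case False
      have "(x, y0 + height x0 x \<theta>) \<notin> regular_points x0 y0 t B" if "\<theta> \<in> {- pi<..<pi}"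
        using angle_eq[OF x, of \<theta> y0] that False by (auto simp: regular_points_def abs_less_iff)
      then show ?thesis using False lt by (auto simp: G_def indicator_def)
    qed
  qed
  also have "\<dots> = \<bar>t\<bar> * (\<integral>\<^sup>+\<omega>. (\<integral>\<^sup>+x. G x ((0 + t * \<omega>) / t) \<partial>lborel) \<partial>lborel)"
    by (rule nn_integral_real_affine) (measurable, use t in simp)
  also have "\<dots> = \<bar>t\<bar> * (\<integral>\<^sup>+\<omega>. (\<integral>\<^sup>+x. G x \<omega> \<partial>lborel) \<partial>lborel)"
    using t by simp
  also have "\<dots> = (\<integral>\<^sup>+\<omega>. ennreal t * (\<integral>\<^sup>+x. G x \<omega> \<partial>lborel) \<partial>lborel)"
    using t by (subst nn_integral_cmult) auto
  also have "\<dots> = angular_integral x0 y0 B (weight x0 t)"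
    unfolding angular_integral_def
  proof (rule nn_integral_cong_AE, rule eventually_mono[OF AE_lborel_neq[of 0]])
    fix \<omega> :: real assume "\<omega> \<noteq> 0"
    show "ennreal t * (\<integral>\<^sup>+x. G x \<omega> \<partial>lborel) = (\<integral>\<^sup>+x. indicator B (x, y0 + height x0 x \<omega>) *
        ennreal (weight x0 t x \<omega>) * indicator {- pi<..<pi} \<omega> \<partial>lborel)" (is "_ = ?rhs")
    proof (cases "\<bar>\<omega>\<bar> < pi")
      case False
      then have "\<omega> \<notin> {- pi<..<pi}" by (auto simp: abs_less_iff)
      then show ?thesis by (simp add: G_def)
    next
      case True
      note nz = angle_scale_bounds[OF t True \<open>\<omega> \<noteq> 0\<close>]
      define A c where "A = x0 * sin ((1 - t) * \<omega>) / sin \<omega>" and "c = sin (t * \<omega>) / sin \<omega>"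
      have mid: "A + c * x = mid x0 t x \<omega>" for x
        by (simp add: A_def c_def mid_def add_divide_distrib mult.commute)
      have "c \<noteq> 0" using nz by (simp add: c_def)
      have [measurable]: "(\<lambda>x. G x \<omega>) \<in> borel_measurable borel"
        unfolding G_def unmid_def by measurable
      have "ennreal t * (\<integral>\<^sup>+x. G x \<omega> \<partial>lborel) = ennreal t * (\<bar>c\<bar> * (\<integral>\<^sup>+x. G (A + c * x) \<omega> \<partial>lborel))"
        by (subst nn_integral_real_affine[OF _ \<open>c \<noteq> 0\<close>, of _ A]) auto
      also have "\<dots> = ennreal (t * \<bar>c\<bar>) * (\<integral>\<^sup>+x. G (mid x0 t x \<omega>) \<omega> \<partial>lborel)"
        using t by (simp add: mid ennreal_mult mult.assoc)
      also have "\<dots> = (\<integral>\<^sup>+x. ennreal (t * \<bar>c\<bar>) * G (mid x0 t x \<omega>) \<omega> \<partial>lborel)"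
        by (subst nn_integral_cmult) (auto simp: mid_def)
      also have "\<dots> = ?rhs"
      proof (rule nn_integral_cong)
        fix x
        have "ennreal (weight x0 t x \<omega>) = ennreal (t * \<bar>c\<bar>) * ennreal (height' x0 (mid x0 t x \<omega>) (t * \<omega>))"
          unfolding weight_def c_def[symmetric] using t by (intro ennreal_mult height'_nonneg nz) auto
        then show "ennreal (t * \<bar>c\<bar>) * G (mid x0 t x \<omega>) \<omega> =
          indicator B (x, y0 + height x0 x \<omega>) * ennreal (weight x0 t x \<omega>) * indicator {- pi<..<pi} \<omega>"
          using nz by (simp add: G_def unmid_mid mult_ac)
      qed
      finally show ?thesis .
    qed
  qed
  finally show ?thesis .
qed

lemma negligible_graph:
  fixes k :: "real \<Rightarrow> real"
  assumes [measurable]: "k \<in> borel_measurable borel"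
  shows "negligible {z. snd z = k (fst z)}"
proof -
  have S: "{z \<in> space (borel \<Otimes>\<^sub>M borel). snd z = k (fst z)} \<in> sets (borel \<Otimes>\<^sub>M borel)" by measurable
  then have S': "{z. snd z = k (fst z)} \<in> sets (lborel \<Otimes>\<^sub>M lborel)" by (simp add: space_pair_measure)
  have "Pair x -` {z. snd z = k (fst z)} = {k x}" for x by auto
  then have "emeasure (lborel \<Otimes>\<^sub>M lborel) {z. snd z = k (fst z)} = 0"
    using lborel.emeasure_pair_measure_alt[OF S'] by simp
  then have "{z. snd z = k (fst z)} \<in> null_sets lborel"
    unfolding lborel_prod using S' unfolding lborel_prod by (simp add: null_sets_def)
  then show ?thesis
    using negligible_iff_null_sets null_sets_completionI by blast
qed

lemma negligible_vertical_line: "negligible {z::plane. fst z = c}"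
proof -
  have "negligible {z::plane. (1, 0) \<bullet> z = c}"
    by (rule negligible_hyperplane) (simp add: zero_prod_def)
  then show ?thesis by (simp add: inner_prod_def)
qed

lemma regular_points_subset:
  assumes t: "0 < t" "t \<le> 1"
  shows "regular_points x0 y0 t B \<subseteq> intermediate_points t {(x0, y0)} B"
proof
  fix z assume z: "z \<in> regular_points x0 y0 t B"
  define \<omega> where "\<omega> = angle x0 y0 z / t"
  define x where "x = unmid x0 t (fst z) \<omega>"
  have zz: "fst z \<noteq> - x0" "snd z \<noteq> y0" "\<bar>angle x0 y0 z\<bar> < t * pi" "(x, y0 + height x0 x \<omega>) \<in> B"
    using z by (auto simp: regular_points_def \<omega>_def x_def)
  have ang: "angle x0 y0 z = t * \<omega>" using t by (simp add: \<omega>_def)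
  have h: "height x0 (fst z) (t * \<omega>) = snd z - y0" using angle(2)[OF zz(1), of y0] by (simp add: ang)
  then have "\<omega> \<noteq> 0" using zz(2) by auto
  have "\<bar>\<omega>\<bar> < pi" using zz(3) t by (simp add: ang abs_mult)
  note nz = angle_scale_bounds[OF t \<open>\<bar>\<omega>\<bar> < pi\<close> \<open>\<omega> \<noteq> 0\<close>]
  define q where "q = (x - x0 * cos \<omega>) / sin \<omega>"
  have w: "wave x0 q \<omega> = x" unfolding q_def by (rule wave_eq[OF \<open>\<bar>\<omega>\<bar> < pi\<close> \<open>\<omega> \<noteq> 0\<close>])
  have "geo (x0, y0) q \<omega> 1 = (x, y0 + height x0 x \<omega>)"
    using height_wave[OF \<open>\<bar>\<omega>\<bar> < pi\<close> \<open>\<omega> \<noteq> 0\<close>, of x0 q] w by (simp add: geo_end)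
  moreover have "geo (x0, y0) q \<omega> t = z"
  proof -
    have wt: "wave x0 q (t * \<omega>) = fst z"
      using mid_wave[OF nz(4), of x0 t q] mid_unmid[OF nz(4,3), of x0 "fst z"] by (simp add: w x_def)
    then have "rise x0 q (t * \<omega>) = snd z - y0"
      using height_wave[OF nz(1,2), of x0 q] h by simp
    then show ?thesis using wt by (simp add: geo_def mult.commute prod_eq_iff)
  qed
  ultimately show "z \<in> intermediate_points t {(x0, y0)} B"
    unfolding intermediate_points_def
    using geo_minimizing(1)[OF \<open>\<bar>\<omega>\<bar> < pi\<close>, of "(x0, y0)" q] geo_start zz(4)
    by (intro CollectI exI[of _ "geo (x0, y0) q \<omega>"]) simp
qed

text \<open>A minimizing geodesic has constant height or has \<open>0 < \<bar>\<omega>\<bar> < pi\<close> or \<open>\<omega> = \<plusminus>pi\<close>. In the last case the abscissa at a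
  time \<open>t < 1\<close> determines \<open>q\<close>, so that the point lies on one of two graphs; at \<open>t = 1\<close> it lies on the
  line \<open>x = - x0\<close>.\<close>

lemma intermediate_points_subset:
  assumes t: "0 < t" "t \<le> 1"
  shows "\<exists>N. negligible N \<and> intermediate_points t {(x0, y0)} B \<subseteq> regular_points x0 y0 t B \<union> N"
proof -
  define k where "k \<epsilon> x = y0 + rise x0 ((x - x0 * cos (\<epsilon> * pi * t)) / sin (\<epsilon> * pi * t)) (\<epsilon> * pi * t)" for \<epsilon> x
  have k [measurable]: "k \<epsilon> \<in> borel_measurable borel" for \<epsilon>
    unfolding k_def rise_def by measurable
  define N where "N = {z::plane. fst z = - x0} \<union> {z. snd z = (\<lambda>_. y0) (fst z)} \<union>
      {z. snd z = k 1 (fst z)} \<union> {z. snd z = k (-1) (fst z)}"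
  have "negligible N"
    unfolding N_def by (intro negligible_Un negligible_vertical_line negligible_graph k) auto
  moreover have "intermediate_points t {(x0, y0)} B \<subseteq> regular_points x0 y0 t B \<union> N"
  proof
    fix z assume "z \<in> intermediate_points t {(x0, y0)} B"
    then obtain \<gamma> where \<gamma>: "z = \<gamma> t" "minimizing_geodesic \<gamma>" "\<gamma> 0 = (x0, y0)" "\<gamma> 1 \<in> B"
      by (auto simp: intermediate_points_def)
    have t01: "t \<in> {0..1}" using t by auto
    show "z \<in> regular_points x0 y0 t B \<union> N"
    proof (cases "snd (\<gamma> 1) = y0 \<or> fst z = - x0")
      case True
      then show ?thesis using flat_geodesic[OF \<gamma>(2) _ t01] \<gamma>(1,3) by (auto simp: N_def)
    next
      case False
      then obtain q \<omega> where q: "\<omega> \<noteq> 0" "\<bar>\<omega>\<bar> \<le> pi" "\<forall>t\<in>{0..1}. \<gamma> t = geo (x0, y0) q \<omega> t"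
        using geodesic_classification[OF \<gamma>(2,3)] by blast
      have z: "z = (wave x0 q (t * \<omega>), y0 + rise x0 q (t * \<omega>))"
        using q(3) t01 \<gamma>(1) by (simp add: geo_def mult.commute)
      then have zf: "fst z = wave x0 q (t * \<omega>)" and zs: "snd z = y0 + rise x0 q (t * \<omega>)" by simp_all
      have e: "\<gamma> 1 = (wave x0 q \<omega>, y0 + rise x0 q \<omega>)"
        using q(3) by (simp add: geo_end)
      show ?thesis
      proof (cases "\<bar>\<omega>\<bar> < pi")
        case True
        note nz = angle_scale_bounds[OF t True q(1)]
        have h: "rise x0 q (t * \<omega>) = height x0 (wave x0 q (t * \<omega>)) (t * \<omega>)"
          by (rule height_wave[OF nz(1,2), symmetric])
        have x: "wave x0 q (t * \<omega>) \<noteq> - x0" using False z by simp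
        have ang: "angle x0 y0 z = t * \<omega>" unfolding z h by (rule angle_eq[OF x nz(1)])
        have "rise x0 q (t * \<omega>) \<noteq> 0" using height_inj[OF x nz(1), of 0] nz(2) h by auto
        moreover have "unmid x0 t (wave x0 q (t * \<omega>)) \<omega> = wave x0 q \<omega>"
          using unmid_mid[OF nz(4,3), of x0 "wave x0 q \<omega>"] mid_wave[OF nz(4), of x0 t q] by simp
        moreover have "\<bar>t * \<omega>\<bar> < t * pi" using True t by (simp add: abs_mult)
        ultimately have "z \<in> regular_points x0 y0 t B"
          using x \<gamma>(4) height_wave[OF True q(1), of x0 q] t
          by (simp add: regular_points_def ang zf zs e)
        then show ?thesis by simp
      next
        case om: False
        define \<epsilon> where "\<epsilon> = sgn \<omega>"
        have \<omega>: "\<omega> = \<epsilon> * pi" using om q(1,2) by (auto simp: \<epsilon>_def sgn_if)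
        have \<epsilon>: "\<epsilon> = 1 \<or> \<epsilon> = -1" using q(1) by (auto simp: \<epsilon>_def sgn_if)
        have "t \<noteq> 1" using z False \<epsilon> \<omega> by (auto simp: wave_def)
        then have "sin (pi * t) > 0" using t by (intro sin_gt_zero) auto
        then have "sin (\<epsilon> * pi * t) \<noteq> 0" using \<epsilon> by auto
        moreover have tw: "t * \<omega> = \<epsilon> * pi * t" by (simp add: \<omega>)
        ultimately have "snd z = k \<epsilon> (fst z)" unfolding zf zs k_def wave_def tw by simp
        then show ?thesis using \<epsilon> by (auto simp: N_def)
      qed
    qed
  qed
  ultimately show ?thesis by blast
qed

text \<open>The difference from the Borel set \<open>regular_points\<close> is a null set, so the set is Lebesgue measurable.\<close>

lemma intermediate_points_measure:
  assumes B: "B \<in> sets borel" and t: "0 < t" "t \<le> 1"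
  shows "emeasure lebesgue (intermediate_points t {(x0, y0)} B) =
    angular_integral x0 y0 B (weight x0 t)"
proof -
  have B': "B \<in> sets (borel \<Otimes>\<^sub>M borel)" using B unfolding borel_prod .
  define Z where "Z = intermediate_points t {(x0, y0)} B"
  define R where "R = regular_points x0 y0 t B"
  have Rs: "R \<in> sets lborel" using sets_regular_points[OF B'] unfolding R_def borel_prod by simp
  obtain N where N: "negligible N" "Z \<subseteq> R \<union> N"
    using intermediate_points_subset[OF t] unfolding Z_def R_def by blast
  have "negligible (Z - R)" using N by (meson Diff_subset_conv negligible_subset)
  then have "Z - R \<in> null_sets lebesgue" by (simp add: negligible_iff_null_sets)
  moreover have "Z = R \<union> (Z - R)" using regular_points_subset[OF t] by (auto simp: Z_def R_def)
  ultimately have "emeasure lebesgue Z = emeasure lebesgue R"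
    using Rs by (metis emeasure_Un_null_set sets_completionI_sets)
  also have "\<dots> = emeasure lborel R" using Rs by simp
  finally show ?thesis
    unfolding Z_def R_def by (simp add: emeasure_regular_points[OF B' t])
qed

section \<open>The sharp Jacobian inequality\<close>

text \<open>The Jacobian of the exponential map in the coordinates \<open>(q, \<omega>)\<close>. Along a geodesic from \<open>x0\<close> the
  parameter \<open>q\<close> is constant, so that the contraction only rescales the argument \<open>\<theta>\<close>.\<close>

definition jac :: "real \<Rightarrow> real \<Rightarrow> real \<Rightarrow> real" where
  "jac x0 q \<theta> = x0\<^sup>2 * sin \<theta> + x0 * q * (\<theta> * sin \<theta>) + q\<^sup>2 * (sin \<theta> - \<theta> * cos \<theta>)"

lemma sin_mult_height':
  assumes "\<bar>\<theta>\<bar> < pi" "\<theta> \<noteq> 0"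
  shows "sin \<theta> * height' x0 (wave x0 q \<theta>) \<theta> = jac x0 q \<theta>"
proof -
  define c s where "c = cos \<theta>" and "s = sin \<theta>"
  have c: "1 + c \<noteq> 0" "1 - c \<noteq> 0" using cos_bounds[OF assms(1)] assms(2) by (auto simp: c_def)
  have sc: "s * s = (1 + c) * (1 - c)"
    using sin_cos_squared_add[of \<theta>] by (simp add: c_def s_def power2_eq_square algebra_simps)
  have P: "s * sym_height' \<theta> = (2 * s + \<theta> * (1 - c)) / (1 + c)"
  proof -
    have "s * (1 + c)\<^sup>2 + s * (s * (\<theta> + s)) = (2 * s + \<theta> * (1 - c)) * (1 + c)"
      unfolding power2_eq_square using sc by algebra
    then have "s * (1 + c)\<^sup>2 + s * (s * (\<theta> + s)) = (2 * s + \<theta> * (1 - c)) / (1 + c) * (1 + c)\<^sup>2"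
      using c by (simp add: power2_eq_square)
    then have "(s * (1 + c)\<^sup>2 + s * (s * (\<theta> + s))) / (1 + c)\<^sup>2 = (2 * s + \<theta> * (1 - c)) / (1 + c)"
      using c by simp
    then show ?thesis
      using c by (simp add: sym_height'_def c_def[symmetric] s_def[symmetric] add_divide_distrib distrib_left)
  qed
  have R: "s * skew_height' \<theta> = (2 * s - \<theta> * (1 + c)) / (1 - c)"
  proof -
    have "s * (1 - c)\<^sup>2 - s * (s * (\<theta> - s)) = (2 * s - \<theta> * (1 + c)) * (1 - c)"
      unfolding power2_eq_square using sc by algebra
    then have "s * (1 - c)\<^sup>2 - s * (s * (\<theta> - s)) = (2 * s - \<theta> * (1 + c)) / (1 - c) * (1 - c)\<^sup>2"
      using c by (simp add: power2_eq_square)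
    then have "(s * (1 - c)\<^sup>2 - s * (s * (\<theta> - s))) / (1 - c)\<^sup>2 = (2 * s - \<theta> * (1 + c)) / (1 - c)"
      using c by simp
    then show ?thesis
      using c assms(2) by (simp add: skew_height'_def c_def[symmetric] s_def[symmetric] diff_divide_distrib right_diff_distrib)
  qed
  define x where "x = x0 * c + q * s"
  have id: "((x0 + x)\<^sup>2 * (2 * s + \<theta> * (1 - c))) * (1 - c) + ((x - x0)\<^sup>2 * (2 * s - \<theta> * (1 + c))) * (1 + c)
      = 4 * (x0\<^sup>2 * s + x0 * q * (\<theta> * s) + q\<^sup>2 * (s - \<theta> * c)) * ((1 + c) * (1 - c))"
    unfolding x_def power2_eq_square using sc by algebra
  have "((x0 + x)\<^sup>2 * (2 * s + \<theta> * (1 - c))) / (1 + c) + ((x - x0)\<^sup>2 * (2 * s - \<theta> * (1 + c))) / (1 - c)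
      = 4 * (x0\<^sup>2 * s + x0 * q * (\<theta> * s) + q\<^sup>2 * (s - \<theta> * c))"
    unfolding add_frac_eq[OF c] id using c by simp
  moreover have "s * height' x0 x \<theta> = ((x0 + x)\<^sup>2 * (s * sym_height' \<theta>) + (x - x0)\<^sup>2 * (s * skew_height' \<theta>)) / 4"
    by (simp add: height'_def algebra_simps)
  ultimately show ?thesis
    unfolding P R by (simp add: jac_def wave_def x_def c_def s_def)
qed

text \<open>The start \<open>3 - h / 5\<close> of the continued fraction of \<open>h / (1 - \<theta> * cot \<theta>)\<close> in the variable \<open>h = \<theta>\<^sup>2\<close>. Two
  differentiations reduce the inequality to \<open>\<theta> * cos \<theta> \<le> sin \<theta>\<close>.\<close>

lemma sin_bound:
  assumes "0 < \<theta>" "\<theta> < pi"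
  shows "\<theta>\<^sup>2 * sin \<theta> \<le> (3 - \<theta>\<^sup>2 / 5) * (sin \<theta> - \<theta> * cos \<theta>)"
proof -
  have m: "0 \<le> 3 * (sin u - u * cos u) - u\<^sup>2 * sin u" if u: "0 \<le> u" "u < pi" for u
  proof -
    have "3 * (sin 0 - 0 * cos 0) - 0\<^sup>2 * sin 0 \<le> 3 * (sin u - u * cos u) - u\<^sup>2 * sin u"
    proof (rule DERIV_nonneg_imp_nondecreasing[OF u(1), where f = "\<lambda>u. 3 * (sin u - u * cos u) - u\<^sup>2 * sin u"])
      fix v assume v: "0 \<le> v" "v \<le> u"
      have "((\<lambda>u. 3 * (sin u - u * cos u) - u\<^sup>2 * sin u) has_real_derivative v * (sin v - v * cos v)) (at v)"
        by (auto intro!: derivative_eq_intros simp: algebra_simps power2_eq_square)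
      moreover have "v * (sin v - v * cos v) \<ge> 0"
        using sin_minus_mult_cos_pos[of v] v u by (cases "v = 0") auto
      ultimately show "\<exists>y. ((\<lambda>u. 3 * (sin u - u * cos u) - u\<^sup>2 * sin u) has_real_derivative y) (at v) \<and> 0 \<le> y" by blast
    qed
    then show ?thesis by simp
  qed
  have "(3 - 0\<^sup>2 / 5) * (sin 0 - 0 * cos 0) - 0\<^sup>2 * sin 0 \<le>
      (3 - \<theta>\<^sup>2 / 5) * (sin \<theta> - \<theta> * cos \<theta>) - \<theta>\<^sup>2 * sin \<theta>"
  proof (rule DERIV_nonneg_imp_nondecreasing[where f = "\<lambda>u. (3 - u\<^sup>2 / 5) * (sin u - u * cos u) - u\<^sup>2 * sin u"])
    fix v assume v: "0 \<le> v" "v \<le> \<theta>"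
    have "((\<lambda>u. (3 - u\<^sup>2 / 5) * (sin u - u * cos u) - u\<^sup>2 * sin u) has_real_derivative
        (v / 5) * (3 * (sin v - v * cos v) - v\<^sup>2 * sin v)) (at v)"
      by (auto intro!: derivative_eq_intros simp: field_simps power2_eq_square)
    then show "\<exists>y. ((\<lambda>u. (3 - u\<^sup>2 / 5) * (sin u - u * cos u) - u\<^sup>2 * sin u) has_real_derivative y) (at v) \<and> 0 \<le> y"
      using m[of v] v assms by (intro exI[of _ "(v / 5) * (3 * (sin v - v * cos v) - v\<^sup>2 * sin v)"]) auto
  qed (use assms in auto)
  then show ?thesis by simp
qed

text \<open>To leading order at \<open>\<theta> = 0\<close> both sides are equal, which is the reason why \<open>5\<close> is sharp. With \<open>h = \<theta>\<^sup>2\<close> and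
  \<open>u = h * s\<close> the claim, multiplied by \<open>h\<close>, is a concave quadratic inequality in \<open>u\<close>. By \<open>sin_bound\<close> the
  variable \<open>u\<close> ranges between \<open>0\<close> and \<open>(3 - h / 5) * r\<close>, and the product of the distances to these two
  ends is split off.\<close>

lemma jac_discriminant:
  assumes \<theta>: "0 < \<theta>" "\<theta> < pi"
  defines "s \<equiv> sin \<theta>" and "r \<equiv> sin \<theta> - \<theta> * cos \<theta>"
  shows "(\<theta> * (2 * s + r))\<^sup>2 \<le> 4 * (3 * s + r) * (4 * r - \<theta>\<^sup>2 * s)"
proof -
  define h where "h = \<theta>\<^sup>2"
  define u where "u = h * s"
  have "\<theta> < 4" using \<theta> pi_less_4 by linarith
  then have "h < 4\<^sup>2" unfolding h_def using \<theta> by (intro power_strict_mono) auto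
  then have h: "0 < h" "h < 40" using \<theta> by (auto simp: h_def)
  have r: "r > 0" using sin_minus_mult_cos_pos[of \<theta>] \<theta> by (simp add: r_def)
  have u: "0 \<le> u" "u \<le> (3 - h / 5) * r"
    using sin_bound[OF \<theta>] sin_gt_zero[OF \<theta>] h by (simp_all add: u_def h_def s_def r_def)
  have "0 \<le> h * r\<^sup>2 * (8 / 5 - h / 25)" using h by simp
  also have "\<dots> = (16 * h - h\<^sup>2) * r\<^sup>2 - 24 * h / 5 * ((3 - h / 5) * r) * r"
    by (simp add: power2_eq_square algebra_simps)
  also have "\<dots> \<le> (16 * h - h\<^sup>2) * r\<^sup>2 - 24 * h / 5 * u * r"
    using u h r by (intro diff_left_mono mult_right_mono mult_left_mono) auto
  also have "\<dots> \<le> (16 * h - h\<^sup>2) * r\<^sup>2 - 24 * h / 5 * u * r + 16 * (u * ((3 - h / 5) * r - u))"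
    using u by simp
  also have "\<dots> = h * (4 * (3 * s + r) * (4 * r - h * s) - h * (2 * s + r)\<^sup>2)"
    by (simp add: u_def power2_eq_square algebra_simps)
  finally have "0 \<le> 4 * (3 * s + r) * (4 * r - h * s) - h * (2 * s + r)\<^sup>2"
    using h by (simp add: zero_le_mult_iff)
  then show ?thesis by (simp add: h_def power_mult_distrib)
qed

text \<open>The form is \<open>4 * jac x0 q \<theta> - \<theta> * jac' x0 q \<theta>\<close>; complete the square in \<open>x0\<close>.\<close>

lemma jac_form_nonneg:
  assumes \<theta>: "0 < \<theta>" "\<theta> < pi"
  shows "0 \<le> x0\<^sup>2 * (4 * sin \<theta> - \<theta> * cos \<theta>) + x0 * q * (\<theta> * (3 * sin \<theta> - \<theta> * cos \<theta>))
     + q\<^sup>2 * (4 * sin \<theta> - 4 * \<theta> * cos \<theta> - \<theta>\<^sup>2 * sin \<theta>)"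
proof -
  define s r where "s = sin \<theta>" and "r = sin \<theta> - \<theta> * cos \<theta>"
  define a b d where "a = 3 * s + r" and "b = \<theta> * (2 * s + r)" and "d = 4 * r - \<theta>\<^sup>2 * s"
  have "a > 0" using sin_minus_mult_cos_pos[of \<theta>] sin_gt_zero[OF \<theta>] \<theta> by (simp add: a_def s_def r_def)
  have "b\<^sup>2 \<le> 4 * a * d" using jac_discriminant[OF \<theta>] by (simp add: a_def b_def d_def s_def r_def)
  then have "0 \<le> (2 * a * x0 + b * q)\<^sup>2 + (4 * a * d - b\<^sup>2) * q\<^sup>2" by simp
  also have "\<dots> = 4 * a * (x0\<^sup>2 * a + x0 * q * b + q\<^sup>2 * d)"
    by (simp add: power2_eq_square algebra_simps)
  finally have "0 \<le> x0\<^sup>2 * a + x0 * q * b + q\<^sup>2 * d"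
    using \<open>a > 0\<close> by (simp add: zero_le_mult_iff)
  then show ?thesis by (simp add: a_def b_def d_def s_def r_def algebra_simps)
qed

lemma jac_contraction:
  assumes \<theta>: "0 < \<theta>" "\<theta> < pi" and t: "0 < t" "t \<le> 1"
  shows "t ^ 4 * jac x0 q \<theta> \<le> jac x0 q (t * \<theta>)"
proof -
  have "jac x0 q \<theta> / \<theta> ^ 4 \<le> jac x0 q (t * \<theta>) / (t * \<theta>) ^ 4"
  proof (rule DERIV_nonpos_imp_nonincreasing[where f = "\<lambda>u. jac x0 q u / u ^ 4"])
    show "t * \<theta> \<le> \<theta>" using \<theta> t by simp
    fix u assume u: "t * \<theta> \<le> u" "u \<le> \<theta>"
    have "t * \<theta> > 0" using t \<theta> by simp
    then have u': "0 < u" "u < pi" using u \<theta> by auto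
    have dj: "(jac x0 q has_real_derivative (x0\<^sup>2 * cos u + x0 * q * (sin u + u * cos u) + q\<^sup>2 * (u * sin u))) (at u)"
      unfolding jac_def[abs_def] by (auto intro!: derivative_eq_intros simp: algebra_simps)
    define J' where "J' = x0\<^sup>2 * cos u + x0 * q * (sin u + u * cos u) + q\<^sup>2 * (u * sin u)"
    have "u * J' - 4 * jac x0 q u \<le> 0"
      using jac_form_nonneg[OF u', of x0 q] by (simp add: jac_def J'_def power2_eq_square algebra_simps)
    then have "u ^ 3 * (u * J' - 4 * jac x0 q u) / (u ^ 4 * u ^ 4) \<le> 0"
      using u' by (intro divide_nonpos_pos mult_nonneg_nonpos) auto
    moreover have "((\<lambda>u. jac x0 q u / u ^ 4) has_real_derivative (J' * u ^ 4 - jac x0 q u * (4 * u ^ 3)) / (u ^ 4 * u ^ 4)) (at u)"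
      by (rule DERIV_divide[OF dj[folded J'_def]]) (use u' in \<open>auto intro!: derivative_eq_intros\<close>)
    moreover have "J' * u ^ 4 - jac x0 q u * (4 * u ^ 3) = u ^ 3 * (u * J' - 4 * jac x0 q u)"
      by (simp add: algebra_simps power_numeral_reduce)
    ultimately show "\<exists>y. ((\<lambda>u. jac x0 q u / u ^ 4) has_real_derivative y) (at u) \<and> y \<le> 0" by force
  qed
  then show ?thesis using \<theta> t by (simp add: power_mult_distrib field_simps)
qed

lemma height'_minus: "height' x0 x (- \<theta>) = height' x0 x \<theta>"
  by (simp add: height'_def sym_height'_def skew_height'_def algebra_simps)

lemma weight_minus: "weight x0 t x (- \<omega>) = weight x0 t x \<omega>"
proof -
  have "mid x0 t x (- \<omega>) = mid x0 t x \<omega>"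
    by (simp add: mid_def add_divide_distrib diff_divide_distrib)
  then show ?thesis by (simp add: weight_def height'_minus)
qed

lemma weight_wave:
  assumes "0 < \<omega>" "\<omega> < pi" "0 < t" "t \<le> 1"
  shows "weight x0 t (wave x0 q \<omega>) \<omega> = t * jac x0 q (t * \<omega>) / sin \<omega>"
proof -
  have \<omega>: "\<bar>\<omega>\<bar> < pi" "\<omega> \<noteq> 0" using assms by auto
  note nz = angle_scale_bounds[OF assms(3,4) \<omega>]
  have "0 < t * \<omega>" "t * \<omega> < pi" using nz assms by auto
  then have "sin (t * \<omega>) > 0" "sin \<omega> > 0" using assms by (auto intro: sin_gt_zero)
  then show ?thesis
    unfolding weight_def mid_wave[OF nz(4)] using sin_mult_height'[OF nz(1,2), of x0 q] by simp
qed

text \<open>This is the inequality of \<open>MCP(0,5)\<close> at the level of densities. Reflection in the \<open>x\<close> axis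
  reduces it to positive angles.\<close>

lemma weight_ge:
  assumes \<omega>: "\<bar>\<omega>\<bar> < pi" "\<omega> \<noteq> 0" and t: "0 < t" "t \<le> 1"
  shows "t ^ 5 * height' x0 x \<omega> \<le> weight x0 t x \<omega>"
proof -
  have pos: "t ^ 5 * height' x0 x \<omega> \<le> weight x0 t x \<omega>" if \<omega>: "0 < \<omega>" "\<omega> < pi" for \<omega>
  proof -
    define q where "q = (x - x0 * cos \<omega>) / sin \<omega>"
    have \<omega>': "\<bar>\<omega>\<bar> < pi" "\<omega> \<noteq> 0" using \<omega> by auto
    have x: "x = wave x0 q \<omega>" unfolding q_def by (rule wave_eq[OF \<omega>', symmetric])
    have s: "sin \<omega> > 0" using \<omega> by (rule sin_gt_zero)
    have "t ^ 5 * height' x0 x \<omega> = t * (t ^ 4 * jac x0 q \<omega>) / sin \<omega>"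
      using sin_mult_height'[OF \<omega>', of x0 q] s by (simp add: x power_numeral_reduce field_simps)
    also have "\<dots> \<le> t * jac x0 q (t * \<omega>) / sin \<omega>"
      using jac_contraction[OF \<omega> t, of x0 q] s t by (intro divide_right_mono mult_left_mono) auto
    also have "\<dots> = weight x0 t x \<omega>" unfolding x by (rule weight_wave[OF \<omega> t, symmetric])
    finally show ?thesis .
  qed
  show ?thesis
  proof (cases "\<omega> > 0")
    case False
    then show ?thesis using pos[of "- \<omega>"] \<omega> by (simp add: height'_minus weight_minus)
  qed (use pos \<omega> in auto)
qed

section \<open>Sufficiency\<close>

text \<open>The speed of the geodesic with angle \<open>\<theta>\<close> from \<open>x0\<close> to \<open>x\<close>, hence the distance of its end points.\<close>

definition chord :: "real \<Rightarrow> real \<Rightarrow> real \<Rightarrow> real" where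
  "chord x0 x \<theta> = \<bar>\<theta>\<bar> * sqrt (x0\<^sup>2 + ((x - x0 * cos \<theta>) / sin \<theta>)\<^sup>2)"

lemma grushin_dist_angular:
  assumes "\<bar>\<theta>\<bar> < pi" "\<theta> \<noteq> 0"
  shows "grushin_dist (x0, y0) (x, y0 + height x0 x \<theta>) = chord x0 x \<theta>"
proof -
  define q where "q = (x - x0 * cos \<theta>) / sin \<theta>"
  have w: "wave x0 q \<theta> = x" unfolding q_def by (rule wave_eq[OF assms])
  have "geo (x0, y0) q \<theta> 1 = (x, y0 + height x0 x \<theta>)"
    using height_wave[OF assms, of x0 q] w by (simp add: geo_end)
  then show ?thesis
    using geo_minimizing(2)[OF assms(1), of "(x0, y0)" q] by (simp add: chord_def q_def)
qed

lemma chord_pos: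
  assumes "\<bar>\<theta>\<bar> < pi" "\<theta> \<noteq> 0" "x \<noteq> - x0"
  shows "chord x0 x \<theta> > 0"
proof -
  have "x0\<^sup>2 + ((x - x0 * cos \<theta>) / sin \<theta>)\<^sup>2 > 0"
    using assms cos_bounds(3)[OF assms(1,2)] by (cases "x0 = 0") (auto simp: add_pos_nonneg)
  then show ?thesis using assms by (simp add: chord_def)
qed

lemma sinh_mult_le:
  assumes "0 \<le> t" "t \<le> 1" "0 \<le> u"
  shows "sinh (t * u) \<le> t * sinh (u::real)"
proof -
  have "t * sinh 0 - sinh (t * 0) \<le> t * sinh u - sinh (t * u)"
  proof (rule DERIV_nonneg_imp_nondecreasing[OF assms(3), where f = "\<lambda>u. t * sinh u - sinh (t * u)"])
    fix v assume v: "0 \<le> v" "v \<le> u"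
    have "((\<lambda>u. t * sinh u - sinh (t * u)) has_real_derivative t * (cosh v - cosh (t * v))) (at v)"
      by (auto intro!: derivative_eq_intros simp: algebra_simps)
    moreover have "t * v \<le> 1 * v" using assms v by (intro mult_right_mono) auto
    then have "cosh (t * v) \<le> cosh v" using assms v by (subst cosh_real_nonneg_le_iff) auto
    then have "0 \<le> t * (cosh v - cosh (t * v))" using assms by simp
    ultimately show "\<exists>y. ((\<lambda>u. t * sinh u - sinh (t * u)) has_real_derivative y) (at v) \<and> 0 \<le> y" by blast
  qed
  then show ?thesis by simp
qed

lemma mcp_factor_eq:
  assumes "N > 1" "s_fun K (r / sqrt (N - 1)) \<noteq> 0"
  shows "mcp_factor K N t r = (s_fun K (t * r / sqrt (N - 1)) / s_fun K (r / sqrt (N - 1))) powr (N - 1)"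
  using assms by (simp add: mcp_factor_def ratio01_def)

text \<open>For \<open>K < 0\<close> convexity of the hyperbolic sine bounds the ratio by \<open>t\<close>, its value for \<open>K = 0\<close>. The distance
  must be positive: the convention \<open>0 / 0 = 1\<close> makes the factor \<open>1\<close> at the base point.\<close>

lemma mcp_factor_le:
  assumes K: "K \<le> 0" and N: "N \<ge> 5" and t: "0 < t" "t \<le> 1" and r: "r > 0"
  shows "mcp_factor K N t r \<le> t ^ 4"
proof -
  define \<rho> where "\<rho> = r / sqrt (N - 1)"
  have \<rho>: "\<rho> > 0" using N r by (simp add: \<rho>_def)
  have t\<rho>: "t * r / sqrt (N - 1) = t * \<rho>" by (simp add: \<rho>_def)
  have pos: "s_fun K \<rho> > 0" and nn: "s_fun K (t * \<rho>) \<ge> 0" and le: "s_fun K (t * \<rho>) \<le> t * s_fun K \<rho>"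
  proof -
    have 1: "s_fun K \<rho> > 0 \<and> s_fun K (t * \<rho>) \<ge> 0 \<and> s_fun K (t * \<rho>) \<le> t * s_fun K \<rho>"
    proof (cases "K = 0")
      case False
      define k where "k = sqrt (- K)"
      have k: "k > 0" using K False by (simp add: k_def)
      have eq: "s_fun K u = sinh (k * u) / k" for u using K False by (simp add: s_fun_def k_def)
      have "sinh (t * (k * \<rho>)) \<le> t * sinh (k * \<rho>)" using t k \<rho> by (intro sinh_mult_le) auto
      then show ?thesis unfolding eq using k \<rho> t by (auto simp: divide_right_mono mult.left_commute)
    qed (use \<rho> t in \<open>simp add: s_fun_def\<close>)
    then show "s_fun K \<rho> > 0" "s_fun K (t * \<rho>) \<ge> 0" "s_fun K (t * \<rho>) \<le> t * s_fun K \<rho>" by auto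
  qed
  have "mcp_factor K N t r = (s_fun K (t * \<rho>) / s_fun K \<rho>) powr (N - 1)"
    using mcp_factor_eq[of N K r t] pos N by (simp add: t\<rho> \<rho>_def[symmetric])
  also have "\<dots> \<le> t powr (N - 1)"
    using pos nn le N by (intro powr_mono2) (auto simp: divide_le_eq)
  also have "\<dots> \<le> t powr 4" using t N by (intro powr_mono') auto
  also have "\<dots> = t ^ 4" using t by (simp add: powr_numeral)
  finally show ?thesis .
qed

lemma AE_regular: "AE z::plane in lebesgue. fst z \<noteq> - x0 \<and> snd z \<noteq> y0"
proof -
  have "negligible ({z::plane. fst z = - x0} \<union> {z. snd z = (\<lambda>_. y0) (fst z)})"
    by (intro negligible_Un negligible_vertical_line negligible_graph) auto
  then have "{z::plane. fst z = - x0} \<union> {z. snd z = (\<lambda>_. y0) (fst z)} \<in> null_sets lebesgue"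
    by (simp add: negligible_iff_null_sets)
  from AE_not_in[OF this] show ?thesis by eventually_elim auto
qed

lemma MCP_sufficient:
  assumes K: "K \<le> 0" and N: "N \<ge> 5"
  shows "grushin_MCP K N"
  unfolding grushin_MCP_def
proof (intro allI ballI impI)
  fix p :: plane and B :: "plane set" and t :: real
  assume B: "B \<in> sets borel" and t01: "t \<in> {0..1}"
  obtain x0 y0 where p: "p = (x0, y0)" by fastforce
  have B': "B \<in> sets (borel \<Otimes>\<^sub>M borel)" using B unfolding borel_prod .
  show "(\<integral>\<^sup>+z\<in>B. ennreal (t * mcp_factor K N t (grushin_dist p z)) \<partial>lebesgue)
      \<le> emeasure lebesgue (intermediate_points t {p} B)"
  proof (cases "t = 0")
    case False
    then have t: "0 < t" "t \<le> 1" using t01 by auto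
    have "(\<integral>\<^sup>+z\<in>B. ennreal (t * mcp_factor K N t (grushin_dist p z)) \<partial>lebesgue) \<le>
        (\<integral>\<^sup>+z. ennreal (t ^ 5) * indicator B z \<partial>lebesgue)"
    proof (rule nn_integral_mono_AE)
      show "AE z in lebesgue. ennreal (t * mcp_factor K N t (grushin_dist p z)) * indicator B z
          \<le> ennreal (t ^ 5) * indicator B z"
        using AE_regular[of x0 y0]
      proof eventually_elim
        fix z assume z: "fst z \<noteq> - x0 \<and> snd z \<noteq> y0"
        define \<theta> where "\<theta> = angle x0 y0 z"
        have \<theta>: "\<bar>\<theta>\<bar> < pi" "height x0 (fst z) \<theta> = snd z - y0"
          using angle[of z x0 y0] z by (auto simp: \<theta>_def)
        then have "\<theta> \<noteq> 0" using z by auto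
        have "grushin_dist p z = chord x0 (fst z) \<theta>"
          using grushin_dist_angular[OF \<theta>(1) \<open>\<theta> \<noteq> 0\<close>, of x0 y0 "fst z"] \<theta>(2) by (simp add: p)
        then have "grushin_dist p z > 0" using chord_pos[OF \<theta>(1) \<open>\<theta> \<noteq> 0\<close>] z by simp
        then have "t * mcp_factor K N t (grushin_dist p z) \<le> t * t ^ 4"
          using mcp_factor_le[OF K N t] t by (intro mult_left_mono) auto
        also have "\<dots> = t ^ 5" by (simp add: power_numeral_reduce)
        finally show "ennreal (t * mcp_factor K N t (grushin_dist p z)) * indicator B z
          \<le> ennreal (t ^ 5) * indicator B z"
          by (intro mult_right_mono ennreal_leI) auto
      qed
    qed
    also have "\<dots> = ennreal (t ^ 5) * emeasure lborel B"
      using B by (simp add: nn_integral_cmult_indicator)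
    also have "\<dots> \<le> angular_integral x0 y0 B (weight x0 t)"
      unfolding emeasure_angular[OF B', of x0 y0]
      by (rule angular_integral_scaled_le[OF B']) (use t weight_ge[OF _ _ t] height'_nonneg in \<open>measurable, auto\<close>)
    also have "\<dots> = emeasure lebesgue (intermediate_points t {p} B)"
      unfolding p by (rule intermediate_points_measure[OF B t, symmetric])
    finally show ?thesis .
  qed simp
qed

section \<open>Necessity\<close>

text \<open>A box in angular coordinates, written with the inverse coordinates in order to be Borel by definition.\<close>

definition angular_box :: "real \<Rightarrow> real \<Rightarrow> real set \<Rightarrow> real set \<Rightarrow> plane set" where
  "angular_box x0 y0 I J = {z. fst z \<in> I \<and> angle x0 y0 z \<in> J}"

lemma sets_angular_box:
  assumes [measurable]: "I \<in> sets borel" "J \<in> sets borel"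
  shows "angular_box x0 y0 I J \<in> sets (borel \<Otimes>\<^sub>M borel)"
proof -
  have "{z \<in> space (borel \<Otimes>\<^sub>M borel). fst z \<in> I \<and> angle x0 y0 z \<in> J} \<in> sets (borel \<Otimes>\<^sub>M borel)"
    by measurable
  then show ?thesis by (simp add: angular_box_def space_pair_measure)
qed

lemma indicator_angular_box:
  assumes "- x0 \<notin> I" "J \<subseteq> {- pi<..<pi}"
  shows "indicator (angular_box x0 y0 I J) (x, y0 + height x0 x \<omega>) * indicator {- pi<..<pi} \<omega> =
    (indicator I x * indicator J \<omega> :: ennreal)"
proof (cases "x \<in> I \<and> \<omega> \<in> {- pi<..<pi}")
  case True
  then have "x \<noteq> - x0" "\<bar>\<omega>\<bar> < pi" using assms by auto
  then have "angle x0 y0 (x, y0 + height x0 x \<omega>) = \<omega>" by (rule angle_eq)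
  then show ?thesis using True by (auto simp: angular_box_def indicator_def)
qed (use assms in \<open>auto simp: angular_box_def indicator_def\<close>)

lemma nn_integral_box:
  fixes a b c d k :: real
  assumes "a \<le> b" "c \<le> d" "0 \<le> k"
  shows "(\<integral>\<^sup>+\<omega>. (\<integral>\<^sup>+x. indicator {a..b} x * indicator {c..d} \<omega> * ennreal k \<partial>lborel) \<partial>lborel)
    = ennreal (k * ((b - a) * (d - c)))"
proof -
  have "(\<integral>\<^sup>+x. indicator {a..b} x * indicator {c..d} \<omega> * ennreal k \<partial>lborel) =
      ennreal k * ennreal (b - a) * indicator {c..d} \<omega>" for \<omega>
  proof -
    have "(\<integral>\<^sup>+x. indicator {a..b} x * indicator {c..d} \<omega> * ennreal k \<partial>lborel) =
        (\<integral>\<^sup>+x. (ennreal k * indicator {c..d} \<omega>) * indicator {a..b} x \<partial>lborel)"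
      by (rule nn_integral_cong) (simp add: mult_ac)
    also have "\<dots> = (ennreal k * indicator {c..d} \<omega>) * emeasure lborel {a..b}"
      by (rule nn_integral_cmult_indicator) simp
    finally show ?thesis using assms by (simp add: mult_ac)
  qed
  then have "(\<integral>\<^sup>+\<omega>. (\<integral>\<^sup>+x. indicator {a..b} x * indicator {c..d} \<omega> * ennreal k \<partial>lborel) \<partial>lborel)
      = (\<integral>\<^sup>+\<omega>. ennreal k * ennreal (b - a) * indicator {c..d} \<omega> \<partial>lborel)"
    by simp
  also have "\<dots> = ennreal k * ennreal (b - a) * emeasure lborel {c..d}"
    by (rule nn_integral_cmult_indicator) simp
  finally show ?thesis using assms by (simp add: ennreal_mult mult.assoc)
qed

lemma angular_box_integral_le:
  assumes "- x0 \<notin> {a..b}" "{c..d} \<subseteq> {- pi<..<pi}" "a \<le> b" "c \<le> d" "0 \<le> k"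
    and le: "\<And>x \<omega>. x \<in> {a..b} \<Longrightarrow> \<omega> \<in> {c..d} \<Longrightarrow> w x \<omega> \<le> k"
  shows "angular_integral x0 y0 (angular_box x0 y0 {a..b} {c..d}) w \<le> ennreal (k * ((b - a) * (d - c)))"
  unfolding angular_integral_def nn_integral_box[OF assms(3-5), symmetric]
proof (intro nn_integral_mono)
  fix \<omega> x
  have "indicator (angular_box x0 y0 {a..b} {c..d}) (x, y0 + height x0 x \<omega>) *
     ennreal (w x \<omega>) * indicator {- pi<..<pi} \<omega> = indicator {a..b} x * indicator {c..d} \<omega> * ennreal (w x \<omega>)"
    using indicator_angular_box[OF assms(1,2), of y0 x \<omega>] by (simp add: mult_ac)
  also have "\<dots> \<le> indicator {a..b} x * indicator {c..d} \<omega> * ennreal k"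
    using le by (auto simp: indicator_def ennreal_leI)
  finally show "indicator (angular_box x0 y0 {a..b} {c..d}) (x, y0 + height x0 x \<omega>) *
     ennreal (w x \<omega>) * indicator {- pi<..<pi} \<omega> \<le> indicator {a..b} x * indicator {c..d} \<omega> * ennreal k" .
qed

lemma angular_box_integral_ge:
  assumes "- x0 \<notin> {a..b}" "{c..d} \<subseteq> {- pi<..<pi}" "a \<le> b" "c \<le> d" "0 \<le> k"
    and le: "\<And>x \<omega>. x \<in> {a..b} \<Longrightarrow> \<omega> \<in> {c..d} \<Longrightarrow> k \<le> w x \<omega>"
  shows "ennreal (k * ((b - a) * (d - c))) \<le>
    angular_integral x0 y0 (angular_box x0 y0 {a..b} {c..d}) w"
  unfolding angular_integral_def nn_integral_box[OF assms(3-5), symmetric]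
proof (intro nn_integral_mono)
  fix \<omega> x
  have "indicator {a..b} x * indicator {c..d} \<omega> * ennreal k \<le> indicator {a..b} x * indicator {c..d} \<omega> * ennreal (w x \<omega>)"
    using le by (auto simp: indicator_def ennreal_leI)
  also have "\<dots> = indicator (angular_box x0 y0 {a..b} {c..d}) (x, y0 + height x0 x \<omega>) *
     ennreal (w x \<omega>) * indicator {- pi<..<pi} \<omega>"
    using indicator_angular_box[OF assms(1,2), of y0 x \<omega>] by (simp add: mult_ac)
  finally show "indicator {a..b} x * indicator {c..d} \<omega> * ennreal k \<le>
     indicator (angular_box x0 y0 {a..b} {c..d}) (x, y0 + height x0 x \<omega>) *
     ennreal (w x \<omega>) * indicator {- pi<..<pi} \<omega>" .
qed

lemma isCont_height'_comp:
  assumes "isCont f p" "isCont g p" "\<bar>g p\<bar> < pi"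
  shows "isCont (\<lambda>p. height' x0 (f p) (g p)) p"
  unfolding height'_def
  by (intro continuous_intros assms(1) isCont_o2[OF assms(2) isCont_sym_height'[OF assms(3)]]
      isCont_o2[OF assms(2) isCont_skew_height'[OF assms(3)]]) simp_all

lemma eventually_box:
  fixes P :: "plane \<Rightarrow> bool"
  assumes "eventually P (nhds (x, \<theta>))"
  obtains \<delta> where "\<delta> > 0" "\<And>u v. u \<in> {x - \<delta>..x + \<delta>} \<Longrightarrow> v \<in> {\<theta> - \<delta>..\<theta> + \<delta>} \<Longrightarrow> P (u, v)"
proof -
  obtain e where e: "e > 0" "\<And>p. dist p (x, \<theta>) < e \<Longrightarrow> P p"
    using assms by (auto simp: eventually_nhds_metric)
  show thesis
  proof (rule that[of "e / 3"])
    fix u v assume uv: "u \<in> {x - e / 3..x + e / 3}" "v \<in> {\<theta> - e / 3..\<theta> + e / 3}"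
    have "dist (u, v) (x, \<theta>) \<le> \<bar>u - x\<bar> + \<bar>v - \<theta>\<bar>"
      using norm_Pair_le[of "u - x" "v - \<theta>"] by (simp add: dist_norm)
    also have "\<dots> \<le> e / 3 + e / 3" using uv unfolding atLeastAtMost_iff by arith
    finally show "P (u, v)" using e by (intro e(2)) linarith
  qed (use e in simp)
qed

lemma isCont_s_fun: "isCont (s_fun K) u"
  unfolding s_fun_def[abs_def] by (cases "K > 0"; cases "K = 0") (auto intro!: continuous_intros)

lemma s_fun_pos:
  assumes "N > 1" "r > 0" "K > 0 \<Longrightarrow> r < pi * sqrt ((N - 1) / K)"
  shows "s_fun K (r / sqrt (N - 1)) > 0"
proof -
  have u: "r / sqrt (N - 1) > 0" using assms by simp
  consider "K > 0" | "K = 0" | "K < 0" by linarith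
  then show ?thesis
  proof cases
    case 1
    have "sqrt K * (r / sqrt (N - 1)) < pi"
      using assms(3)[OF 1] 1 assms(1) by (simp add: real_sqrt_divide field_simps)
    then have "sin (sqrt K * (r / sqrt (N - 1))) > 0" using u 1 by (intro sin_gt_zero mult_pos_pos) auto
    then show ?thesis using 1 by (simp add: s_fun_def)
  next
    case 3
    have "sqrt (- K) * (r / sqrt (N - 1)) > 0" using u 3 by (intro mult_pos_pos) auto
    then have "sinh (sqrt (- K) * (r / sqrt (N - 1))) > 0" by (simp only: sinh_real_pos_iff)
    then show ?thesis using 3 by (simp add: s_fun_def)
  qed (use u in \<open>auto simp: s_fun_def\<close>)
qed

text \<open>Positive distances below the critical one keep the denominator away from \<open>0\<close>, so that the factor is
  locally a power of a quotient of continuous functions.\<close>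

lemma isCont_mcp_factor:
  assumes N: "N > 1 \<or> (K \<le> 0 \<and> N = 1)" and r: "r > 0" "K > 0 \<Longrightarrow> r < pi * sqrt ((N - 1) / K)"
    and t: "0 < t" "t \<le> 1"
  shows "isCont (mcp_factor K N t) r" and "mcp_factor K N t r > 0"
proof -
  have "isCont (mcp_factor K N t) r \<and> mcp_factor K N t r > 0"
  proof (cases "K \<le> 0 \<and> N = 1")
    case True
    then show ?thesis by (simp add: mcp_factor_def[abs_def])
  next
    case False
    then have N: "N > 1" using N by auto
    let ?g = "\<lambda>r. s_fun K (r / sqrt (N - 1))"
    have g: "isCont ?g u" for u
      by (rule isCont_o2[OF _ isCont_s_fun]) (use N in \<open>auto intro!: continuous_intros\<close>)
    have gt: "isCont (\<lambda>r. s_fun K (t * r / sqrt (N - 1))) u" for u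
      by (rule isCont_o2[OF _ isCont_s_fun]) (use N in \<open>auto intro!: continuous_intros\<close>)
    have pos: "?g r > 0" by (rule s_fun_pos[OF N r])
    have post: "s_fun K (t * r / sqrt (N - 1)) > 0"
    proof (rule s_fun_pos[OF N])
      show "t * r > 0" using t r by simp
      have "t * r \<le> 1 * r" using t r by (intro mult_right_mono) auto
      then show "t * r < pi * sqrt ((N - 1) / K)" if "K > 0" using r(2)[OF that] by simp
    qed
    have "(?g \<longlongrightarrow> ?g r) (nhds r)"
      using g[of r] by (simp add: isCont_def tendsto_at_iff_tendsto_nhds[of ?g])
    from order_tendstoD(1)[OF this pos] have "\<forall>\<^sub>F u in nhds r. ?g u > 0" .
    then have ev: "\<forall>\<^sub>F u in nhds r. mcp_factor K N t u = (s_fun K (t * u / sqrt (N - 1)) / ?g u) powr (N - 1)"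
      by eventually_elim (rule mcp_factor_eq[OF N], simp)
    have "isCont (\<lambda>u. (s_fun K (t * u / sqrt (N - 1)) / ?g u) powr (N - 1)) r"
      using pos post by (intro continuous_intros g gt) auto
    then have "isCont (mcp_factor K N t) r" using isCont_cong[OF ev] by simp
    moreover have "mcp_factor K N t r > 0"
      using mcp_factor_eq[OF N, of K r t] pos post by simp
    ultimately show ?thesis by blast
  qed
  then show "isCont (mcp_factor K N t) r" "mcp_factor K N t r > 0" by auto
qed

text \<open>If the inequality failed at a point, continuity would give constants that separate all three factors
  on a small box around the point, and the box would violate the measure contraction property.\<close>

lemma MCP_pointwise:
  assumes mcp: "grushin_MCP K N" and N: "N > 1 \<or> (K \<le> 0 \<and> N = 1)" and t: "0 < t" "t \<le> 1"
    and \<theta>: "\<bar>\<theta>\<bar> < pi" "\<theta> \<noteq> 0" and x: "x \<noteq> - x0"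
    and R: "K > 0 \<Longrightarrow> chord x0 x \<theta> < pi * sqrt ((N - 1) / K)"
  shows "t * mcp_factor K N t (chord x0 x \<theta>) * height' x0 x \<theta> \<le> weight x0 t x \<theta>"
proof (rule ccontr)
  assume "\<not> ?thesis"
  then have less: "weight x0 t x \<theta> < t * mcp_factor K N t (chord x0 x \<theta>) * height' x0 x \<theta>" by simp
  note nz = angle_scale_bounds[OF t \<theta>]
  define p where "p = (x, \<theta>)"
  define f where "f p = t * mcp_factor K N t (chord x0 (fst p) (snd p))" for p
  define H where "H p = height' x0 (fst p) (snd p)" for p
  define W where "W p = weight x0 t (fst p) (snd p)" for p
  have r: "chord x0 x \<theta> > 0" by (rule chord_pos[OF \<theta> x])
  have cc: "isCont (\<lambda>p. chord x0 (fst p) (snd p)) p"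
    unfolding chord_def using nz by (intro continuous_intros) (auto simp: p_def)
  have cf: "isCont f p"
    unfolding f_def
    by (intro continuous_intros isCont_o2[OF cc] isCont_mcp_factor(1)[OF N _ _ t]) (use r R in \<open>auto simp: p_def\<close>)
  have cH: "isCont H p"
    unfolding H_def by (intro isCont_height'_comp continuous_intros) (use \<theta> in \<open>auto simp: p_def\<close>)
  have cW: "isCont W p"
    unfolding W_def weight_def mid_def
    by (intro continuous_intros isCont_height'_comp) (use nz in \<open>auto simp: p_def\<close>)
  have fpos: "f p > 0" and Hpos: "H p > 0"
    using isCont_mcp_factor(2)[OF N r R t] height'_pos[OF \<theta>(1) x] t by (simp_all add: f_def H_def p_def)
  have "W p < f p * H p" using less by (simp add: W_def f_def H_def p_def)
  (* Constants with W p < w, w / m < h < H p and m < f p: the integral over a box on which they still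
     separate the three functions contradicts w < m * h. *)
  define m where "m = (W p / H p + f p) / 2"
  have Wnn: "W p \<ge> 0"
    unfolding W_def weight_def using t height'_nonneg[OF nz(1)] by (simp add: p_def)
  have WH: "W p / H p < f p" using \<open>W p < f p * H p\<close> Hpos by (simp add: field_simps)
  then have m: "W p < m * H p" "m < f p" "m > 0"
    using Hpos fpos Wnn by (auto simp: m_def field_simps add_nonneg_pos)
  define w where "w = (W p + m * H p) / 2"
  have w: "W p < w" "w < m * H p" "w \<ge> 0" using m Wnn by (auto simp: w_def)
  have "w / m < H p" using w m by (simp add: field_simps)
  then obtain h where h: "w / m < h" and hH: "h < H p" using dense by blast
  have "w / m \<ge> 0" using w m by simp
  then have "h > 0" using h by linarith
  have nh: "(g \<longlongrightarrow> g p) (nhds p)" if "isCont g p" for g :: "plane \<Rightarrow> real"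
    using that by (simp add: isCont_def tendsto_at_iff_tendsto_nhds)
  have "\<forall>\<^sub>F q in nhds p. fst q \<noteq> - x0 \<and> snd q \<noteq> 0 \<and> \<bar>snd q\<bar> < pi"
  proof -
    have "isCont fst p" "isCont snd p" "isCont (\<lambda>q. \<bar>snd q\<bar>) p" by (intro continuous_intros)+
    note c = this[THEN nh]
    have "\<forall>\<^sub>F q in nhds p. fst q \<noteq> - x0"
      using tendsto_imp_eventually_ne[OF c(1), of "- x0"] x by (simp add: p_def)
    moreover have "\<forall>\<^sub>F q in nhds p. snd q \<noteq> 0"
      using tendsto_imp_eventually_ne[OF c(2), of 0] \<theta> by (simp add: p_def)
    moreover have "\<forall>\<^sub>F q in nhds p. \<bar>snd q\<bar> < pi"
      using order_tendstoD(2)[OF c(3), of pi] \<theta> by (simp add: p_def)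
    ultimately show ?thesis by eventually_elim simp
  qed
  moreover have "\<forall>\<^sub>F q in nhds p. K > 0 \<longrightarrow> chord x0 (fst q) (snd q) < pi * sqrt ((N - 1) / K)"
  proof (cases "K > 0")
    case True
    have "chord x0 (fst p) (snd p) < pi * sqrt ((N - 1) / K)" using R[OF True] by (simp add: p_def)
    from order_tendstoD(2)[OF nh[OF cc] this] show ?thesis by eventually_elim simp
  qed simp
  moreover have "\<forall>\<^sub>F q in nhds p. W q < w" by (rule order_tendstoD(2)[OF nh[OF cW] w(1)])
  moreover have "\<forall>\<^sub>F q in nhds p. h < H q" by (rule order_tendstoD(1)[OF nh[OF cH] hH])
  moreover have "\<forall>\<^sub>F q in nhds p. m < f q" by (rule order_tendstoD(1)[OF nh[OF cf] m(2)])
  moreover have "\<forall>\<^sub>F q in nhds p. H q < H p + 1" by (rule order_tendstoD(2)[OF nh[OF cH]]) simp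
  ultimately have "\<forall>\<^sub>F q in nhds p. (fst q \<noteq> - x0 \<and> snd q \<noteq> 0 \<and> \<bar>snd q\<bar> < pi) \<and>
      (K > 0 \<longrightarrow> chord x0 (fst q) (snd q) < pi * sqrt ((N - 1) / K)) \<and> W q < w \<and> h < H q \<and> m < f q \<and> H q < H p + 1"
    by eventually_elim blast
  then obtain \<delta> where "\<delta> > 0" and \<delta>: "\<And>u v. u \<in> {x - \<delta>..x + \<delta>} \<Longrightarrow> v \<in> {\<theta> - \<delta>..\<theta> + \<delta>} \<Longrightarrow>
      (u \<noteq> - x0 \<and> v \<noteq> 0 \<and> \<bar>v\<bar> < pi) \<and>
      (K > 0 \<longrightarrow> chord x0 u v < pi * sqrt ((N - 1) / K)) \<and> W (u, v) < w \<and> h < H (u, v) \<and> m < f (u, v) \<and> H (u, v) < H p + 1"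
    unfolding p_def by (rule eventually_box) auto
  define I J where "I = {x - \<delta>..x + \<delta>}" and "J = {\<theta> - \<delta>..\<theta> + \<delta>}"
  have xI: "x \<in> I" and \<theta>J: "\<theta> \<in> J" using \<open>\<delta> > 0\<close> by (auto simp: I_def J_def)
  have IJ: "- x0 \<notin> I" "J \<subseteq> {- pi<..<pi}"
  proof -
    show "- x0 \<notin> I" using \<delta>[OF _ \<theta>J[unfolded J_def]] by (auto simp: I_def)
    show "J \<subseteq> {- pi<..<pi}"
    proof
      fix v assume "v \<in> J"
      then have "\<bar>v\<bar> < pi" using \<delta>[OF xI[unfolded I_def]] by (simp add: J_def)
      then show "v \<in> {- pi<..<pi}" by auto
    qed
  qed
  define B where "B = angular_box x0 0 I J"
  have B': "B \<in> sets (borel \<Otimes>\<^sub>M borel)" unfolding B_def by (rule sets_angular_box) (auto simp: I_def J_def)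
  then have B: "B \<in> sets borel" unfolding borel_prod .
  define A where "A = (x + \<delta> - (x - \<delta>)) * (\<theta> + \<delta> - (\<theta> - \<delta>))"
  have A: "A > 0" using \<open>\<delta> > 0\<close> by (simp add: A_def)
  note box = IJ[unfolded I_def J_def]
  have le: "x - \<delta> \<le> x + \<delta>" "\<theta> - \<delta> \<le> \<theta> + \<delta>" using \<open>\<delta> > 0\<close> by auto
  have Bge: "ennreal (h * A) \<le> emeasure lborel B"
    unfolding emeasure_angular[OF B', of x0 0] unfolding B_def I_def J_def A_def
    by (rule angular_box_integral_ge[OF box le]) (use \<open>h > 0\<close> \<delta> in \<open>auto simp: H_def intro: less_imp_le\<close>)
  have Ble: "emeasure lborel B \<le> ennreal ((H p + 1) * A)"
    unfolding emeasure_angular[OF B', of x0 0] unfolding B_def I_def J_def A_def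
    by (rule angular_box_integral_le[OF box le]) (use Hpos \<delta> in \<open>auto simp: H_def intro: less_imp_le\<close>)
  have Bpos: "0 < emeasure lebesgue B" and Bfin: "emeasure lebesgue B < \<infinity>"
  proof -
    have "0 < ennreal (h * A)" using \<open>h > 0\<close> A by simp
    then have "0 < emeasure lborel B" using Bge by (rule less_le_trans)
    moreover have "emeasure lborel B < \<infinity>" using Ble by (rule le_less_trans) simp
    ultimately show "0 < emeasure lebesgue B" "emeasure lebesgue B < \<infinity>" using B by simp_all
  qed
  have Z: "emeasure lebesgue (intermediate_points t {(x0, 0)} B) \<le> ennreal (w * A)"
    unfolding intermediate_points_measure[OF B t, of x0 0] unfolding B_def I_def J_def A_def
    by (rule angular_box_integral_le[OF box le]) (use w \<delta> in \<open>auto simp: W_def intro: less_imp_le\<close>)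
  have dist: "grushin_dist (x0, 0) z = chord x0 (fst z) (angle x0 0 z)"
    and zI: "fst z \<in> {x - \<delta>..x + \<delta>}" and zJ: "angle x0 0 z \<in> {\<theta> - \<delta>..\<theta> + \<delta>}" if "z \<in> B" for z
  proof -
    show zI: "fst z \<in> {x - \<delta>..x + \<delta>}" and zJ: "angle x0 0 z \<in> {\<theta> - \<delta>..\<theta> + \<delta>}"
      using that by (auto simp: B_def angular_box_def I_def J_def)
    note d = \<delta>[OF zI zJ]
    have "height x0 (fst z) (angle x0 0 z) = snd z - 0" by (rule angle(2)) (use d in simp)
    then show "grushin_dist (x0, 0) z = chord x0 (fst z) (angle x0 0 z)"
      using grushin_dist_angular[of "angle x0 0 z" x0 0 "fst z"] d by simp
  qed
  have sub: "B \<subseteq> {z. grushin_dist (x0, 0) z < pi * sqrt ((N - 1) / K)}" if "K > 0"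
    using \<delta>[OF zI zJ] dist that by auto
  have "(\<integral>\<^sup>+z\<in>B. ennreal (t * mcp_factor K N t (grushin_dist (x0, 0) z)) \<partial>lebesgue)
      \<le> emeasure lebesgue (intermediate_points t {(x0, 0)} B)"
    using mcp B Bpos Bfin sub t unfolding grushin_MCP_def by simp
  moreover have "ennreal m * emeasure lebesgue B \<le>
      (\<integral>\<^sup>+z\<in>B. ennreal (t * mcp_factor K N t (grushin_dist (x0, 0) z)) \<partial>lebesgue)"
  proof -
    have "ennreal m * emeasure lebesgue B = (\<integral>\<^sup>+z. ennreal m * indicator B z \<partial>lebesgue)"
      using B by (subst nn_integral_cmult_indicator) auto
    also have "\<dots> \<le> (\<integral>\<^sup>+z\<in>B. ennreal (t * mcp_factor K N t (grushin_dist (x0, 0) z)) \<partial>lebesgue)"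
    proof (rule nn_integral_mono)
      fix z
      show "ennreal m * indicator B z \<le> ennreal (t * mcp_factor K N t (grushin_dist (x0, 0) z)) * indicator B z"
      proof (cases "z \<in> B")
        case True
        then have "m \<le> t * mcp_factor K N t (grushin_dist (x0, 0) z)"
          using \<delta>[OF zI[OF True] zJ[OF True]] dist[OF True] by (simp add: f_def)
        then show ?thesis by (intro mult_right_mono ennreal_leI) auto
      qed simp
    qed
    finally show ?thesis .
  qed
  moreover have "ennreal (m * (h * A)) \<le> ennreal m * emeasure lebesgue B"
    using Bge B m by (subst ennreal_mult') (auto intro!: mult_left_mono)
  ultimately have "ennreal (m * (h * A)) \<le> ennreal (w * A)" using Z by (meson order_trans)
  then have "m * (h * A) \<le> w * A" using w A by (simp add: ennreal_le_iff)
  then have "m * h \<le> w" using A by (simp add: mult.assoc[symmetric])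
  then show False using h m by (simp add: field_simps)
qed

text \<open>Take the origin as base point and end points of angle \<open>1\<close>. By dilation the density of the contraction
  by \<open>1 / 2\<close> is a fixed multiple of the density of the coordinates, whatever the distance \<open>r\<close>. The
  coefficient is \<open>(1 / (2 * cos (u / 2))) powr (N - 1)\<close> with \<open>u = r * sqrt K / sqrt (N - 1)\<close>, and it is
  unbounded as \<open>u\<close> tends to \<open>pi\<close>, that is, as \<open>r\<close> tends to the critical distance.\<close>

lemma MCP_imp_K_nonpos:
  assumes mcp: "grushin_MCP K N" and N: "N > 1 \<or> (K \<le> 0 \<and> N = 1)"
  shows "K \<le> 0"
proof (rule ccontr)
  assume "\<not> K \<le> 0"
  then have K: "K > 0" and N1: "N > 1" using N by auto
  define \<kappa> where "\<kappa> \<theta> = (sym_height' \<theta> + skew_height' \<theta>) / 4" for \<theta>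
  have h: "height' 0 x \<theta> = \<kappa> \<theta> * x\<^sup>2" for x \<theta> by (simp add: height'_def \<kappa>_def algebra_simps)
  have one: "\<bar>1\<bar> < pi" "(1::real) \<noteq> 0" using pi_gt3 by auto
  have \<kappa>1: "\<kappa> 1 > 0" using sym_height'_pos[OF one(1)] skew_height'_pos[OF one(1)] by (simp add: \<kappa>_def)
  have s1: "sin 1 > (0::real)" using pi_gt3 by (intro sin_gt_zero) auto
  define w where "w = 1 / 2 * \<bar>sin (1 / 2) / sin 1\<bar> * (\<kappa> (1 / 2) * (sin (1 / 2) / sin 1)\<^sup>2)"
  define M where "M = 2 * w / \<kappa> 1"
  have bound: "(1 / (2 * cos (u / 2))) powr (N - 1) \<le> M" if u: "0 < u" "u < pi" for u
  proof -
    define r where "r = u * sqrt (N - 1) / sqrt K"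
    have r: "r > 0" using u N1 K by (simp add: r_def)
    define x where "x = r * sin 1"
    have x: "x > 0" using r s1 by (simp add: x_def)
    have ch: "chord 0 x 1 = r" using r s1 by (simp add: chord_def x_def)
    have R: "r < pi * sqrt ((N - 1) / K)"
      using u N1 K by (simp add: r_def real_sqrt_divide divide_strict_right_mono)
    have "1 / 2 * mcp_factor K N (1 / 2) r * height' 0 x 1 \<le> weight 0 (1 / 2) x 1"
      using MCP_pointwise[OF mcp N _ _ one, of "1/2" x 0] x R ch by simp
    also have "weight 0 (1 / 2) x 1 = w * x\<^sup>2"
      by (simp add: weight_def mid_def h w_def power2_eq_square field_simps)
    finally have "1 / 2 * mcp_factor K N (1 / 2) r * \<kappa> 1 * x\<^sup>2 \<le> w * x\<^sup>2" by (simp add: h)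
    then have "1 / 2 * mcp_factor K N (1 / 2) r * \<kappa> 1 \<le> w" using x by simp
    then have "mcp_factor K N (1 / 2) r \<le> M" using \<kappa>1 by (simp add: M_def field_simps)
    moreover have "mcp_factor K N (1 / 2) r = (1 / (2 * cos (u / 2))) powr (N - 1)"
    proof -
      have a: "sqrt K * (r / sqrt (N - 1)) = u" "sqrt K * (1 / 2 * r / sqrt (N - 1)) = u / 2"
        using K N1 by (simp_all add: r_def)
      have e: "s_fun K (r / sqrt (N - 1)) = sin u / sqrt K" "s_fun K (1 / 2 * r / sqrt (N - 1)) = sin (u / 2) / sqrt K"
        unfolding s_fun_def a using K by simp_all
      have su: "sin u > 0" "sin (u / 2) > 0" using u by (auto intro: sin_gt_zero)
      have "sin u = 2 * sin (u / 2) * cos (u / 2)" using sin_double[of "u / 2"] by simp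
      then have "sin (u / 2) / sin u = 1 / (2 * cos (u / 2))" using su by simp
      then show ?thesis
        using mcp_factor_eq[OF N1, of K r "1/2"] e su K by simp
    qed
    ultimately show ?thesis by simp
  qed
  have "filterlim (\<lambda>u. (1 / (2 * cos (u / 2))) powr (N - 1)) at_top (at_left pi)"
    using N1 by real_asymp
  then have "\<forall>\<^sub>F u in at_left pi. (1 / (2 * cos (u / 2))) powr (N - 1) > M"
    by (simp add: filterlim_at_top_dense)
  moreover have "\<forall>\<^sub>F u in at_left pi. 0 < u \<and> u < pi"
    by (rule eventually_at_leftI[of 0]) auto
  ultimately have "\<forall>\<^sub>F u in at_left pi. False"
    by eventually_elim (use bound in force)
  then show False by simp
qed

text \<open>At small scales every bound \<open>K \<le> 0\<close> looks like \<open>K = 0\<close>.\<close>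

lemma mcp_factor_tendsto:
  assumes K: "K \<le> 0" and N: "N \<ge> 1" and t: "0 < t" "t \<le> 1" and D: "D > 0"
  shows "((\<lambda>c. mcp_factor K N t (c * D)) \<longlongrightarrow> t powr (N - 1)) (at_right 0)"
proof (cases "N = 1")
  case True
  then show ?thesis using K t by (simp add: mcp_factor_def)
next
  case False
  then have N1: "N > 1" using N by simp
  define k where "k = D / sqrt (N - 1)"
  have k: "k > 0" using D N1 by (simp add: k_def)
  have ev: "\<forall>\<^sub>F c in at_right 0. (s_fun K (t * (c * k)) / s_fun K (c * k)) powr (N - 1) = mcp_factor K N t (c * D)"
    using eventually_at_right_less[of "0::real"]
  proof eventually_elim
    fix c :: real assume c: "0 < c"
    have "s_fun K (c * D / sqrt (N - 1)) > 0"
      by (rule s_fun_pos[OF N1]) (use c D K in auto)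
    then show "(s_fun K (t * (c * k)) / s_fun K (c * k)) powr (N - 1) = mcp_factor K N t (c * D)"
      using mcp_factor_eq[OF N1, of K "c * D" t] by (simp add: k_def mult.assoc)
  qed
  have "((\<lambda>c. s_fun K (t * (c * k)) / s_fun K (c * k)) \<longlongrightarrow> t) (at_right 0)"
  proof (cases "K = 0")
    case True
    have "\<forall>\<^sub>F c in at_right (0::real). t = s_fun K (t * (c * k)) / s_fun K (c * k)"
      using eventually_at_right_less[of "0::real"] by eventually_elim (use True k in \<open>simp add: s_fun_def\<close>)
    then show ?thesis by (rule Lim_transform_eventually[OF tendsto_const])
  next
    case False
    define b where "b = sqrt (- K) * k"
    have b: "b > 0" using False K k by (simp add: b_def)
    have "((\<lambda>c. sinh (t * b * c) / sinh (b * c)) \<longlongrightarrow> t) (at_right 0)"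
      using t b by real_asymp
    then show ?thesis
      using False K by (simp add: s_fun_def b_def mult_ac)
  qed
  then have "((\<lambda>c. (s_fun K (t * (c * k)) / s_fun K (c * k)) powr (N - 1)) \<longlongrightarrow> t powr (N - 1)) (at_right 0)"
    by (intro tendsto_intros) (use t in auto)
  then show ?thesis by (rule Lim_transform_eventually[OF _ ev])
qed

text \<open>Apply the pointwise inequality to geodesics from abscissa \<open>c\<close> with \<open>q = - 3 * c / \<theta>\<close>, which is the
  null direction of the form in \<open>jac_form_nonneg\<close> to leading order: as \<open>\<theta>\<close> tends to \<open>0\<close> they approach the
  segment from \<open>(c, 0)\<close> to \<open>(- 2 * c, 0)\<close>. The densities are homogeneous in \<open>c\<close>, so \<open>c\<close> may tend to \<open>0\<close>
  first, which removes \<open>K\<close>; then \<open>\<theta>\<close> tends to \<open>0\<close>.\<close>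

lemma MCP_imp_N_ge_5:
  assumes mcp: "grushin_MCP K N" and K: "K \<le> 0" and N: "N \<ge> 1"
  shows "N \<ge> 5"
proof (rule ccontr)
  assume "\<not> N \<ge> 5"
  have N': "N > 1 \<or> (K \<le> 0 \<and> N = 1)" using K N by auto
  define j where "j t \<theta> = sin (t * \<theta>) - 3 * t * sin (t * \<theta>) + 9 * (sin (t * \<theta>) - t * \<theta> * cos (t * \<theta>)) / \<theta>\<^sup>2" for t \<theta> :: real
  have key: "t powr (N - 1) \<le> t - 3 * t\<^sup>2 + 3 * t ^ 3" if t: "0 < t" "t \<le> 1" for t
  proof -
    (* With this choice of q the density is c\<^sup>2 times a function of the angle, whose quotient by \<theta> has
       the limit u - 3 * u\<^sup>2 + 3 * u ^ 3. *)
    have jac_j: "jac c (- (3 * c) / \<theta>) (u * \<theta>) = c\<^sup>2 * j u \<theta>" if "\<theta> \<noteq> 0" for c u \<theta>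
      using that by (simp add: jac_def j_def power2_eq_square field_simps)
    have ev0: "\<forall>\<^sub>F \<theta> in at_right 0. t powr (N - 1) * j 1 \<theta> \<le> j t \<theta>"
    proof -
      (* The end point has abscissa c * (cos \<theta> - 3 * (sin \<theta> / \<theta>)), which is close to - 2 * c and
         therefore different from - c. *)
      have lim: "((\<lambda>\<theta>. cos \<theta> - 3 * (sin \<theta> / \<theta>)) \<longlongrightarrow> - 2) (at_right (0::real))" by real_asymp
      have "\<forall>\<^sub>F \<theta> in at_right 0. cos \<theta> - 3 * (sin \<theta> / \<theta>) < (-1::real)"
        by (rule order_tendstoD(2)[OF lim]) simp
      moreover have "\<forall>\<^sub>F \<theta> in at_right 0. 0 < \<theta> \<and> \<theta> < pi"
        by (rule eventually_at_rightI[of _ pi]) auto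
      ultimately show ?thesis
      proof eventually_elim
        fix \<theta> assume \<xi>: "cos \<theta> - 3 * (sin \<theta> / \<theta>) < - 1" and "0 < \<theta> \<and> \<theta> < pi"
        then have \<theta>: "0 < \<theta>" "\<theta> < pi" "\<bar>\<theta>\<bar> < pi" "\<theta> \<noteq> 0" by auto
        have s: "sin \<theta> > 0" using \<theta> by (intro sin_gt_zero)
        define D where "D = sqrt (\<theta>\<^sup>2 + 9)"
        have D: "D > 0" by (simp add: D_def add_nonneg_pos)
        have ineq: "mcp_factor K N t (c * D) * j 1 \<theta> \<le> j t \<theta>" if c: "c > 0" for c
        proof -
          define q where "q = - (3 * c) / \<theta>"
          define x where "x = wave c q \<theta>"
          have xc: "x = c * (cos \<theta> - 3 * (sin \<theta> / \<theta>))" using \<theta> by (simp add: x_def wave_def q_def algebra_simps)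
          have "x \<noteq> - c"
          proof
            assume "x = - c"
            then have "c * (cos \<theta> - 3 * (sin \<theta> / \<theta>)) = c * (- 1)" using xc by simp
            with c have "cos \<theta> - 3 * (sin \<theta> / \<theta>) = - 1" by (simp only: mult_cancel_left) auto
            then show False using \<xi> by simp
          qed
          have ch: "chord c x \<theta> = c * D"
          proof -
            have "(x - c * cos \<theta>) / sin \<theta> = q" using s by (simp add: x_def wave_def)
            moreover have "c\<^sup>2 + q\<^sup>2 = (c / \<theta>)\<^sup>2 * (\<theta>\<^sup>2 + 9)"
              using \<theta> by (simp add: q_def power2_eq_square field_simps)
            ultimately show ?thesis
              using \<theta> c by (simp add: chord_def D_def real_sqrt_mult)
          qed
          have "t * mcp_factor K N t (c * D) * height' c x \<theta> \<le> weight c t x \<theta>"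
            using MCP_pointwise[OF mcp N' t \<theta>(3,4) \<open>x \<noteq> - c\<close>] K ch by simp
          moreover have "height' c x \<theta> = c\<^sup>2 * j 1 \<theta> / sin \<theta>"
            using sin_mult_height'[OF \<theta>(3,4), of c q] jac_j[OF \<theta>(4), of c 1] s
            by (simp add: x_def q_def field_simps)
          moreover have "weight c t x \<theta> = t * (c\<^sup>2 * j t \<theta>) / sin \<theta>"
            using weight_wave[OF \<theta>(1,2) t, of c q] jac_j[OF \<theta>(4), of c t] by (simp add: x_def q_def)
          ultimately have "(t * c\<^sup>2 / sin \<theta>) * (mcp_factor K N t (c * D) * j 1 \<theta>) \<le> (t * c\<^sup>2 / sin \<theta>) * j t \<theta>"
            by (simp add: mult_ac)
          moreover have "t * c\<^sup>2 / sin \<theta> > 0" using t c s by simp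
          ultimately show ?thesis by (rule mult_left_le_imp_le)
        qed
        show "t powr (N - 1) * j 1 \<theta> \<le> j t \<theta>"
        proof (rule tendsto_upperbound)
          show "((\<lambda>c. mcp_factor K N t (c * D) * j 1 \<theta>) \<longlongrightarrow> t powr (N - 1) * j 1 \<theta>) (at_right 0)"
            by (intro tendsto_intros mcp_factor_tendsto K N t D)
          show "\<forall>\<^sub>F c in at_right 0. mcp_factor K N t (c * D) * j 1 \<theta> \<le> j t \<theta>"
            using eventually_at_right_less[of "0::real"] by eventually_elim (rule ineq)
        qed simp
      qed
    qed
    have jlim: "((\<lambda>\<theta>. j u \<theta> / \<theta>) \<longlongrightarrow> u - 3 * u\<^sup>2 + 3 * u ^ 3) (at_right 0)" if u: "u > 0" for u
    proof -
      have "((\<lambda>\<theta>. sin (u * \<theta>) / \<theta>) \<longlongrightarrow> u) (at_right 0)" using u by real_asymp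
      moreover have "((\<lambda>\<theta>. (sin (u * \<theta>) - u * \<theta> * cos (u * \<theta>)) / \<theta> ^ 3) \<longlongrightarrow> u ^ 3 / 3) (at_right 0)"
        using u by (real_asymp; simp add: power3_eq_cube)
      ultimately have "((\<lambda>\<theta>. sin (u * \<theta>) / \<theta> - 3 * u * (sin (u * \<theta>) / \<theta>) +
          9 * ((sin (u * \<theta>) - u * \<theta> * cos (u * \<theta>)) / \<theta> ^ 3)) \<longlongrightarrow> u - 3 * u * u + 9 * (u ^ 3 / 3)) (at_right 0)"
        by (intro tendsto_add tendsto_diff tendsto_mult tendsto_const)
      moreover have "sin (u * \<theta>) / \<theta> - 3 * u * (sin (u * \<theta>) / \<theta>) +
          9 * ((sin (u * \<theta>) - u * \<theta> * cos (u * \<theta>)) / \<theta> ^ 3) = j u \<theta> / \<theta>" for \<theta>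
        by (simp add: j_def add_divide_distrib diff_divide_distrib power2_eq_square power3_eq_cube)
      ultimately show ?thesis by (simp add: power2_eq_square mult.assoc)
    qed
    have "t powr (N - 1) * (1 - 3 * 1\<^sup>2 + 3 * 1 ^ 3) \<le> t - 3 * t\<^sup>2 + 3 * t ^ 3"
    proof (rule tendsto_le)
      show "((\<lambda>\<theta>. t powr (N - 1) * (j 1 \<theta> / \<theta>)) \<longlongrightarrow> t powr (N - 1) * (1 - 3 * 1\<^sup>2 + 3 * 1 ^ 3)) (at_right 0)"
        by (intro tendsto_mult tendsto_const jlim) simp
      show "((\<lambda>\<theta>. j t \<theta> / \<theta>) \<longlongrightarrow> t - 3 * t\<^sup>2 + 3 * t ^ 3) (at_right 0)" by (rule jlim[OF t(1)])
      show "\<forall>\<^sub>F \<theta> in at_right 0. t powr (N - 1) * (j 1 \<theta> / \<theta>) \<le> j t \<theta> / \<theta>"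
        using ev0 eventually_at_right_less[of "0::real"]
        by eventually_elim (simp add: divide_right_mono)
    qed simp
    then show ?thesis by simp
  qed
  define f where "f t = t - 3 * t\<^sup>2 + 3 * t ^ 3 - t powr (N - 1)" for t :: real
  have "(f has_real_derivative 5 - N) (at 1)"
    unfolding f_def by (auto intro!: derivative_eq_intros)
  then obtain d where d: "d > 0" "\<And>h. 0 < h \<Longrightarrow> h < d \<Longrightarrow> f (1 - h) < f 1"
    using DERIV_pos_inc_left[of f "5 - N" 1] \<open>\<not> N \<ge> 5\<close> by auto
  define h where "h = min d 1 / 2"
  have h: "0 < h" "h < d" "h < 1" using d(1) by (auto simp: h_def)
  have "f 1 = 0" by (simp add: f_def)
  then have "f (1 - h) < 0" using d(2)[OF h(1,2)] by simp
  moreover have "f (1 - h) \<ge> 0" using key[of "1 - h"] h by (simp add: f_def)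
  ultimately show False by simp
qed

theorem corollary66:
  fixes K N :: real
  assumes "N > 1 \<or> (K \<le> 0 \<and> N = 1)"
  shows "grushin_MCP K N \<longleftrightarrow> N \<ge> 5 \<and> K \<le> 0"
proof
  assume mcp: "grushin_MCP K N"
  have "K \<le> 0" by (rule MCP_imp_K_nonpos[OF mcp assms])
  moreover have "N \<ge> 5" by (rule MCP_imp_N_ge_5[OF mcp \<open>K \<le> 0\<close>]) (use assms in auto)
  ultimately show "N \<ge> 5 \<and> K \<le> 0" by simp
next
  assume "N \<ge> 5 \<and> K \<le> 0"
  then show "grushin_MCP K N" by (intro MCP_sufficient) auto
qed

end
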